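(* Let $\mathbb T$ be the triangular lattice, embedded in $\mathbb R^2$ so that its sites are the centers of the hexagonal faces of the hexagonal lattice $\mathbb H$, and for $\delta>0$ let $\delta\mathbb T$, $\delta\mathbb H$ be the rescaled lattices. Let $\sigma^0\in\{-1,+1\}^{\mathbb T}$ have i.i.d. coordinates with $\mu^0(\sigma^0_x=+1)=1/2$, and let $\sigma^n=\mathrm T^n\sigma^0$, $n\ge 1$, and $\sigma^\infty=\lim_n\sigma^n$ (which exists almost surely, each spin flipping only finitely often), where $\mathrm T$ is the cellular automaton described in the context. For $n\in\{0,1,2,\dots\}\cup\{\infty\}$ and $\delta>0$, let $\mathcal F^n_\delta$ be the (closed) set of curves in $\dot{\mathbb R}^2$ formed by the b-paths of the configuration $\sigma^n$ placed on $\delta\mathbb T$. Then for $\mu^0$-almost every $\sigma^0$, $$\lim_{\delta\to 0}\operatorname{dist}(\mathcal F^0_\delta,\mathcal F^n_\delta)=0\quad\text{for every } n\in\{1,2,\dots\}\cup\{\infty\}.$$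
   Context: Each site $x$ of $\mathbb T$ has a set $\mathcal N(x)$ of six nearest neighbors. The cellular automaton $\mathrm T:\{-1,+1\}^{\mathbb T}\to\{-1,+1\}^{\mathbb T}$ acts synchronously: $(\mathrm T\sigma)_x=\sigma_x$ if $x$ has at least two neighbors $y_1,y_2$ with $\sigma_{y_1}=\sigma_{y_2}=\sigma_x$ and $y_1,y_2$ not neighbors of each other; otherwise $(\mathrm T\sigma)_x=-\sigma_x$. For neighboring sites $x,y$, $\eta^*_{x,y}$ denotes the edge of $\mathbb H$ (dual edge) that is the perpendicular bisector of the edge $xy$. A b-path (boundary path) of a configuration $\sigma$ is a sequence $(\eta^*_{\zeta_0,\xi_0},\dots,\eta^*_{\zeta_k,\xi_k})$ of distinct dual edges such that for each $i$ either $\zeta_{i+1}=\zeta_i$ and $\xi_{i+1}\in\mathcal N(\xi_i)$, or $\xi_{i+1}=\xi_i$ and $\zeta_{i+1}\in\mathcal N(\zeta_i)$, and $\sigma_{\zeta_i}=-\sigma_{\xi_i}$ for all $i$; it is viewed as a polygonal curve in the plane. Metric on $\mathbb R^2$: $\mathrm d(u,v)=\inf_\phi\int(1+|\phi|^2)^{-1}ds$, infimum over smooth curves $\phi$ from $u$ to $v$ parametrized by arc length; $\dot{\mathbb R}^2$ is the one-point compactification (isometric to the sphere). Curves are continuous maps $[0,1]\to\dot{\mathbb R}^2$ modulo monotone reparametrization, with distance $\mathrm D(\mathcal C_1,\mathcal C_2)=\inf_{f_1,f_2}\sup_{t\in[0,1]}\mathrm d(\gamma_1(f_1(t)),\gamma_2(f_2(t)))$,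 infimum over monotone continuous surjections $f_1,f_2$ of $[0,1]$. For closed sets of curves $\mathcal F,\mathcal F'$, $\operatorname{dist}(\mathcal F,\mathcal F')\le\varepsilon$ iff every $\mathcal C\in\mathcal F$ has some $\mathcal C'\in\mathcal F'$ with $\mathrm D(\mathcal C,\mathcal C')\le\varepsilon$ and vice versa (induced Hausdorff metric). *)

theory Defs
  imports "HOL-Probability.Probability"
begin

type_synonym site = "int \<times> int"
type_synonym config = "site \<Rightarrow> bool"  \<comment> \<open>True encodes spin +1, False encodes spin -1\<close>

definition omega :: complex where
  "omega = Complex (1/2) (sqrt 3 / 2)"

text \<open>Embedding of the triangular lattice in the plane (identified with the complex plane);
  nearest neighbours are at distance 1, and sites are centres of hexagonal faces of the dual
  hexagonal lattice.\<close>
definition pos :: "site \<Rightarrow> complex" where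
  "pos x = of_int (fst x) + of_int (snd x) * omega"

definition nbrs :: "site \<Rightarrow> site set" where
  "nbrs x = (case x of (a, b) \<Rightarrow>
     {(a+1, b), (a-1, b), (a, b+1), (a, b-1), (a+1, b-1), (a-1, b+1)})"

definition T :: "config \<Rightarrow> config" where
  "T \<sigma> x = (if \<exists>y1\<in>nbrs x. \<exists>y2\<in>nbrs x. y1 \<noteq> y2 \<and> \<sigma> y1 = \<sigma> x \<and> \<sigma> y2 = \<sigma> x \<and> y2 \<notin> nbrs y1
             then \<sigma> x else \<not> \<sigma> x)"

text \<open>The limit configuration: at each site, the eventual value of the spin
  (well defined whenever every spin flips only finitely often).\<close>
definition sigma_inf :: "config \<Rightarrow> config" where
  "sigma_inf \<sigma>0 x = (THE b. \<forall>\<^sub>F n in sequentially. (T ^^ n) \<sigma>0 x = b)"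

definition mu0 :: "config measure" where
  "mu0 = PiM UNIV (\<lambda>_. measure_pmf (bernoulli_pmf (1/2)))"

text \<open>Endpoints of the dual edge \<open>\<eta>*_{x,y}\<close> (perpendicular bisector of the edge xy):
  the centres of the two triangles containing the edge xy, i.e. the two hexagon vertices.\<close>
definition dual_ends :: "site \<times> site \<Rightarrow> complex set" where
  "dual_ends e = (case e of (x, y) \<Rightarrow>
     {(pos x + pos y + pos z) / 3 | z. z \<in> nbrs x \<and> z \<in> nbrs y})"

definition dual_edge :: "site \<times> site \<Rightarrow> site set" where
  "dual_edge e = (case e of (x, y) \<Rightarrow> {x, y})"

definition b_path :: "config \<Rightarrow> (site \<times> site) list \<Rightarrow> bool" where
  "b_path \<sigma> p \<longleftrightarrow>
     p \<noteq> [] \<and>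
     (\<forall>i < length p. snd (p ! i) \<in> nbrs (fst (p ! i))) \<and>
     distinct (map dual_edge p) \<and>
     (\<forall>i. Suc i < length p \<longrightarrow>
        (fst (p ! Suc i) = fst (p ! i) \<and> snd (p ! Suc i) \<in> nbrs (snd (p ! i))) \<or>
        (snd (p ! Suc i) = snd (p ! i) \<and> fst (p ! Suc i) \<in> nbrs (fst (p ! i)))) \<and>
     (\<forall>i < length p. \<sigma> (fst (p ! i)) = (\<not> \<sigma> (snd (p ! i))))"

definition traces :: "(site \<times> site) list \<Rightarrow> complex list \<Rightarrow> bool" where
  "traces p vs \<longleftrightarrow> length vs = Suc (length p) \<and>
     (\<forall>i < length p. {vs ! i, vs ! Suc i} = dual_ends (p ! i))"

definition polygon :: "complex list \<Rightarrow> real \<Rightarrow> complex" where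
  "polygon vs t = (let m = length vs - 1; s = t * real m; i = min (nat \<lfloor>s\<rfloor>) (m - 1);
                       u = s - real i
                   in of_real (1 - u) * vs ! i + of_real u * vs ! Suc i)"

definition curves :: "real \<Rightarrow> config \<Rightarrow> (real \<Rightarrow> complex) set" where
  "curves \<delta> \<sigma> = {polygon (map (\<lambda>v. of_real \<delta> * v) vs) | p vs. b_path \<sigma> p \<and> traces p vs}"

definition dmet :: "complex \<Rightarrow> complex \<Rightarrow> real" where
  "dmet u v = Inf {integral {0..L} (\<lambda>s. 1 / (1 + (cmod (\<phi> s))\<^sup>2)) | L \<phi>.
       0 \<le> L \<and> \<phi> C1_differentiable_on {0..L} \<and> \<phi> 0 = u \<and> \<phi> L = v \<and>
       (\<forall>s\<in>{0..L}. norm (vector_derivative \<phi> (at s within {0..L})) = 1)}"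

definition reparam :: "(real \<Rightarrow> real) \<Rightarrow> bool" where
  "reparam f \<longleftrightarrow> mono_on {0..1} f \<and> continuous_on {0..1} f \<and> f ` {0..1} = {0..1}"

definition Dcurve :: "(real \<Rightarrow> complex) \<Rightarrow> (real \<Rightarrow> complex) \<Rightarrow> real" where
  "Dcurve \<gamma>1 \<gamma>2 = Inf {(SUP t\<in>{0..1}. dmet (\<gamma>1 (f1 t)) (\<gamma>2 (f2 t))) | f1 f2.
       reparam f1 \<and> reparam f2}"

definition haus_le :: "real \<Rightarrow> (real \<Rightarrow> complex) set \<Rightarrow> (real \<Rightarrow> complex) set \<Rightarrow> bool" where
  "haus_le \<epsilon> F F' \<longleftrightarrow> (\<forall>C\<in>F. \<exists>C'\<in>F'. Dcurve C C' \<le> \<epsilon>) \<and> (\<forall>C'\<in>F'. \<exists>C\<in>F. Dcurve C C' \<le> \<epsilon>)"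

end

theory Submission
  imports Defs
begin

text \<open>
  Call a set of equally coloured sites self-supporting if each of its sites has two non-adjacent
  neighbours in it. Such sets are fixed by T; let a site be unstable if it lies in none of them, and
  an edge stable if its ends have opposite colours and neither is unstable. A stable edge is crossed
  by an interface of every configuration of the evolution.

  Flipping a site around which the six neighbours show at most two colour changes reroutes the
  interface around that site, without affecting the order in which interfaces visit edges that avoid
  it. On a finite component of unstable sites every iterate of T is reached by such flips, so all
  configurations of the evolution have the same successor of a given stable edge along its interface.
  Erasing the unstable sites of one colour one at a time is a sequence of such flips too; it shows that the
  initial interfaces touching a component of unstable sites run along a single stretch without stable edges.

  Stretches without stable edges are short: whenever the exploration of an interface reaches a new
  column, twelve unexplored sites decide, with probability at least 1/4096, that a stable edge follows at once.
  By the Borel-Cantelli lemma the stretches and the unstable components at distance r have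
  diameter o(r). In the metric d a displacement of order o(r) at distance r becomes
  uniformly small after scaling, also near infinity.
\<close>

section \<open>Interfaces on the triangular lattice\<close>

text \<open>The obstacle is that T changes infinitely many sites at once, while only single flips
  are known to respect interfaces, and only at sites where no two strands of interface meet. Two
  facts remove it. A site flipped by T has at most two neighbours of its own colour, and these are
  adjacent; so its surroundings stay simple whichever of the other scheduled flips have already been
  made. And an interface leaving a stable edge sees only one unstable component before its next
  stable edge, so this finite component can be updated while everything else stays frozen.

  Stable edges serve as milestones: an interface that starts at one and repeats none repeats no edge
  at all, so keeping their order turns b-paths into b-paths.

  Twelve is the size of two disjoint hexagonal rings of opposite colours, each supporting itself.
  They occupy three columns that the interface has not yet seen, so their colours are independent of
  its past. This controls the drift in one direction only; rotation invariance of the measure gives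
  the others.\<close>

definition rot :: "site \<Rightarrow> site" where
  "rot v = (- snd v, fst v + snd v)"

text \<open>The index runs through all natural numbers with period 6, so that neighbours on the ring
  around a site are addressed as \<open>k + i\<close> without reduction modulo 6.\<close>

definition dir :: "nat \<Rightarrow> site" where
  "dir k = (rot ^^ k) (1, 0)"

lemma rot_add: "rot (v + w) = rot v + rot w"
  by (simp add: rot_def prod_eq_iff)

lemma rot_diff: "rot (v - w) = rot v - rot w"
  by (simp add: rot_def prod_eq_iff)

lemma rot_minus: "rot (- v) = - rot v"
  by (simp add: rot_def prod_eq_iff)

text \<open>In the coordinates of \<open>pos\<close>, \<open>rot\<close> is multiplication by
  \<open>omega\<close>; this is the identity omega^2 = omega - 1, from which all relations between
  directions follow.\<close>

lemma rot_rot: "rot (rot v) = rot v - v"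
  by (simp add: rot_def prod_eq_iff)

lemma rot_eq_iff [simp]: "rot v = rot w \<longleftrightarrow> v = w"
  by (auto simp: rot_def prod_eq_iff)

lemma dir_Suc: "dir (Suc k) = rot (dir k)"
  by (simp add: dir_def)

lemma dir_add2: "dir (k + 2) = dir (k + 1) - dir k"
  by (simp add: dir_Suc rot_rot)

lemma dir_add3: "dir (k + 3) = - dir k"
  by (simp add: dir_Suc rot_rot rot_diff eval_nat_numeral)

lemma dir_add6 [simp]: "dir (k + 6) = dir k"
  using dir_add3[of k] dir_add3[of "k + 3"] by (simp add: add.assoc)

lemma dir_mod6: "dir (k mod 6) = dir k"
proof -
  have "dir (r + 6 * q) = dir r" for r q
  proof (induction q)
    case (Suc q)
    then show ?case using dir_add6[of "r + 6 * q"] by (simp add: algebra_simps)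
  qed simp
  from this[of "k mod 6" "k div 6"] show ?thesis by simp
qed

lemma dir_simps: "dir 0 = (1, 0)" "dir 1 = (0, 1)" "dir 2 = (-1, 1)" "dir 3 = (-1, 0)"
    "dir 4 = (0, -1)" "dir 5 = (1, -1)" "dir (Suc 0) = (0, 1)"
  by (simp_all add: dir_def rot_def eval_nat_numeral)

lemma less6_cases: "k < (6::nat) \<Longrightarrow> k = 0 \<or> k = 1 \<or> k = 2 \<or> k = 3 \<or> k = 4 \<or> k = 5"
  by auto

lemma nbrs_iff_ex: "y \<in> nbrs x \<longleftrightarrow> (\<exists>k<6. y = x + dir k)"
proof -
  have "(\<exists>k<6. y = x + dir k) \<longleftrightarrow> y \<in> (\<lambda>k. x + dir k) ` {0,1,2,3,4,5}"
    by (auto dest!: less6_cases) (force intro: exI[of _ 0] exI[of _ 1] exI[of _ 2] exI[of _ 3] exI[of _ 4] exI[of _ 5])+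
  also have "\<dots> \<longleftrightarrow> y \<in> nbrs x"
    unfolding nbrs_def by (cases x; cases y) (auto simp: dir_simps)
  finally show ?thesis ..
qed

lemma nbrs_dir [simp, intro]: "x + dir k \<in> nbrs x"
  unfolding nbrs_iff_ex by (metis dir_mod6 mod_less_divisor zero_less_numeral)

lemma nbrs_sym: "y \<in> nbrs x \<longleftrightarrow> x \<in> nbrs y"
  by (cases x; cases y) (auto simp: nbrs_def)

lemma nbrs_irrefl [simp]: "x \<notin> nbrs x"
  by (cases x) (auto simp: nbrs_def)

lemma finite_nbrs [simp]: "finite (nbrs x)"
  by (cases x) (auto simp: nbrs_def)

lemma nbrs_translate: "x + v \<in> nbrs (x + w) \<longleftrightarrow> v \<in> nbrs w"
  by (simp add: nbrs_iff_ex add.assoc)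

lemma dir_ring_nbrs:
  assumes "i < 6" "j < 6"
  shows "x + dir j \<in> nbrs (x + dir i) \<longleftrightarrow> j = (i + 1) mod 6 \<or> i = (j + 1) mod 6"
  unfolding nbrs_translate
  using less6_cases[OF assms(1)] less6_cases[OF assms(2)]
  by (elim disjE; simp add: dir_simps nbrs_def)

lemma dir_inj: "i < 6 \<Longrightarrow> j < 6 \<Longrightarrow> dir i = dir j \<longleftrightarrow> i = j"
  by (drule less6_cases, drule less6_cases, elim disjE; simp add: dir_simps)

type_synonym edge = "site \<times> site"

text \<open>An edge (x, y) is directed so that its dual edge is traversed from right to left of the vector
  from x to y; \<open>ahead\<close> is the third corner of the triangle entered, and \<open>step\<close> is the dual edge
  through which the interface leaves it, with the colours of the two components preserved.\<close>
definition ahead :: "edge \<Rightarrow> site" where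
  "ahead e = fst e + rot (snd e - fst e)"

definition step :: "config \<Rightarrow> edge \<Rightarrow> edge" where
  "step \<sigma> e = (if \<sigma> (ahead e) = \<sigma> (fst e) then (ahead e, snd e) else (fst e, ahead e))"

definition bich :: "config \<Rightarrow> edge \<Rightarrow> bool" where
  "bich \<sigma> e \<longleftrightarrow> snd e \<in> nbrs (fst e) \<and> \<sigma> (fst e) \<noteq> \<sigma> (snd e)"

abbreviation on_edge :: "site \<Rightarrow> edge \<Rightarrow> bool" where
  "on_edge x e \<equiv> x = fst e \<or> x = snd e"

lemma ahead_dir: "ahead (x, x + dir k) = x + dir (k + 1)"
  by (simp add: ahead_def dir_Suc)

lemma ahead_ring: "ahead (x + dir k, x + dir (k + 1)) = x"
proof -
  have "rot (dir (k + 1) - dir k) = - dir k"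
    by (simp add: rot_diff dir_Suc rot_rot)
  then show ?thesis by (simp add: ahead_def)
qed

lemma ahead_in: "ahead (x + dir (k + 1), x) = x + dir k"
proof -
  have "rot (- dir (k + 1)) = dir k - dir (k + 1)"
    by (simp add: rot_minus dir_Suc rot_rot)
  then show ?thesis by (simp add: ahead_def)
qed

lemma ahead_nbrs:
  assumes "snd e \<in> nbrs (fst e)"
  shows "ahead e \<in> nbrs (fst e)" "ahead e \<in> nbrs (snd e)"
proof -
  obtain k where k: "snd e = fst e + dir k" using assms by (auto simp: nbrs_iff_ex)
  then have a: "ahead e = fst e + dir (k + 1)" using ahead_dir[of "fst e" k] by (metis prod.collapse)
  then show "ahead e \<in> nbrs (fst e)" by auto
  have "ahead e = snd e + dir (k + 2)" unfolding a k by (simp add: dir_add2[simplified])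
  then show "ahead e \<in> nbrs (snd e)" by (metis nbrs_dir)
qed

lemma common_nbrs:
  assumes "y \<in> nbrs x"
  shows "z \<in> nbrs x \<and> z \<in> nbrs y \<longleftrightarrow> z = ahead (x, y) \<or> z = ahead (y, x)"
proof
  assume z: "z \<in> nbrs x \<and> z \<in> nbrs y"
  obtain i j where i: "i < 6" "y = x + dir i" and j: "j < 6" "z = x + dir j"
    using assms z by (auto simp: nbrs_iff_ex)
  from z have "j = (i + 1) mod 6 \<or> i = (j + 1) mod 6"
    using dir_ring_nbrs[OF i(1) j(1)] i j by auto
  then show "z = ahead (x, y) \<or> z = ahead (y, x)"
    using ahead_dir[of x i] ahead_in[of x j] dir_mod6 i(2) j(2) by metis
next
  assume "z = ahead (x, y) \<or> z = ahead (y, x)"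
  then show "z \<in> nbrs x \<and> z \<in> nbrs y"
    using ahead_nbrs[of "(x, y)"] ahead_nbrs[of "(y, x)"] assms nbrs_sym by auto
qed

lemma bich_swap [simp]: "bich \<sigma> (prod.swap e) \<longleftrightarrow> bich \<sigma> e"
  by (auto simp: bich_def nbrs_sym)

lemma bich_step: "bich \<sigma> e \<Longrightarrow> bich \<sigma> (step \<sigma> e)"
  using ahead_nbrs[of e] nbrs_sym by (auto simp: bich_def step_def)

lemma fst_colour_step: "\<sigma> (fst (step \<sigma> e)) = \<sigma> (fst e)"
  by (auto simp: step_def)

lemma bich_funpow: "bich \<sigma> e \<Longrightarrow> bich \<sigma> ((step \<sigma> ^^ j) e)"
  by (induction j) (auto simp: bich_step)

lemma fst_colour_funpow: "\<sigma> (fst ((step \<sigma> ^^ j) e)) = \<sigma> (fst e)"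
  by (induction j) (auto simp: fst_colour_step)

lemma ahead_swap_left: "ahead (y, ahead (x, y)) = x"
  by (cases x; cases y) (auto simp: ahead_def rot_def)

lemma ahead_swap_right: "ahead (ahead (x, y), x) = y"
  by (cases x; cases y) (auto simp: ahead_def rot_def)

text \<open>Swapping the ends of an edge reverses the direction of travel. Interfaces can therefore
  be traced backwards, which makes \<open>step\<close> injective on bichromatic edges.\<close>

lemma step_swap_step: "bich \<sigma> e \<Longrightarrow> step \<sigma> (prod.swap (step \<sigma> e)) = prod.swap e"
  by (cases e) (auto simp: step_def bich_def ahead_swap_left ahead_swap_right)

lemma step_inj: "bich \<sigma> e \<Longrightarrow> bich \<sigma> e' \<Longrightarrow> step \<sigma> e = step \<sigma> e' \<Longrightarrow> e = e'"
  using step_swap_step[of \<sigma> e] step_swap_step[of \<sigma> e'] by (metis prod.swap_def swap_swap)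

lemma step_funpow_inj:
  "bich \<sigma> e \<Longrightarrow> bich \<sigma> e' \<Longrightarrow> (step \<sigma> ^^ j) e = (step \<sigma> ^^ j) e' \<Longrightarrow> e = e'"
  by (induction j) (auto dest: step_inj[OF bich_funpow bich_funpow])

lemma funpow_swap:
  assumes "bich \<sigma> e" "i \<le> j"
  shows "(step \<sigma> ^^ i) (prod.swap ((step \<sigma> ^^ j) e)) = prod.swap ((step \<sigma> ^^ (j - i)) e)"
  using assms(2)
proof (induction i)
  case (Suc i)
  then have "j - i = Suc (j - Suc i)" by simp
  with Suc show ?case
    using step_swap_step[OF bich_funpow[OF assms(1)], of "j - Suc i"] by simp
qed simp

lemma on_edge_step: "on_edge x (step \<sigma> e) \<Longrightarrow> on_edge x e \<or> x = ahead e"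
  by (auto simp: step_def split: if_splits)

lemma ahead_on_step: "on_edge (ahead e) (step \<sigma> e)"
  by (auto simp: step_def)

lemma step_cong:
  "\<sigma> (ahead e) = \<tau> (ahead e) \<Longrightarrow> \<sigma> (fst e) = \<tau> (fst e) \<Longrightarrow> step \<sigma> e = step \<tau> e"
  by (simp add: step_def)

section \<open>Flips that preserve interfaces\<close>

text \<open>At most two colour changes around x: any change between neighbours k and k + 1 starts a run of
  length l which is followed by a complementary run of the other colour.\<close>
definition simple :: "config \<Rightarrow> site \<Rightarrow> bool" where
  "simple \<sigma> x \<longleftrightarrow> (\<forall>k. \<sigma> (x + dir k) \<noteq> \<sigma> (x + dir (k + 1)) \<longrightarrow>
     (\<exists>l\<in>{1..5}. \<forall>i<6. \<sigma> (x + dir (k + 1 + i)) =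
        (if i < l then \<sigma> (x + dir (k + 1)) else \<sigma> (x + dir k))))"

definition flip :: "site \<Rightarrow> config \<Rightarrow> config" where
  "flip x \<sigma> = \<sigma>(x := \<not> \<sigma> x)"

lemma dir_nonzero [simp]: "dir k \<noteq> 0" "0 \<noteq> dir k"
  using nbrs_dir[of 0 k] nbrs_irrefl[of 0] by auto

lemma flip_dir [simp]: "flip x \<sigma> (x + dir k) = \<sigma> (x + dir k)"
  by (simp add: flip_def)

lemma simple_flip [simp]: "simple (flip x \<sigma>) x = simple \<sigma> x"
  unfolding simple_def flip_dir ..

lemma flip_flip [simp]: "flip x (flip x \<sigma>) = \<sigma>"
  by (auto simp: flip_def)

text \<open>With x as first end the interface turns around x with increasing index; with x as second
  end (\<open>run_down\<close>) the index decreases.\<close>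

lemma run_up:
  assumes "\<forall>i\<le>j. \<sigma> (x + dir (k + i)) \<noteq> \<sigma> x"
  shows "(step \<sigma> ^^ j) (x, x + dir k) = (x, x + dir (k + j))"
  using assms by (induction j) (auto simp: step_def ahead_dir[unfolded Suc_eq_plus1[symmetric]])

lemma run_down:
  assumes "\<forall>i\<le>j. \<sigma> (x + dir (k + i)) \<noteq> \<sigma> x"
  shows "(step \<sigma> ^^ j) (x + dir (k + j), x) = (x + dir k, x)"
  using assms
proof (induction j)
  case (Suc j)
  have "step \<sigma> (x + dir (k + Suc j), x) = (x + dir (k + j), x)"
    using Suc.prems ahead_in[of x "k + j"] by (auto simp: step_def)
  then show ?case using Suc by (simp del: funpow.simps add: funpow_Suc_right)
qed simp

lemma ahead_eqD:
  assumes "y \<in> nbrs u" "ahead (u, y) = x"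
  obtains k where "k < 6" "u = x + dir k" "y = x + dir (k + 1)"
proof -
  have "u \<in> nbrs x" using ahead_nbrs[of "(u, y)"] assms nbrs_sym by auto
  then obtain k where k: "k < 6" "u = x + dir k" by (auto simp: nbrs_iff_ex)
  have "rot (y - u) = - dir k" using assms(2) k by (auto simp: ahead_def algebra_simps add_eq_0_iff)
  also have "\<dots> = rot (dir (k + 1) - dir k)" by (simp add: rot_diff dir_Suc rot_rot)
  finally have "y = x + dir (k + 1)" using k by (auto simp: algebra_simps)
  with k that show ?thesis by blast
qed

text \<open>Together with \<open>exit_down\<close> this treats the two colours of x for one and the
  same ring. The interface enters and leaves the hexagon of x through the same two edges; only the
  side on which it passes x, and hence the number of steps (\<open>l + 1\<close> or
  \<open>7 - l\<close>), depends on the colour.\<close>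

lemma exit_up:
  assumes "\<sigma> (x + dir k) = \<sigma> x" "1 \<le> l" "l \<le> 5"
    and run: "\<forall>i<6. \<sigma> (x + dir (k + 1 + i)) = (if i < l then \<not> \<sigma> x else \<sigma> x)"
  shows "(step \<sigma> ^^ (l + 1)) (x + dir k, x + dir (k + 1)) = (x + dir (k + l + 1), x + dir (k + l))"
    and "\<And>i. 0 < i \<Longrightarrow> i \<le> l \<Longrightarrow> fst ((step \<sigma> ^^ i) (x + dir k, x + dir (k + 1))) = x"
proof -
  have s1: "step \<sigma> (x + dir k, x + dir (k + 1)) = (x, x + dir (k + 1))"
    using assms(1) by (simp add: step_def ahead_ring[simplified])
  have up: "(step \<sigma> ^^ i) (x, x + dir (k + 1)) = (x, x + dir (k + 1 + i))" if "i < l" for i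
  proof (rule run_up, intro allI impI)
    fix j assume "j \<le> i"
    then show "\<sigma> (x + dir (k + 1 + j)) \<noteq> \<sigma> x" using run[rule_format, of j] that assms(3) by auto
  qed
  have eq: "(step \<sigma> ^^ Suc i) (x + dir k, x + dir (k + 1)) = (x, x + dir (k + 1 + i))" if "i < l" for i
    using up[OF that] s1 by (simp del: funpow.simps add: funpow_Suc_right)
  show "fst ((step \<sigma> ^^ i) (x + dir k, x + dir (k + 1))) = x" if "0 < i" "i \<le> l" for i
    using eq[of "i - 1"] that by (simp del: funpow.simps)
  have "\<sigma> (x + dir (k + l + 1)) = \<sigma> x" using run[rule_format, of l] assms(3) by (auto simp: algebra_simps)
  then have "step \<sigma> (x, x + dir (k + l)) = (x + dir (k + l + 1), x + dir (k + l))"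
    using ahead_dir[of x "k + l"] by (auto simp: step_def)
  moreover have "(step \<sigma> ^^ l) (x + dir k, x + dir (k + 1)) = (x, x + dir (k + l))"
    using eq[of "l - 1"] assms(2) by (simp del: funpow.simps)
  ultimately show "(step \<sigma> ^^ (l + 1)) (x + dir k, x + dir (k + 1)) = (x + dir (k + l + 1), x + dir (k + l))"
    by simp
qed

lemma exit_down:
  assumes "\<sigma> (x + dir k) \<noteq> \<sigma> x" "1 \<le> l" "l \<le> 5"
    and run: "\<forall>i<6. \<sigma> (x + dir (k + 1 + i)) = (if i < l then \<sigma> x else \<not> \<sigma> x)"
  shows "(step \<sigma> ^^ (7 - l)) (x + dir k, x + dir (k + 1)) = (x + dir (k + l + 1), x + dir (k + l))"
    and "\<And>i. 0 < i \<Longrightarrow> i < 7 - l \<Longrightarrow> snd ((step \<sigma> ^^ i) (x + dir k, x + dir (k + 1))) = x"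
proof -
  \<comment> \<open>The index decreases along this arc, so the arc is started at
    \<open>k + 6\<close> instead of k to stay within the naturals.\<close>
  have "k + l + 1 + (5 - l) = k + 6" using assms(2,3) by simp
  then have k6: "dir k = dir (k + l + 1 + (5 - l))" by (metis dir_add6)
  have s1: "step \<sigma> (x + dir k, x + dir (k + 1)) = (x + dir k, x)"
    using assms(1) by (auto simp: step_def ahead_ring[simplified])
  have down: "(step \<sigma> ^^ i) (x + dir k, x) = (x + dir (k + l + 1 + (5 - l - i)), x)" if "i \<le> 5 - l" for i
  proof -
    have "(step \<sigma> ^^ i) (x + dir (k + l + 1 + (5 - l - i) + i), x) = (x + dir (k + l + 1 + (5 - l - i)), x)"
    proof (rule run_down, intro allI impI)
      fix j assume "j \<le> i"
      then show "\<sigma> (x + dir (k + l + 1 + (5 - l - i) + j)) \<noteq> \<sigma> x"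
        using run[rule_format, of "l + (5 - l - i) + j"] that assms(3) by (auto simp: algebra_simps)
    qed
    moreover have "k + l + 1 + (5 - l - i) + i = k + l + 1 + (5 - l)" using that by simp
    ultimately show ?thesis by (simp only: k6[symmetric])
  qed
  have eq: "(step \<sigma> ^^ Suc i) (x + dir k, x + dir (k + 1)) = (x + dir (k + l + 1 + (5 - l - i)), x)"
    if "i \<le> 5 - l" for i
    using down[OF that] s1 by (simp del: funpow.simps add: funpow_Suc_right)
  show "snd ((step \<sigma> ^^ i) (x + dir k, x + dir (k + 1))) = x" if "0 < i" "i < 7 - l" for i
    using eq[of "i - 1"] that by (simp del: funpow.simps)
  have "\<sigma> (x + dir (k + l)) = \<sigma> x"
    using run[rule_format, of "l - 1"] assms(2,3) by (auto simp: algebra_simps)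
  then have "step \<sigma> (x + dir (k + l + 1), x) = (x + dir (k + l + 1), x + dir (k + l))"
    using ahead_in[of x "k + l"] run[rule_format, of l] assms(3) by (auto simp: step_def algebra_simps)
  then show "(step \<sigma> ^^ (7 - l)) (x + dir k, x + dir (k + 1)) = (x + dir (k + l + 1), x + dir (k + l))"
    using eq[of "5 - l"] assms(3) by (simp add: Suc_diff_le eval_nat_numeral)
qed

lemma detour:
  assumes "simple \<sigma> x" "bich \<sigma> e" "\<not> on_edge x e"
  obtains p p' e'' where "p > 0" "p' > 0" "(step \<sigma> ^^ p) e = e''" "(step (flip x \<sigma>) ^^ p') e = e''"
    "\<not> on_edge x e''" "\<forall>i. 0 < i \<and> i < p \<longrightarrow> on_edge x ((step \<sigma> ^^ i) e)"
    "\<forall>i. 0 < i \<and> i < p' \<longrightarrow> on_edge x ((step (flip x \<sigma>) ^^ i) e)"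
proof (cases "ahead e = x")
  case False
  then have a: "step (flip x \<sigma>) e = step \<sigma> e"
    using assms(3) by (intro step_cong) (auto simp: flip_def)
  have b: "\<not> on_edge x (step \<sigma> e)" using on_edge_step[of x \<sigma> e] False assms(3) by auto
  show ?thesis
  proof (rule that[of 1 1 "step \<sigma> e"])
    show "(step (flip x \<sigma>) ^^ 1) e = step \<sigma> e" using a by simp
    show "\<not> on_edge x (step \<sigma> e)" by (rule b)
  qed auto
next
  case True
  have "snd e \<in> nbrs (fst e)" "ahead (fst e, snd e) = x" using True assms(2) by (auto simp: bich_def)
  then obtain k where "fst e = x + dir k" "snd e = x + dir (k + 1)" by (rule ahead_eqD)
  then have k: "e = (x + dir k, x + dir (k + 1))" by (simp add: prod_eq_iff)
  have ne: "\<sigma> (x + dir k) \<noteq> \<sigma> (x + dir (k + 1))" using assms(2) k by (auto simp: bich_def)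
  then obtain l where l: "1 \<le> l" "l \<le> 5" and
    run: "\<forall>i<6. \<sigma> (x + dir (k + 1 + i)) = (if i < l then \<sigma> (x + dir (k + 1)) else \<sigma> (x + dir k))"
    using assms(1) unfolding simple_def by force
  let ?e = "(x + dir (k + l + 1), x + dir (k + l))"
  show ?thesis
  proof (cases "\<sigma> (x + dir k) = \<sigma> x")
    case True
    have 1: "\<forall>i<6. \<sigma> (x + dir (k + 1 + i)) = (if i < l then \<not> \<sigma> x else \<sigma> x)"
      using run ne True by auto
    have 2: "\<forall>i<6. flip x \<sigma> (x + dir (k + 1 + i)) = (if i < l then flip x \<sigma> x else \<not> flip x \<sigma> x)"
      using 1 unfolding flip_dir by (auto simp: flip_def)
    have 3: "flip x \<sigma> (x + dir k) \<noteq> flip x \<sigma> x" using True unfolding flip_dir by (auto simp: flip_def)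
    show ?thesis
    proof (rule that[of "l + 1" "7 - l" ?e])
      show "(step \<sigma> ^^ (l + 1)) e = ?e" unfolding k by (rule exit_up(1)[OF True l 1])
      show "(step (flip x \<sigma>) ^^ (7 - l)) e = ?e" unfolding k by (rule exit_down(1)[OF 3 l 2])
      show "\<forall>i. 0 < i \<and> i < l + 1 \<longrightarrow> on_edge x ((step \<sigma> ^^ i) e)"
        unfolding k using exit_up(2)[OF True l 1] by (metis less_Suc_eq_le Suc_eq_plus1)
      show "\<forall>i. 0 < i \<and> i < 7 - l \<longrightarrow> on_edge x ((step (flip x \<sigma>) ^^ i) e)"
        unfolding k using exit_down(2)[OF 3 l 2] by (metis less_Suc_eq_le Suc_eq_plus1)
    qed (use l in auto)
  next
    case False
    have 1: "\<forall>i<6. \<sigma> (x + dir (k + 1 + i)) = (if i < l then \<sigma> x else \<not> \<sigma> x)"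
      using run ne False by auto
    have 2: "\<forall>i<6. flip x \<sigma> (x + dir (k + 1 + i)) = (if i < l then \<not> flip x \<sigma> x else flip x \<sigma> x)"
      using 1 unfolding flip_dir by (auto simp: flip_def)
    have 3: "flip x \<sigma> (x + dir k) = flip x \<sigma> x" using False unfolding flip_dir by (auto simp: flip_def)
    show ?thesis
    proof (rule that[of "7 - l" "l + 1" ?e])
      show "(step \<sigma> ^^ (7 - l)) e = ?e" unfolding k by (rule exit_down(1)[OF False l 1])
      show "(step (flip x \<sigma>) ^^ (l + 1)) e = ?e" unfolding k by (rule exit_up(1)[OF 3 l 2])
      show "\<forall>i. 0 < i \<and> i < 7 - l \<longrightarrow> on_edge x ((step \<sigma> ^^ i) e)"
        unfolding k using exit_down(2)[OF False l 1] by (metis less_Suc_eq_le Suc_eq_plus1)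
      show "\<forall>i. 0 < i \<and> i < l + 1 \<longrightarrow> on_edge x ((step (flip x \<sigma>) ^^ i) e)"
        unfolding k using exit_up(2)[OF 3 l 2] by (metis less_Suc_eq_le Suc_eq_plus1)
    qed (use l in auto)
  qed
qed

text \<open>The two ends are not tested against A. For e and e' in A and \<open>j > 0\<close> it
  therefore says that e' is the successor of e among the edges of A.\<close>

definition conn :: "config \<Rightarrow> edge set \<Rightarrow> nat \<Rightarrow> edge \<Rightarrow> edge \<Rightarrow> bool" where
  "conn \<sigma> A j e e' \<longleftrightarrow> (step \<sigma> ^^ j) e = e' \<and> (\<forall>i. 0 < i \<and> i < j \<longrightarrow> (step \<sigma> ^^ i) e \<notin> A)"

text \<open>The orbit is cut at its edges that avoid x, and each piece is replaced by the
  corresponding detour, which touches x throughout and so meets no edge of A. Whether j is 0 is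
  recorded because an edge may be its own successor on a closed interface.\<close>

lemma conn_flip:
  assumes "simple \<sigma> x" "\<forall>a\<in>A. \<not> on_edge x a" "\<not> on_edge x e'"
  shows "conn \<sigma> A j e e' \<Longrightarrow> bich \<sigma> e \<Longrightarrow> \<not> on_edge x e \<Longrightarrow>
    \<exists>j'. (j = 0 \<longleftrightarrow> j' = 0) \<and> conn (flip x \<sigma>) A j' e e'"
proof (induction j arbitrary: e rule: less_induct)
  case (less j)
  show ?case
  proof (cases "j = 0")
    case True
    then show ?thesis using less.prems by (auto simp: conn_def)
  next
    case False
    obtain p p' e'' where p: "p > 0" "p' > 0" "(step \<sigma> ^^ p) e = e''" "(step (flip x \<sigma>) ^^ p') e = e''"
      "\<not> on_edge x e''" "\<forall>i. 0 < i \<and> i < p \<longrightarrow> on_edge x ((step \<sigma> ^^ i) e)"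
      "\<forall>i. 0 < i \<and> i < p' \<longrightarrow> on_edge x ((step (flip x \<sigma>) ^^ i) e)"
      by (rule detour[OF assms(1) less.prems(2,3)])
    have "p \<le> j"
    proof (rule ccontr)
      assume "\<not> p \<le> j"
      then have "on_edge x ((step \<sigma> ^^ j) e)" using p(6) False by simp
      then show False using assms(3) less.prems(1) by (simp add: conn_def)
    qed
    have fp: "(step \<sigma> ^^ i) e'' = (step \<sigma> ^^ (i + p)) e" for i
      using p(3) by (simp add: funpow_add)
    have fp': "(step (flip x \<sigma>) ^^ (i + p')) e = (step (flip x \<sigma>) ^^ i) e''" for i
      using p(4) by (simp add: funpow_add)
    have "conn \<sigma> A (j - p) e'' e'"
      unfolding conn_def fp using less.prems(1) \<open>p \<le> j\<close> p(1) by (auto simp: conn_def)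
    moreover have "bich \<sigma> e''" using p(3) less.prems(2) bich_funpow by blast
    ultimately obtain j' where j': "j - p = 0 \<longleftrightarrow> j' = 0" "conn (flip x \<sigma>) A j' e'' e'"
      using less.IH[of "j - p" e''] p(1,5) False by auto
    have "conn (flip x \<sigma>) A (j' + p') e e'"
      unfolding conn_def
    proof (intro conjI allI impI)
      show "(step (flip x \<sigma>) ^^ (j' + p')) e = e'" using j'(2) by (simp add: fp' conn_def)
      fix i assume i: "0 < i \<and> i < j' + p'"
      consider "i < p'" | "i = p'" | "i > p'" by linarith
      then show "(step (flip x \<sigma>) ^^ i) e \<notin> A"
      proof cases
        case 1
        then show ?thesis using p(7) i assms(2) by blast
      next
        case 2
        then have "p < j" using i j'(1) \<open>p \<le> j\<close> by auto
        then show ?thesis using less.prems(1) p(1,3,4) 2 by (auto simp: conn_def)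
      next
        case 3
        then show ?thesis using j'(2) fp'[of "i - p'"] i by (auto simp: conn_def)
      qed
    qed
    then show ?thesis using False p(2) by (intro exI[of _ "j' + p'"]) auto
  qed
qed

section \<open>Sites flipped by the automaton\<close>

lemma dir_far:
  "x + dir (i + 2) \<notin> nbrs (x + dir i)" "x + dir (i + 3) \<notin> nbrs (x + dir i)"
  "dir (i + 2) \<noteq> dir i" "dir (i + 3) \<noteq> dir i"
proof -
  have m: "dir (i + 2) = dir ((i mod 6 + 2) mod 6)" "dir (i + 3) = dir ((i mod 6 + 3) mod 6)"
    "dir i = dir (i mod 6)"
    using dir_mod6[of "i + 2"] dir_mod6[of "i + 3"] by (simp_all add: dir_mod6 mod_simps)
  have l: "(i mod 6 + 2) mod 6 < 6" "(i mod 6 + 3) mod 6 < 6" "i mod 6 < 6" by simp_all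
  show "x + dir (i + 2) \<notin> nbrs (x + dir i)" "x + dir (i + 3) \<notin> nbrs (x + dir i)"
    "dir (i + 2) \<noteq> dir i" "dir (i + 3) \<noteq> dir i"
    unfolding m dir_ring_nbrs[OF l(3,1)] dir_ring_nbrs[OF l(3,2)] dir_inj[OF l(1,3)] dir_inj[OF l(2,3)]
    using less6_cases[OF l(3)] by (elim disjE; simp)+
qed

lemma far_pair:
  assumes "y1 \<in> nbrs x" "y2 \<in> nbrs x" "y1 \<noteq> y2" "y2 \<notin> nbrs y1"
  obtains i j where "y1 = x + dir i" "y2 = x + dir j" "j = i + 2 \<or> j = i + 3 \<or> i = j + 2"
proof -
  obtain i j where ij: "i < 6" "j < 6" "y1 = x + dir i" "y2 = x + dir j"
    using assms(1,2) by (auto simp: nbrs_iff_ex)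
  have ne: "i \<noteq> j" using assms(3) ij by auto
  have na: "\<not> (j = (i + 1) mod 6 \<or> i = (j + 1) mod 6)"
    using assms(4) dir_ring_nbrs[OF ij(1,2)] ij by auto
  have "\<exists>i'\<in>{i, i + 6}. \<exists>j'\<in>{j, j + 6}. j' = i' + 2 \<or> j' = i' + 3 \<or> i' = j' + 2"
    using less6_cases[OF ij(1)] less6_cases[OF ij(2)] ne na by (elim disjE; simp)
  then obtain i' j' where "i' = i \<or> i' = i + 6" "j' = j \<or> j' = j + 6"
    "j' = i' + 2 \<or> j' = i' + 3 \<or> i' = j' + 2" by blast
  moreover from this have "dir i' = dir i" "dir j' = dir j" using dir_add6 by metis+
  ultimately show ?thesis using that[of i' j'] ij by simp
qed

definition tflips :: "config \<Rightarrow> site set" where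
  "tflips \<sigma> = {x. T \<sigma> x \<noteq> \<sigma> x}"

lemma tflips_iff:
  "x \<in> tflips \<sigma> \<longleftrightarrow> \<not> (\<exists>y1\<in>nbrs x. \<exists>y2\<in>nbrs x. y1 \<noteq> y2 \<and> \<sigma> y1 = \<sigma> x \<and> \<sigma> y2 = \<sigma> x \<and> y2 \<notin> nbrs y1)"
  unfolding tflips_def T_def by (simp only: mem_Collect_eq split: if_split) blast

text \<open>On the 6-cycle of neighbours, distinct and non-adjacent means at distance 2 or 3. So the
  neighbours that share the colour of a flipping site are at most two consecutive ones.\<close>

lemma tflips_ring:
  "x \<in> tflips \<sigma> \<longleftrightarrow> (\<forall>i. \<not> (\<sigma> (x + dir i) = \<sigma> x \<and> \<sigma> (x + dir (i + 2)) = \<sigma> x) \<and>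
      \<not> (\<sigma> (x + dir i) = \<sigma> x \<and> \<sigma> (x + dir (i + 3)) = \<sigma> x))" (is "?L \<longleftrightarrow> ?R")
proof
  assume L: ?L
  show ?R
  proof (intro allI conjI notI; elim conjE)
    fix i assume "\<sigma> (x + dir i) = \<sigma> x" "\<sigma> (x + dir (i + 2)) = \<sigma> x"
    then show False using L dir_far(1)[of x i] dir_far(3)[of i] unfolding tflips_iff
      by (metis add_left_cancel nbrs_dir)
  next
    fix i assume "\<sigma> (x + dir i) = \<sigma> x" "\<sigma> (x + dir (i + 3)) = \<sigma> x"
    then show False using L dir_far(2)[of x i] dir_far(4)[of i] unfolding tflips_iff
      by (metis add_left_cancel nbrs_dir)
  qed
next
  assume R: ?R
  show ?L unfolding tflips_iff
  proof (intro notI; elim bexE conjE)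
    fix y1 y2 assume a: "y1 \<in> nbrs x" "y2 \<in> nbrs x" "y1 \<noteq> y2" "y2 \<notin> nbrs y1"
      and b: "\<sigma> y1 = \<sigma> x" "\<sigma> y2 = \<sigma> x"
    obtain i j where "y1 = x + dir i" "y2 = x + dir j" "j = i + 2 \<or> j = i + 3 \<or> i = j + 2"
      using a by (rule far_pair)
    then show False using R b by metis
  qed
qed

lemma simple_if_no_alternation:
  fixes \<sigma> x
  defines "f \<equiv> \<lambda>k. \<sigma> (x + dir k)"
  assumes "\<And>k p q. f k \<noteq> f (k + 1) \<Longrightarrow> k + 1 < p \<Longrightarrow> p < q \<Longrightarrow> q < k + 6 \<Longrightarrow> f p = f k \<Longrightarrow> f q \<noteq> f k \<Longrightarrow> False"
  shows "simple \<sigma> x"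
  unfolding simple_def
proof (intro allI impI)
  fix k assume k: "\<sigma> (x + dir k) \<noteq> \<sigma> (x + dir (k + 1))"
  \<comment> \<open>The run of the new colour ends at the first return to the old one; a further
    change before index \<open>k + 6\<close> would be the excluded alternation.\<close>
  define l where "l = (LEAST l. f (k + 1 + l) = f k)"
  have "k + 1 + 5 = k + (6 :: nat)" by simp
  then have f6: "f (k + 1 + 5) = f k" by (simp only: f_def dir_add6)
  have fl: "f (k + 1 + l) = f k" and l5: "l \<le> 5"
    unfolding l_def by (rule LeastI[of _ 5], rule f6, rule Least_le, rule f6)
  have lt: "f (k + 1 + i) \<noteq> f k" if "i < l" for i
    using not_less_Least that unfolding l_def by blast
  have "l \<noteq> 0" using fl k by (auto simp: f_def intro!: gr0I)
  have ge: "f (k + 1 + i) = f k" if "l \<le> i" "i < 6" for i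
  proof (rule ccontr)
    assume ne: "f (k + 1 + i) \<noteq> f k"
    then have "i \<noteq> l" "i \<noteq> 5" using fl f6 by metis+
    then show False
      using assms(2)[of k "k + 1 + l" "k + 1 + i"] k that ne fl \<open>l \<noteq> 0\<close> by (auto simp: f_def)
  qed
  show "\<exists>l\<in>{1..5}. \<forall>i<6. \<sigma> (x + dir (k + 1 + i)) =
      (if i < l then \<sigma> (x + dir (k + 1)) else \<sigma> (x + dir k))"
  proof (intro bexI[of _ l] allI impI)
    fix i :: nat assume "i < 6"
    then show "\<sigma> (x + dir (k + 1 + i)) = (if i < l then \<sigma> (x + dir (k + 1)) else \<sigma> (x + dir k))"
      using lt[of i] ge[of i] k unfolding f_def by (metis not_less)
  next
    show "l \<in> {1..5}" using \<open>l \<noteq> 0\<close> l5 by simp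
  qed
qed

definition flipset :: "site set \<Rightarrow> config \<Rightarrow> config" where
  "flipset Y \<sigma> x = (if x \<in> Y then \<not> \<sigma> x else \<sigma> x)"

lemma tflips_interior:
  assumes "\<sigma> (x + dir k) = c" "\<sigma> (x + dir (k + 1)) = c" "\<sigma> (x + dir (k + 2)) = c"
  shows "x + dir (k + 1) \<notin> tflips \<sigma>"
proof -
  have i: "k + 3 + 2 = k + (5 :: nat)" "k + 2 + 3 = k + (5 :: nat)" by simp_all
  have "x + dir k = x + dir (k + 1) + dir (k + 5)" "x + dir (k + 2) = x + dir (k + 1) + dir (k + 3)"
    using dir_add3[of k] dir_add3[of "k + 2"] dir_add2[of k] by (simp_all only: i) (simp_all add: algebra_simps)
  then have "\<sigma> (x + dir (k + 1) + dir (k + 3)) = \<sigma> (x + dir (k + 1)) \<and>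
      \<sigma> (x + dir (k + 1) + dir (k + 3 + 2)) = \<sigma> (x + dir (k + 1))"
    using assms unfolding i by metis
  then show ?thesis unfolding tflips_ring by blast
qed

text \<open>Let z be the opposite-coloured site next to x and w = \<open>x + dir k\<close>. Around x
  the site \<open>x + dir (k + 2)\<close> is not adjacent to w, and around w the site
  \<open>w + dir (k + 1)\<close> is not adjacent to x, so neither has the colour of x. They are
  opposite neighbours of z and have its colour, so z is supported.\<close>

lemma tflips_beside:
  assumes "x \<in> tflips \<sigma>" "x + dir k \<in> tflips \<sigma>" "\<sigma> (x + dir k) = \<sigma> x" "\<sigma> (x + dir (k + 1)) \<noteq> \<sigma> x"
  shows "x + dir (k + 1) \<notin> tflips \<sigma>"
proof -
  let ?z = "x + dir (k + 1)"
  have 1: "?z + dir (k + 3) = x + dir (k + 2)"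
    using dir_add3[of k] dir_add2[of k] by (simp add: algebra_simps)
  have 2: "?z + dir k = x + dir k + dir (k + 1)" by (simp add: algebra_simps)
  have 3: "x + dir k + dir (k + 3) = x" using dir_add3[of k] by simp
  have i: "k + 1 + 2 = k + (3 :: nat)" by simp
  have "\<sigma> (x + dir (k + 2)) \<noteq> \<sigma> x" using assms(1,3) unfolding tflips_ring by blast
  moreover have "\<sigma> (x + dir k + dir (k + 1)) \<noteq> \<sigma> x"
    using assms(2,3) 3 i unfolding tflips_ring by metis
  ultimately have "\<sigma> (?z + dir k) = \<sigma> ?z" "\<sigma> (?z + dir (k + 3)) = \<sigma> ?z"
    using assms(4) 1 2 by (metis (full_types))+
  then show ?thesis unfolding tflips_ring by blast
qed

text \<open>Mirror image of \<open>tflips_beside\<close>.\<close>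

lemma tflips_beside':
  assumes "x \<in> tflips \<sigma>" "x + dir (k + 1) \<in> tflips \<sigma>" "\<sigma> (x + dir (k + 1)) = \<sigma> x" "\<sigma> (x + dir k) \<noteq> \<sigma> x"
  shows "x + dir k \<notin> tflips \<sigma>"
proof -
  let ?z = "x + dir k"
  have i: "k + 1 + 3 = k + (4 :: nat)" "k + 2 + 3 = k + (5 :: nat)" by simp_all
  have 1: "?z + dir (k + 4) = x + dir (k + 5)"
    using dir_add3[of "k + 1"] dir_add3[of "k + 2"] dir_add2[of k] unfolding i by (simp add: algebra_simps)
  have 2: "?z + dir (k + 1) = x + dir (k + 1) + dir k" by (simp add: algebra_simps)
  have 3: "x + dir (k + 1) + dir (k + 4) = x" using dir_add3[of "k + 1"] unfolding i by simp
  have j: "k + 5 + 2 = k + 1 + (6 :: nat)" "k + 4 + 2 = k + (6 :: nat)" by simp_all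
  have 4: "dir (k + 5 + 2) = dir (k + 1)" "dir (k + 4 + 2) = dir k"
    unfolding j dir_add6 by simp_all
  have "\<sigma> (x + dir (k + 5)) \<noteq> \<sigma> x" using assms(1,3) 4 unfolding tflips_ring by metis
  moreover have "\<sigma> (x + dir (k + 1) + dir k) \<noteq> \<sigma> x"
    using assms(2,3) 3 4 unfolding tflips_ring by metis
  ultimately have "\<sigma> (?z + dir (k + 1)) = \<sigma> ?z" "\<sigma> (?z + dir (k + 1 + 3)) = \<sigma> ?z"
    using assms(4) 1 2 unfolding i by (metis (full_types))+
  then show ?thesis unfolding tflips_ring by blast
qed

text \<open>Hence the synchronous update T may be carried out one site at a time, in any order.\<close>
lemma simple_flipset_tflips:
  assumes x: "x \<in> tflips \<sigma>" and Y: "Y \<subseteq> tflips \<sigma>"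
  shows "simple (flipset Y \<sigma>) x"
proof (rule simple_if_no_alternation)
  fix k p q
  let ?f = "\<lambda>k. flipset Y \<sigma> (x + dir k)"
  assume a: "?f k \<noteq> ?f (k + 1)" "k + 1 < p" "p < q" "q < k + 6" "?f p = ?f k" "?f q \<noteq> ?f k"
  define s where "s i = (\<sigma> (x + dir (k + i)) = \<sigma> x)" for i
  define y where "y i = (x + dir (k + i) \<in> Y)" for i
  have f: "?f (k + i) = (if s i = y i then \<not> \<sigma> x else \<sigma> x)" for i
    by (auto simp: flipset_def s_def y_def)
  have s6: "s (i + 6) = s i" "y (i + 6) = y i" for i
    unfolding s_def y_def by (simp_all only: add.assoc[symmetric] dir_add6)
  have c0: "j = i + 2 \<or> j = i + 3 \<Longrightarrow> \<not> (s i \<and> s j)" for i j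
    using x unfolding tflips_ring s_def by (metis add.assoc)
  have c1: "j = i + 1 \<Longrightarrow> l = i + 2 \<Longrightarrow> \<not> s i \<Longrightarrow> \<not> s j \<Longrightarrow> \<not> s l \<Longrightarrow> \<not> y j" for i j l
    using tflips_interior[of \<sigma> x "k + i" "\<not> \<sigma> x"] Y unfolding s_def y_def by (auto simp: add.assoc)
  have c2: "j = i + 1 \<Longrightarrow> s i \<Longrightarrow> y i \<Longrightarrow> \<not> s j \<Longrightarrow> \<not> y j" for i j
    using tflips_beside[of x \<sigma> "k + i"] x Y unfolding s_def y_def by (auto simp: add.assoc)
  have c3: "j = i + 1 \<Longrightarrow> s j \<Longrightarrow> y j \<Longrightarrow> \<not> s i \<Longrightarrow> \<not> y i" for i j
    using tflips_beside'[of x \<sigma> "k + i"] x Y unfolding s_def y_def by (auto simp: add.assoc)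
  have pq: "p \<in> {k + 2, k + 3, k + 4}" "q \<in> {k + 3, k + 4, k + 5}" using a(2-4) by auto
  obtain P Q where PQ: "p = k + P" "q = k + Q" "P < Q" "P \<in> {2, 3, 4}" "Q \<in> {3, 4, 5}"
    using pq a(3) by auto
  have e: "(s 0 = y 0) \<noteq> (s 1 = y 1)" "(s P = y P) = (s 0 = y 0)" "(s Q = y Q) \<noteq> (s 0 = y 0)"
    using a(1,5,6) f[of 0] f[of 1] f[of P] f[of Q] unfolding PQ by (auto split: if_splits)
  \<comment> \<open>What is left is propositional: s marks neighbours of the colour of x, y those
    already flipped, and for every position (P, Q) of an alternation the constraints on the indices
    0 to 7 are contradictory.\<close>
  note c = c0[of 2 0, simplified] c0[of 3 1, simplified] c0[of 4 2, simplified] c0[of 5 3, simplified]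
    c0[of 6 4, simplified] c0[of 7 5, simplified] c0[of 3 0, simplified] c0[of 4 1, simplified]
    c0[of 5 2, simplified] c1[of 1 0 2, simplified] c1[of 2 1 3, simplified] c1[of 3 2 4, simplified]
    c1[of 4 3 5, simplified] c1[of 5 4 6, simplified] c1[of 6 5 7, simplified] c2[of 1 0, simplified]
    c3[of 1 0, simplified] c2[of 2 1, simplified] c3[of 2 1, simplified] c2[of 3 2, simplified]
    c3[of 3 2, simplified] c2[of 4 3, simplified] c3[of 4 3, simplified] c2[of 5 4, simplified]
    c3[of 5 4, simplified] c2[of 6 5, simplified] c3[of 6 5, simplified] s6(1)[of 0, simplified]
    s6(2)[of 0, simplified] s6(1)[of 1, simplified] s6(2)[of 1, simplified]
  consider "P = 2 \<and> Q = 3" | "P = 2 \<and> Q = 4" | "P = 2 \<and> Q = 5" | "P = 3 \<and> Q = 4" | "P = 3 \<and> Q = 5" | "P = 4 \<and> Q = 5"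
    using PQ(3-5) by auto
  then show False
  proof cases
    case 1 show ?thesis using c e[simplified 1[THEN conjunct1] 1[THEN conjunct2], simplified] by argo
  next case 2 show ?thesis using c e[simplified 2[THEN conjunct1] 2[THEN conjunct2], simplified] by argo
  next case 3 show ?thesis using c e[simplified 3[THEN conjunct1] 3[THEN conjunct2], simplified] by argo
  next case 4 show ?thesis using c e[simplified 4[THEN conjunct1] 4[THEN conjunct2], simplified] by argo
  next case 5 show ?thesis using c e[simplified 5[THEN conjunct1] 5[THEN conjunct2], simplified] by argo
  next case 6 show ?thesis using c e[simplified 6[THEN conjunct1] 6[THEN conjunct2], simplified] by argo
  qed
qed


text \<open>Admissible single flips inside B. They can be undone, because simplicity at x does not
  involve the colour of x itself.\<close>

inductive fstep :: "site set \<Rightarrow> config \<Rightarrow> config \<Rightarrow> bool" for B where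
  "x \<in> B \<Longrightarrow> simple \<sigma> x \<Longrightarrow> fstep B \<sigma> (flip x \<sigma>)"

lemma fstep_sym: "fstep B \<sigma> \<tau> \<Longrightarrow> fstep B \<tau> \<sigma>"
proof (induction rule: fstep.induct)
  case (1 x \<sigma>)
  then show ?case using fstep.intros[of x B "flip x \<sigma>"] by simp
qed

lemma fstep_star_sym: "(fstep B)\<^sup>*\<^sup>* \<sigma> \<tau> \<Longrightarrow> (fstep B)\<^sup>*\<^sup>* \<tau> \<sigma>"
  by (induction rule: rtranclp_induct) (auto intro: fstep_sym converse_rtranclp_into_rtranclp)

lemma bich_flip: "\<not> on_edge x e \<Longrightarrow> bich (flip x \<sigma>) e = bich \<sigma> e"
  by (auto simp: bich_def flip_def)

lemma conn_fstep_star: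
  assumes "(fstep B)\<^sup>*\<^sup>* \<sigma> \<tau>" "\<forall>a\<in>A. fst a \<notin> B \<and> snd a \<notin> B"
    "fst e \<notin> B" "snd e \<notin> B" "fst e' \<notin> B" "snd e' \<notin> B" "bich \<sigma> e" "conn \<sigma> A j e e'" "j > 0"
  shows "bich \<tau> e \<and> (\<exists>j>0. conn \<tau> A j e e')"
  using assms(1)
proof (induction rule: rtranclp_induct)
  case base
  then show ?case using assms by blast
next
  case (step \<tau> \<tau>')
  from step(2) obtain x where x: "x \<in> B" "simple \<tau> x" "\<tau>' = flip x \<tau>" by (auto simp: fstep.simps)
  from step(3) obtain j where "j > 0" "conn \<tau> A j e e'" "bich \<tau> e" by blast
  then show ?case
    using conn_flip[OF x(2), of A e' j e] x assms(2-6) bich_flip[of x e \<tau>] by (metis neq0_conv)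
qed

lemma fstep_star_mono: "(fstep B)\<^sup>*\<^sup>* \<sigma> \<tau> \<Longrightarrow> B \<subseteq> C \<Longrightarrow> (fstep C)\<^sup>*\<^sup>* \<sigma> \<tau>"
  by (erule rtranclp_mono[THEN predicate2D, rotated]) (blast elim: fstep.cases intro: fstep.intros)

lemma fstep_star_flipset:
  assumes "finite Y" "Y \<subseteq> tflips \<sigma>"
  shows "(fstep Y)\<^sup>*\<^sup>* \<sigma> (flipset Y \<sigma>)"
  using assms
proof (induction Y rule: finite_induct)
  case empty
  have "flipset {} \<sigma> = \<sigma>" by (auto simp: flipset_def)
  then show ?case by simp
next
  case (insert x Y)
  have "simple (flipset Y \<sigma>) x" using insert.prems by (intro simple_flipset_tflips) auto
  then have "fstep (insert x Y) (flipset Y \<sigma>) (flip x (flipset Y \<sigma>))" by (intro fstep.intros) auto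
  moreover have "flip x (flipset Y \<sigma>) = flipset (insert x Y) \<sigma>"
    using insert.hyps by (intro ext) (simp add: flip_def flipset_def)
  moreover have "(fstep (insert x Y))\<^sup>*\<^sup>* \<sigma> (flipset Y \<sigma>)"
    using insert.IH insert.prems fstep_star_mono[of Y \<sigma> "flipset Y \<sigma>" "insert x Y"] by auto
  ultimately show ?case by simp
qed

section \<open>Stable sites\<close>

text \<open>The complement of the least fixed point is the largest union of self-supporting sets.\<close>
inductive unst :: "config \<Rightarrow> site \<Rightarrow> bool" for \<sigma> where
  unstI: "\<forall>y1\<in>nbrs x. \<forall>y2\<in>nbrs x. y1 \<noteq> y2 \<and> y2 \<notin> nbrs y1 \<and> \<sigma> y1 = \<sigma> x \<and> \<sigma> y2 = \<sigma> x \<longrightarrow>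
    unst \<sigma> y1 \<or> unst \<sigma> y2 \<Longrightarrow> unst \<sigma> x"

lemma stable_support:
  assumes "\<not> unst \<sigma> x"
  obtains y1 y2 where "y1 \<in> nbrs x" "y2 \<in> nbrs x" "y1 \<noteq> y2" "y2 \<notin> nbrs y1" "\<sigma> y1 = \<sigma> x" "\<sigma> y2 = \<sigma> x"
    "\<not> unst \<sigma> y1" "\<not> unst \<sigma> y2"
  using assms unstI[of x \<sigma>] by blast

lemma self_supporting_stable:
  assumes "\<And>x. x \<in> B \<Longrightarrow> \<exists>y1\<in>nbrs x \<inter> B. \<exists>y2\<in>nbrs x \<inter> B. y1 \<noteq> y2 \<and> y2 \<notin> nbrs y1 \<and> \<sigma> y1 = \<sigma> x \<and> \<sigma> y2 = \<sigma> x"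
  shows "unst \<sigma> x \<Longrightarrow> x \<notin> B"
proof (induction rule: unst.induct)
  case (unstI x)
  then show ?case using assms[of x] by blast
qed

text \<open>Each site of the ring has its two neighbours on the ring, and these are at distance 2
  around z, hence not adjacent. The colour of the centre z is arbitrary.\<close>

lemma ring_stable:
  assumes "\<And>k. \<sigma> (z + dir k) = c"
  shows "\<not> unst \<sigma> (z + dir k)"
proof
  assume "unst \<sigma> (z + dir k)"
  moreover have "\<exists>y1\<in>nbrs x \<inter> range (\<lambda>k. z + dir k). \<exists>y2\<in>nbrs x \<inter> range (\<lambda>k. z + dir k).
      y1 \<noteq> y2 \<and> y2 \<notin> nbrs y1 \<and> \<sigma> y1 = \<sigma> x \<and> \<sigma> y2 = \<sigma> x"
    if x: "x \<in> range (\<lambda>k. z + dir k)" for x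
  proof -
    from x obtain k where k: "x = z + dir k" by auto
    have i: "k + 2 + 3 = k + (5 :: nat)" "k + 5 + 2 = k + 1 + (6 :: nat)" by simp_all
    have 1: "z + dir (k + 1) = x + dir (k + 2)"
      using dir_add2[of k] unfolding k by (simp add: algebra_simps)
    have 2: "z + dir (k + 5) = x + dir (k + 4)"
      using dir_add2[of k] dir_add3[of "k + 2"] dir_add3[of "k + 1"] unfolding k i
      by (simp add: algebra_simps)
    have 3: "z + dir (k + 1) \<notin> nbrs (z + dir (k + 5))" "dir (k + 1) \<noteq> dir (k + 5)"
      using dir_far(1)[of z "k + 5"] dir_far(3)[of "k + 5"] unfolding i dir_add6 by auto
    show ?thesis
    proof (intro bexI conjI)
      show "z + dir (k + 1) \<notin> nbrs (z + dir (k + 5))" "z + dir (k + 5) \<noteq> z + dir (k + 1)" using 3 by auto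
      show "\<sigma> (z + dir (k + 1)) = \<sigma> x" "\<sigma> (z + dir (k + 5)) = \<sigma> x" using assms k by auto
      show "z + dir (k + 1) \<in> nbrs x \<inter> range (\<lambda>k. z + dir k)" using 1 by (metis IntI nbrs_dir rangeI)
      show "z + dir (k + 5) \<in> nbrs x \<inter> range (\<lambda>k. z + dir k)" using 2 by (metis IntI nbrs_dir rangeI)
    qed
  qed
  ultimately show False using self_supporting_stable[of "range (\<lambda>k. z + dir k)"] by blast
qed

text \<open>Otherwise the neighbours of x would form a monochromatic, hence stable, ring, and two
  opposite ones among them would support x.\<close>

lemma unst_has_opposite:
  assumes "unst \<sigma> x"
  obtains u where "u \<in> nbrs x" "\<sigma> u \<noteq> \<sigma> x"
proof (rule ccontr)
  assume n: "\<not> thesis"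
  have same: "\<sigma> (x + dir k) = \<sigma> x" for k using n that[of "x + dir k"] by auto
  from assms have "unst \<sigma> (x + dir 0) \<or> unst \<sigma> (x + dir (0 + 3))"
  proof cases
    case unstI
    then show ?thesis using dir_far(2)[of x 0] dir_far(4)[of 0] same
      by (metis add_left_cancel nbrs_dir)
  qed
  then show False using ring_stable[of \<sigma> x, OF same] by blast
qed

lemma T_eqI:
  assumes "y1 \<in> nbrs x" "y2 \<in> nbrs x" "y1 \<noteq> y2" "y2 \<notin> nbrs y1" "\<sigma> y1 = \<sigma> x" "\<sigma> y2 = \<sigma> x"
  shows "T \<sigma> x = \<sigma> x"
  using assms unfolding T_def by auto

lemma stable_T: "\<not> unst \<sigma> x \<Longrightarrow> (T ^^ n) \<sigma> x = \<sigma> x"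
proof (induction n arbitrary: x)
  case (Suc n)
  obtain y1 y2 where y: "y1 \<in> nbrs x" "y2 \<in> nbrs x" "y1 \<noteq> y2" "y2 \<notin> nbrs y1" "\<sigma> y1 = \<sigma> x" "\<sigma> y2 = \<sigma> x"
    "\<not> unst \<sigma> y1" "\<not> unst \<sigma> y2" by (rule stable_support[OF Suc.prems])
  have "T ((T ^^ n) \<sigma>) x = (T ^^ n) \<sigma> x"
    by (rule T_eqI[OF y(1-4)]) (use Suc y in auto)
  then show ?case using Suc by simp
qed simp


section \<open>Energy\<close>

text \<open>Number of bichromatic lattice edges; using three of the six directions counts each edge
  once, at the end from which it points in direction 0, 1 or 2.\<close>

definition energy :: "site set \<Rightarrow> config \<Rightarrow> int" where
  "energy V \<sigma> = (\<Sum>z\<in>V. \<Sum>k<3. of_bool (\<sigma> z \<noteq> \<sigma> (z + dir k)))"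

lemma sum_lessThan6: "(\<Sum>k<6. f k) = f 0 + f 1 + f 2 + f 3 + f 4 + (f 5 :: int)" for f :: "nat \<Rightarrow> int"
  by (simp add: eval_nat_numeral)

lemma sum_lessThan3: "(\<Sum>k<3. f k) = f 0 + f 1 + (f 2 :: int)" for f :: "nat \<Rightarrow> int"
  by (simp add: eval_nat_numeral)

lemma energy_flip:
  assumes "finite V" "x \<in> V" "nbrs x \<subseteq> V"
  shows "energy V (flip x \<sigma>) = energy V \<sigma> + (\<Sum>k<6. if \<sigma> (x + dir k) = \<sigma> x then 1 else -1)"
proof -
  define t where "t z = (\<Sum>k<3. of_bool (flip x \<sigma> z \<noteq> flip x \<sigma> (z + dir k)) - of_bool (\<sigma> z \<noteq> \<sigma> (z + dir k)) :: int)" for z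
  \<comment> \<open>Three of the edges at x are counted at x and one at each of these three
    neighbours.\<close>
  let ?V = "{x, x + dir 3, x + dir 4, x + dir 5}"
  have d: "dir 3 + dir 0 = 0" "dir 4 + dir 1 = 0" "dir 5 + dir 2 = 0" by (simp_all add: dir_simps zero_prod_def)
  have z0: "t z = 0" if "z \<notin> ?V" for z
  proof -
    have "z + dir 0 \<noteq> x" "z + dir 1 \<noteq> x" "z + dir 2 \<noteq> x" "z \<noteq> x"
      using that d by (auto simp: dir_simps)
    then show ?thesis by (simp add: t_def flip_def sum_lessThan3)
  qed
  have "energy V (flip x \<sigma>) - energy V \<sigma> = (\<Sum>z\<in>V. t z)"
    by (simp add: energy_def t_def sum_subtractf)
  also have "\<dots> = (\<Sum>z\<in>?V. t z)"
    using assms z0 by (intro sum.mono_neutral_right) auto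
  also have "\<dots> = t x + t (x + dir 3) + t (x + dir 4) + t (x + dir 5)"
    using dir_inj[of 3 4] dir_inj[of 3 5] dir_inj[of 4 5] by (simp add: add.assoc)
  also have "\<dots> = (\<Sum>k<6. if \<sigma> (x + dir k) = \<sigma> x then 1 else -1)"
  proof -
    have "t x = (\<Sum>k<3. if \<sigma> (x + dir k) = \<sigma> x then 1 else -1)"
      unfolding t_def by (intro sum.cong) (auto simp: flip_def)
    moreover have "t (x + dir (k + 3)) = (if \<sigma> (x + dir (k + 3)) = \<sigma> x then 1 else -1)" if "k < 3" for k
    proof -
      have b: "x + dir (k + 3) + dir k = x" using dir_add3[of k] by simp
      have nb: "x + dir (k + 3) + dir j \<noteq> x" if "j < 3" "j \<noteq> k" for j
      proof
        assume "x + dir (k + 3) + dir j = x"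
        then have "dir j = dir k" using b by (metis add_left_cancel)
        then show False using dir_inj[of j k] that \<open>k < 3\<close> by simp
      qed
      have "t (x + dir (k + 3)) = (\<Sum>j<3. if j = k then (if \<sigma> (x + dir (k + 3)) = \<sigma> x then 1 else -1) else 0)"
        unfolding t_def
      proof (intro sum.cong refl)
        fix j :: nat assume "j \<in> {..<3}"
        then show "of_bool (flip x \<sigma> (x + dir (k + 3)) \<noteq> flip x \<sigma> (x + dir (k + 3) + dir j)) -
            of_bool (\<sigma> (x + dir (k + 3)) \<noteq> \<sigma> (x + dir (k + 3) + dir j)) =
            (if j = k then (if \<sigma> (x + dir (k + 3)) = \<sigma> x then 1 else -1) else (0 :: int))"
          unfolding flip_dir
          by (cases "j = k") (simp_all only: b, auto simp: flip_def nb[simplified])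
      qed
      then show ?thesis using that by simp
    qed
    from this[of 0] this[of 1] this[of 2] have "t (x + dir 3) = (if \<sigma> (x + dir 3) = \<sigma> x then 1 else -1)"
      "t (x + dir 4) = (if \<sigma> (x + dir 4) = \<sigma> x then 1 else -1)"
      "t (x + dir 5) = (if \<sigma> (x + dir 5) = \<sigma> x then 1 else -1)" by (simp_all add: numeral_eq_Suc)
    ultimately show ?thesis by (simp add: sum_lessThan6 sum_lessThan3)
  qed
  finally show ?thesis by simp
qed

text \<open>Flipping in the order of a linear functional that vanishes on none of the six directions: the two
  opposite-coloured neighbours that may flip along with x lie on a line through x, so at most one
  of them precedes x, and the energy never increases.\<close>
definition height :: "site \<Rightarrow> int" where
  "height x = 2 * fst x + snd x"

lemma energy_flip_max:
  assumes V: "finite V" "x \<in> V" "nbrs x \<subseteq> V"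
    and x: "x \<in> tflips \<sigma>" "Y \<subseteq> tflips \<sigma>" "x \<notin> Y" "\<forall>y\<in>Y. height y \<le> height x"
  shows "energy V (flip x (flipset Y \<sigma>)) \<le> energy V (flipset Y \<sigma>)"
    and "Y = {} \<Longrightarrow> energy V (flip x (flipset Y \<sigma>)) < energy V (flipset Y \<sigma>)"
proof -
  define s where "s i = (\<sigma> (x + dir i) = \<sigma> x)" for i
  define y where "y i = (x + dir i \<in> Y)" for i
  have f: "flipset Y \<sigma> (x + dir i) = flipset Y \<sigma> x \<longleftrightarrow> s i \<noteq> y i" for i
    using x(3) by (auto simp: flipset_def s_def y_def)
  have s6: "s (i + 6) = s i" "y (i + 6) = y i" for i
    unfolding s_def y_def by simp_all
  have c0: "j = i + 2 \<or> j = i + 3 \<Longrightarrow> \<not> (s i \<and> s j)" for i j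
    using x(1) unfolding tflips_ring s_def by metis
  have c1: "j = i + 1 \<Longrightarrow> l = i + 2 \<Longrightarrow> \<not> s i \<Longrightarrow> \<not> s j \<Longrightarrow> \<not> s l \<Longrightarrow> \<not> y j" for i j l
    using tflips_interior[of \<sigma> x "i" "\<not> \<sigma> x"] x(2) unfolding s_def y_def by auto
  \<comment> \<open>Exactly these directions increase the height.\<close>
  have y: "\<not> y 0" "\<not> y 1" "\<not> y 5"
    using x(4) unfolding y_def height_def by (auto simp: dir_simps)
  note c = c0[of 2 0, simplified] c0[of 3 1, simplified] c0[of 4 2, simplified] c0[of 5 3, simplified]
    c0[of 6 4, simplified] c0[of 7 5, simplified] c0[of 3 0, simplified] c0[of 4 1, simplified] c0[of 5 2, simplified]
    c1[of 1 0 2, simplified] c1[of 2 1 3, simplified] c1[of 3 2 4, simplified] c1[of 4 3 5, simplified]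
    c1[of 5 4 6, simplified] c1[of 6 5 7, simplified] s6(1)[of 0, simplified] s6(2)[of 0, simplified]
    s6(1)[of 1, simplified] s6(2)[of 1, simplified] y[simplified]
  have "(\<Sum>k<6. if s k \<noteq> y k then 1 else - 1) \<le> (0 :: int)"
    unfolding sum_lessThan6
    using c unfolding One_nat_def by (smt (verit))
  then show "energy V (flip x (flipset Y \<sigma>)) \<le> energy V (flipset Y \<sigma>)"
    unfolding energy_flip[OF V] f by simp
  assume "Y = {}"
  then have y: "\<not> y 0" "\<not> y 1" "\<not> y 2" "\<not> y 3" "\<not> y 4" "\<not> y 5" by (simp_all add: y_def)
  have "(\<Sum>k<6. if s k \<noteq> y k then 1 else - 1) < (0 :: int)"
    unfolding sum_lessThan6
    using c y unfolding One_nat_def by (smt (verit))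
  then show "energy V (flip x (flipset Y \<sigma>)) < energy V (flipset Y \<sigma>)"
    unfolding energy_flip[OF V] f by simp
qed

text \<open>The highest site is split off as the last to flip. No flip raises the energy, and the
  very first one lowers it strictly, since it sees the unmodified configuration.\<close>

lemma energy_flipset:
  assumes "finite V" "finite Y" "Y \<noteq> {}" "Y \<subseteq> tflips \<sigma>" "Y \<subseteq> V" "\<And>y. y \<in> Y \<Longrightarrow> nbrs y \<subseteq> V"
  shows "energy V (flipset Y \<sigma>) < energy V \<sigma>"
  using assms(2-)
proof (induction "card Y" arbitrary: Y)
  case 0
  then show ?case by auto
next
  case (Suc n)
  have "Max (height ` Y) \<in> height ` Y" using Suc.prems by (intro Max_in) auto
  then obtain x where x: "x \<in> Y" "height x = Max (height ` Y)" by auto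
  have mx: "\<forall>y\<in>Y. height y \<le> height x" using x Suc.prems by simp
  let ?Y = "Y - {x}"
  have eq: "flipset Y \<sigma> = flip x (flipset ?Y \<sigma>)"
    using x by (intro ext) (simp add: flip_def flipset_def)
  have V: "x \<in> V" "nbrs x \<subseteq> V" using x Suc.prems by auto
  show ?case
  proof (cases "?Y = {}")
    case True
    have "flipset {} \<sigma> = \<sigma>" by (auto simp: flipset_def)
    then show ?thesis
      using energy_flip_max(2)[OF assms(1) V, of \<sigma> "{}"] x Suc.prems unfolding eq True by auto
  next
    case False
    have "energy V (flipset ?Y \<sigma>) < energy V \<sigma>"
      using Suc False x by (intro Suc.hyps(1)) auto
    moreover have "energy V (flipset Y \<sigma>) \<le> energy V (flipset ?Y \<sigma>)"
      unfolding eq using energy_flip_max(1)[OF assms(1) V, of \<sigma> ?Y] x Suc.prems mx by auto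
    ultimately show ?thesis by simp
  qed
qed

section \<open>Peeling\<close>

text \<open>An erasing order as in bootstrap percolation: only colour c ever disappears, and each
  site has lost its support when its turn comes.\<close>

fun peel :: "bool \<Rightarrow> config \<Rightarrow> site list \<Rightarrow> bool" where
  "peel c \<sigma> [] = True"
| "peel c \<sigma> (x # xs) = (\<sigma> x = c \<and> x \<in> tflips \<sigma> \<and> peel c (flip x \<sigma>) xs)"

text \<open>Support for colour c only weakens as sites of colour c disappear, so skipping the sites
  already absent leaves a valid order.\<close>

lemma peel_mono:
  assumes "peel c \<sigma> xs" "\<And>x. \<tau> x = c \<Longrightarrow> \<sigma> x = c"
  shows "\<exists>ys. peel c \<tau> ys \<and> set ys = {x \<in> set xs. \<tau> x = c}"
  using assms
proof (induction xs arbitrary: \<sigma> \<tau>)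
  case Nil
  then show ?case by (intro exI[of _ "[]"]) simp
next
  case (Cons x xs)
  show ?case
  proof (cases "\<tau> x = c")
    case True
    have le: "flip x \<tau> z = c \<Longrightarrow> flip x \<sigma> z = c" for z
      using Cons.prems True by (auto simp: flip_def split: if_splits)
    obtain ys where ys: "peel c (flip x \<tau>) ys" "set ys = {z \<in> set xs. flip x \<tau> z = c}"
      using Cons.IH[of "flip x \<sigma>" "flip x \<tau>"] Cons.prems le by auto
    have "x \<in> tflips \<tau>"
      using Cons.prems True unfolding peel.simps tflips_iff by metis
    then have "peel c \<tau> (x # ys)" using ys True by simp
    moreover have "set (x # ys) = {z \<in> set (x # xs). \<tau> z = c}"
      using ys(2) True by (auto simp: flip_def split: if_splits)
    ultimately show ?thesis by blast
  next
    case False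
    have le: "\<tau> z = c \<Longrightarrow> flip x \<sigma> z = c" for z
      using Cons.prems(2)[of z] False by (auto simp: flip_def split: if_splits)
    obtain ys where "peel c \<tau> ys" "set ys = {z \<in> set xs. \<tau> z = c}"
      using Cons.IH[of "flip x \<sigma>" \<tau>] Cons.prems le by auto
    then show ?thesis using False by (intro exI[of _ ys]) auto
  qed
qed

lemma peel_colour: "peel c \<sigma> xs \<Longrightarrow> x \<in> set xs \<Longrightarrow> \<sigma> x = c"
proof (induction xs arbitrary: \<sigma>)
  case (Cons y ys)
  show ?case
  proof (cases "x = y")
    case False
    then have "flip y \<sigma> x = c" using Cons.IH[of "flip y \<sigma>"] Cons.prems by auto
    then show ?thesis using False by (simp add: flip_def)
  qed (use Cons.prems in auto)
qed simp

lemma peel_append: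
  "peel c \<sigma> xs \<Longrightarrow> peel c (flipset (set xs) \<sigma>) ys \<Longrightarrow> peel c \<sigma> (xs @ ys)"
proof (induction xs arbitrary: \<sigma>)
  case Nil
  have "flipset {} \<sigma> = \<sigma>" by (auto simp: flipset_def)
  then show ?case using Nil by simp
next
  case (Cons x xs)
  have "x \<notin> set xs" using peel_colour[of c "flip x \<sigma>" xs x] Cons.prems(1) by (auto simp: flip_def)
  then have "flipset (set (x # xs)) \<sigma> = flipset (set xs) (flip x \<sigma>)"
    by (intro ext) (simp add: flip_def flipset_def)
  then show ?case using Cons by simp
qed

text \<open>After the first list has been erased, monotonicity still allows what is left of the
  second.\<close>

lemma peel_union:
  assumes "peel c \<sigma> xs" "peel c \<sigma> ys"
  shows "\<exists>zs. peel c \<sigma> zs \<and> set zs = set xs \<union> set ys"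
proof -
  have "flipset (set xs) \<sigma> x = c \<Longrightarrow> \<sigma> x = c" for x
    using peel_colour[OF assms(1), of x] by (simp add: flipset_def split: if_splits)
  then obtain ys' where ys': "peel c (flipset (set xs) \<sigma>) ys'" "set ys' = {x \<in> set ys. flipset (set xs) \<sigma> x = c}"
    using peel_mono[OF assms(2), of "flipset (set xs) \<sigma>"] by blast
  have "set ys \<subseteq> set xs \<union> set ys'"
    using peel_colour[OF assms(2)] unfolding ys'(2) by (auto simp: flipset_def)
  then show ?thesis using peel_append[OF assms(1) ys'(1)] ys'(2) by (intro exI[of _ "xs @ ys'"]) auto
qed

lemma peel_finite_union:
  assumes "finite Z" "\<And>z. z \<in> Z \<Longrightarrow> \<exists>xs. peel c \<sigma> xs \<and> z \<in> set xs \<and> set xs \<subseteq> B"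
  shows "\<exists>xs. peel c \<sigma> xs \<and> Z \<subseteq> set xs \<and> set xs \<subseteq> B"
  using assms
proof (induction Z rule: finite_induct)
  case empty
  then show ?case by (intro exI[of _ "[]"]) simp
next
  case (insert z Z)
  then obtain xs ys where "peel c \<sigma> xs" "Z \<subseteq> set xs" "set xs \<subseteq> B" "peel c \<sigma> ys" "z \<in> set ys" "set ys \<subseteq> B"
    by (metis insertCI)
  then show ?case using peel_union[of c \<sigma> xs ys] by fastforce
qed

text \<open>By induction every neighbour on which the instability of x relies has its own finite
  list. As there are at most six of them, their lists merge into one, after which x has no
  supporting pair left and can be erased too.\<close>

lemma unst_peel:
  "unst \<sigma> x \<Longrightarrow> \<exists>xs. peel (\<sigma> x) \<sigma> xs \<and> x \<in> set xs \<and> set xs \<subseteq> Collect (unst \<sigma>)"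
proof (induction rule: unst.induct)
  case (unstI x)
  let ?Z = "{y \<in> nbrs x. \<exists>xs. peel (\<sigma> x) \<sigma> xs \<and> y \<in> set xs \<and> set xs \<subseteq> Collect (unst \<sigma>)}"
  have "finite ?Z" by simp
  then have "\<exists>xs. peel (\<sigma> x) \<sigma> xs \<and> ?Z \<subseteq> set xs \<and> set xs \<subseteq> Collect (unst \<sigma>)"
    by (rule peel_finite_union) blast
  then obtain xs where xs: "peel (\<sigma> x) \<sigma> xs" "?Z \<subseteq> set xs" "set xs \<subseteq> Collect (unst \<sigma>)"
    by blast
  show ?case
  proof (cases "x \<in> set xs")
    case False
    let ?\<tau> = "flipset (set xs) \<sigma>"
    have fx: "?\<tau> x = \<sigma> x" using False by (simp add: flipset_def)
    have aux: "y \<notin> set xs \<and> \<sigma> y = \<sigma> x" if "?\<tau> y = \<sigma> x" for y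
      using peel_colour[OF xs(1), of y] that by (cases "y \<in> set xs") (simp_all add: flipset_def)
    have "x \<in> tflips ?\<tau>" unfolding tflips_iff
    proof (intro notI; elim bexE conjE)
      fix y1 y2 assume y: "y1 \<in> nbrs x" "y2 \<in> nbrs x" "y1 \<noteq> y2" "?\<tau> y1 = ?\<tau> x" "?\<tau> y2 = ?\<tau> x" "y2 \<notin> nbrs y1"
      have n: "y1 \<notin> set xs" "y2 \<notin> set xs" "\<sigma> y1 = \<sigma> x" "\<sigma> y2 = \<sigma> x"
        using aux[of y1] aux[of y2] y(4,5) fx by simp_all
      have a: "y \<in> ?Z" if "y \<in> nbrs x" "\<sigma> y = \<sigma> x"
        "\<exists>xs. peel (\<sigma> y) \<sigma> xs \<and> y \<in> set xs \<and> set xs \<subseteq> Collect (unst \<sigma>)" for y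
        using that unfolding that(2) by blast
      have b: "(\<exists>xs. peel (\<sigma> y1) \<sigma> xs \<and> y1 \<in> set xs \<and> set xs \<subseteq> Collect (unst \<sigma>)) \<or>
        (\<exists>xs. peel (\<sigma> y2) \<sigma> xs \<and> y2 \<in> set xs \<and> set xs \<subseteq> Collect (unst \<sigma>))"
        using unstI y n by blast
      from b show False
      proof
        assume "\<exists>xs. peel (\<sigma> y1) \<sigma> xs \<and> y1 \<in> set xs \<and> set xs \<subseteq> Collect (unst \<sigma>)"
        from a[OF y(1) n(3) this] show False using n(1) xs(2) by blast
      next
        assume "\<exists>xs. peel (\<sigma> y2) \<sigma> xs \<and> y2 \<in> set xs \<and> set xs \<subseteq> Collect (unst \<sigma>)"
        from a[OF y(2) n(4) this] show False using n(2) xs(2) by blast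
      qed
    qed
    then have "peel (\<sigma> x) \<sigma> (xs @ [x])" using xs(1) fx by (intro peel_append) simp_all
    moreover have "unst \<sigma> x" using unstI by (intro unst.unstI) blast
    ultimately show ?thesis using xs(3) by (intro exI[of _ "xs @ [x]"]) auto
  qed (use xs in blast)
qed

section \<open>Stretches of interface that avoid a set of edges\<close>

definition gap :: "config \<Rightarrow> edge set \<Rightarrow> edge \<Rightarrow> edge \<Rightarrow> bool" where
  "gap \<sigma> A e e' \<longleftrightarrow> bich \<sigma> e \<and> bich \<sigma> e' \<and> e \<notin> A \<and> e' \<notin> A \<and>
     (\<exists>j. conn \<sigma> A j e e' \<or> conn \<sigma> A j e' e)"

lemma gap_sym: "gap \<sigma> A e e' \<Longrightarrow> gap \<sigma> A e' e"
  unfolding gap_def by blast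

lemma conn_append:
  assumes "conn \<sigma> A j e e'" "conn \<sigma> A k e' e''" "e' \<notin> A"
  shows "conn \<sigma> A (k + j) e e''"
  unfolding conn_def
proof (intro conjI allI impI)
  have e': "(step \<sigma> ^^ j) e = e'" using assms(1) by (simp add: conn_def)
  show "(step \<sigma> ^^ (k + j)) e = e''" using assms(2) e' by (simp add: conn_def funpow_add)
  fix i assume i: "0 < i \<and> i < k + j"
  consider "i < j" | "i = j" | "i > j" by linarith
  then show "(step \<sigma> ^^ i) e \<notin> A"
  proof cases
    case 3
    then have "(step \<sigma> ^^ i) e = (step \<sigma> ^^ (i - j)) e'"
      using e' funpow_add[of "i - j" j "step \<sigma>"] by simp
    then show ?thesis using assms(2) 3 i by (auto simp: conn_def)
  qed (use assms i e' in \<open>auto simp: conn_def\<close>)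
qed

lemma conn_drop:
  assumes "conn \<sigma> A j e e'" "k \<le> j"
  shows "conn \<sigma> A (j - k) ((step \<sigma> ^^ k) e) e'"
proof -
  have "(step \<sigma> ^^ i) ((step \<sigma> ^^ k) e) = (step \<sigma> ^^ (i + k)) e" for i by (simp add: funpow_add)
  then show ?thesis using assms by (auto simp: conn_def)
qed

lemma conn_take:
  assumes "conn \<sigma> A j e e'" "k \<le> j"
  shows "conn \<sigma> A k e ((step \<sigma> ^^ k) e)"
  using assms by (auto simp: conn_def)

lemma conn_common_end:
  assumes "conn \<sigma> A j e e'" "conn \<sigma> A k e'' e'" "bich \<sigma> e" "bich \<sigma> e''" "k \<le> j"
  shows "conn \<sigma> A (j - k) e e''"
proof -
  have "(step \<sigma> ^^ k) ((step \<sigma> ^^ (j - k)) e) = (step \<sigma> ^^ k) e''"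
    using assms(1,2,5) funpow_add[of k "j - k" "step \<sigma>"] by (simp add: conn_def)
  then have "(step \<sigma> ^^ (j - k)) e = e''"
    by (rule step_funpow_inj[OF bich_funpow[OF assms(3)] assms(4)])
  then show ?thesis using conn_take[OF assms(1), of "j - k"] by simp
qed

text \<open>Orbits are deterministic forwards and, by injectivity of \<open>step\<close>, backwards,
  so two stretches with a common start or a common end are nested. Concatenation works because the
  ends of a gap lie outside A.\<close>

lemma gap_trans:
  assumes "gap \<sigma> A e e'" "gap \<sigma> A e' e''"
  shows "gap \<sigma> A e e''"
proof -
  note g = assms[unfolded gap_def]
  have "\<exists>j. conn \<sigma> A j e e'' \<or> conn \<sigma> A j e'' e"
  proof -
    obtain j k where jk: "conn \<sigma> A j e e' \<or> conn \<sigma> A j e' e" "conn \<sigma> A k e' e'' \<or> conn \<sigma> A k e'' e'"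
      using g by blast
    have split: ?thesis if "conn \<sigma> A j e' e" "conn \<sigma> A k e' e''"
    proof (cases "j \<le> k")
      case True
      then show ?thesis using conn_drop[OF that(2) True] that(1) by (auto simp: conn_def)
    next
      case False
      then have "k \<le> j" by simp
      then show ?thesis using conn_drop[OF that(1) \<open>k \<le> j\<close>] that(2) by (auto simp: conn_def)
    qed
    have join: ?thesis if "conn \<sigma> A j e e'" "conn \<sigma> A k e'' e'"
      using conn_common_end[OF that] conn_common_end[OF that(2,1)] g by (meson nle_le)
    show ?thesis using jk conn_append[of \<sigma> A j e e' k e''] conn_append[of \<sigma> A k e'' e' j e] split join g by blast
  qed
  then show ?thesis using g by (auto simp: gap_def)
qed

lemma gap_flip:
  assumes "gap (flip x \<sigma>) A e e'" "simple \<sigma> x" "\<forall>a\<in>A. \<not> on_edge x a" "\<not> on_edge x e" "\<not> on_edge x e'"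
  shows "gap \<sigma> A e e'"
proof -
  have s: "simple (flip x \<sigma>) x" using assms(2) by simp
  have "\<exists>j'. conn \<sigma> A j' f f'" if "conn (flip x \<sigma>) A j f f'" "bich (flip x \<sigma>) f" "\<not> on_edge x f" "\<not> on_edge x f'" for j f f'
    using conn_flip[OF s assms(3) that(4) that(1-3)] by auto
  then show ?thesis using assms unfolding gap_def by (metis bich_flip)
qed

lemma conn_swap:
  assumes "conn \<sigma> A j e e'" "bich \<sigma> e" "\<And>a. a \<in> A \<Longrightarrow> prod.swap a \<in> A"
  shows "conn \<sigma> A j (prod.swap e') (prod.swap e)"
  unfolding conn_def
proof (intro conjI allI impI)
  have e': "e' = (step \<sigma> ^^ j) e" using assms(1) by (simp add: conn_def)
  show "(step \<sigma> ^^ j) (prod.swap e') = prod.swap e" unfolding e' using funpow_swap[OF assms(2), of j j] by simp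
  fix i assume i: "0 < i \<and> i < j"
  then have "(step \<sigma> ^^ (j - i)) e \<notin> A" using assms(1) by (auto simp: conn_def)
  then show "(step \<sigma> ^^ i) (prod.swap e') \<notin> A"
    unfolding e' using funpow_swap[OF assms(2), of i j] i assms(3) by (metis less_imp_le swap_swap)
qed

lemma gap_swap:
  assumes "gap \<sigma> A e e'" "\<And>a. a \<in> A \<Longrightarrow> prod.swap a \<in> A"
  shows "gap \<sigma> A (prod.swap e) (prod.swap e')"
  using assms conn_swap[OF _ _ assms(2)] unfolding gap_def by (metis bich_swap swap_swap)

lemma tflips_simple: "x \<in> tflips \<sigma> \<Longrightarrow> simple \<sigma> x"
  using simple_flipset_tflips[of x \<sigma> "{}"] by (simp add: flipset_def[abs_def])

lemma conn_run_up:
  assumes "\<forall>i\<le>j. \<sigma> (x + dir (k + i)) \<noteq> \<sigma> x" "\<forall>a\<in>A. \<not> on_edge x a"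
  shows "conn \<sigma> A j (x, x + dir k) (x, x + dir (k + j))"
  unfolding conn_def
proof (intro conjI allI impI)
  show "(step \<sigma> ^^ j) (x, x + dir k) = (x, x + dir (k + j))" using assms(1) by (rule run_up)
  fix i assume "0 < i \<and> i < j"
  then have "(step \<sigma> ^^ i) (x, x + dir k) = (x, x + dir (k + i))" using assms(1) by (intro run_up) auto
  then show "(step \<sigma> ^^ i) (x, x + dir k) \<notin> A" using assms(2) by auto
qed

text \<open>Two neighbours of the opposite colour divide the ring into two arcs. If one arc contains
  a neighbour of the colour of x, the other contains none, since it would be at distance 2 or 3 from
  the first. The interface follows a free arc.\<close>

lemma gap_around_site:
  assumes x: "x \<in> tflips \<sigma>" and A: "\<forall>a\<in>A. \<not> on_edge x a"
    and "u \<in> nbrs x" "\<sigma> u \<noteq> \<sigma> x" "v \<in> nbrs x" "\<sigma> v \<noteq> \<sigma> x"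
  shows "gap \<sigma> A (x, u) (x, v)"
proof -
  have main: "\<exists>j. conn \<sigma> A j (x, x + dir i) (x, x + dir j') \<or> conn \<sigma> A j (x, x + dir j') (x, x + dir i)"
    if ij: "i \<le> j'" "j' < 6" and op: "\<sigma> (x + dir i) \<noteq> \<sigma> x" "\<sigma> (x + dir j') \<noteq> \<sigma> x" for i j'
  proof (cases "\<forall>l\<le>j' - i. \<sigma> (x + dir (i + l)) \<noteq> \<sigma> x")
    case True
    then show ?thesis using conn_run_up[OF True A] ij by auto
  next
    case False
    then obtain l where l: "l \<le> j' - i" "\<sigma> (x + dir (i + l)) = \<sigma> x" by auto
    define m where "m = i + l"
    have m: "i < m" "m < j'" "\<sigma> (x + dir m) = \<sigma> x"
      using l ij op unfolding m_def by (auto simp: le_less intro: gr0I)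
    have i6: "i + 6 = j' + (i + 6 - j')" using ij by simp
    have "\<forall>l\<le>i + 6 - j'. \<sigma> (x + dir (j' + l)) \<noteq> \<sigma> x"
    proof (intro allI impI notI)
      fix l assume l: "l \<le> i + 6 - j'" "\<sigma> (x + dir (j' + l)) = \<sigma> x"
      define m' where "m' = j' + l"
      have m': "\<sigma> (x + dir m') = \<sigma> x" "j' \<le> m'" "m' \<le> i + 6" using l ij unfolding m'_def by auto
      have "m' \<noteq> j'" "m' \<noteq> i + 6" using m'(1) op by auto
      then have "m' = m + 2 \<or> m' = m + 3 \<or> m + 6 = m' + 2" using m m'(2,3) ij by linarith
      then show False using x m(3) m'(1) dir_add6[of m] unfolding tflips_ring by metis
    qed
    from conn_run_up[OF this A] show ?thesis unfolding i6[symmetric] dir_add6 by blast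
  qed
  obtain i j where ij: "i < 6" "j < 6" "u = x + dir i" "v = x + dir j"
    using assms by (auto simp: nbrs_iff_ex)
  have "\<exists>l. conn \<sigma> A l (x, u) (x, v) \<or> conn \<sigma> A l (x, v) (x, u)"
    using main[of i j] main[of j i] ij assms by (metis nle_le)
  then show ?thesis using assms by (auto simp: gap_def bich_def)
qed

text \<open>The two common neighbours of x and w are at distance 2 around x, so one of them, r, has
  the opposite colour; in the triangle x, w, r the two edges at r are one step apart.\<close>

lemma gap_to_nbr:
  assumes x: "x \<in> tflips \<sigma>" and A: "\<forall>a\<in>A. \<not> on_edge x a" "\<forall>a\<in>A. \<not> on_edge w a"
    and w: "w \<in> nbrs x" "\<sigma> w = \<sigma> x"
  obtains r where "r \<in> nbrs x" "r \<in> nbrs w" "\<sigma> r \<noteq> \<sigma> x" "gap \<sigma> A (x, r) (w, r)"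
proof -
  obtain m where m: "w = x + dir m" using w by (auto simp: nbrs_iff_ex)
  have i: "m + 5 + 1 = m + (6::nat)" "m + 5 + 2 = m + 1 + (6::nat)" by simp_all
  have "\<not> (\<sigma> (x + dir (m + 5)) = \<sigma> x \<and> \<sigma> (x + dir (m + 5 + 2)) = \<sigma> x)"
    using x unfolding tflips_ring by blast
  then consider "\<sigma> (x + dir (m + 5)) \<noteq> \<sigma> x" | "\<sigma> (x + dir (m + 1)) \<noteq> \<sigma> x"
    unfolding i dir_add6 by blast
  then show ?thesis
  proof cases
    case 1
    let ?r = "x + dir (m + 5)"
    have "ahead (x, ?r) = w" using ahead_dir[of x "m + 5"] unfolding i dir_add6 m .
    then have s: "step \<sigma> (x, ?r) = (w, ?r)" and "w \<in> nbrs ?r"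
      using w ahead_nbrs[of "(x, ?r)"] by (auto simp: step_def)
    have "conn \<sigma> A 1 (x, ?r) (w, ?r)" using s by (simp add: conn_def)
    moreover have rw: "?r \<in> nbrs w" using \<open>w \<in> nbrs ?r\<close> nbrs_sym[of w ?r] by simp
    ultimately have "gap \<sigma> A (x, ?r) (w, ?r)"
      using 1 A w unfolding gap_def bich_def by auto
    then show ?thesis using that[of ?r] 1 rw by auto
  next
    case 2
    let ?r = "x + dir (m + 1)"
    have a: "ahead (w, ?r) = x" using ahead_ring[of x m] unfolding m .
    have rw: "?r \<in> nbrs w" using ahead_nbrs[of "(x, w)"] w ahead_dir[of x m] unfolding m by simp
    have s: "step \<sigma> (w, ?r) = (x, ?r)"
      using w a by (simp add: step_def)
    have "conn \<sigma> A 1 (w, ?r) (x, ?r)" using s by (simp add: conn_def)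
    then have "gap \<sigma> A (x, ?r) (w, ?r)"
      using 2 A w rw unfolding gap_def bich_def by auto
    then show ?thesis using that[of ?r] 2 rw by auto
  qed
qed

text \<open>When the first site x of the list is erased, the interface runs around it in a single arc, and this
  arc also touches the remaining neighbours of x of colour c.\<close>
lemma peel_gap:
  assumes "peel c \<sigma> xs" "\<forall>a\<in>A. fst a \<notin> set xs \<and> snd a \<notin> set xs"
    "w \<in> set xs" "w' \<in> set xs" "w = w' \<or> w' \<in> nbrs w"
    "u \<in> nbrs w" "\<sigma> u \<noteq> c" "u' \<in> nbrs w'" "\<sigma> u' \<noteq> c"
  shows "gap \<sigma> A (w, u) (w', u')"
  using assms
proof (induction xs arbitrary: \<sigma> w w' u u')
  case (Cons x xs)
  have xc: "\<sigma> x = c" and xt: "x \<in> tflips \<sigma>" and px: "peel c (flip x \<sigma>) xs" using Cons.prems by auto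
  have Ax: "\<forall>a\<in>A. \<not> on_edge x a" using Cons.prems(2) by auto
  have colour: "\<sigma> y = c" if "y \<in> set (x # xs)" for y using peel_colour[OF Cons.prems(1) that] .
  have later: "gap \<sigma> A (w, u) (w', u')"
    if "w \<in> set xs" "w' \<in> set xs" "w = w' \<or> w' \<in> nbrs w" "u \<in> nbrs w" "\<sigma> u \<noteq> c" "u' \<in> nbrs w'" "\<sigma> u' \<noteq> c"
    for w w' u u'
  proof -
    have ne: "w \<noteq> x" "w' \<noteq> x" "u \<noteq> x" "u' \<noteq> x"
      using peel_colour[OF px, of x] that xc by (auto simp: flip_def)
    then have "gap (flip x \<sigma>) A (w, u) (w', u')"
      using that Cons.prems(2) by (intro Cons.IH[OF px]) (auto simp: flip_def)
    then show ?thesis by (rule gap_flip[OF _ tflips_simple[OF xt] Ax]) (use ne in auto)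
  qed
  have first: "gap \<sigma> A (x, u) (w', u')"
    if h: "w' \<in> set xs" "w' \<in> nbrs x" "u \<in> nbrs x" "\<sigma> u \<noteq> c" "u' \<in> nbrs w'" "\<sigma> u' \<noteq> c" for w' u u'
  proof -
    have "\<forall>a\<in>A. \<not> on_edge w' a" using Cons.prems(2) h(1) by auto
    then obtain r where r: "r \<in> nbrs x" "r \<in> nbrs w'" "\<sigma> r \<noteq> \<sigma> x" "gap \<sigma> A (x, r) (w', r)"
      using gap_to_nbr[OF xt Ax, of w'] h(2) colour[of w'] h(1) xc by auto
    have "gap \<sigma> A (x, u) (x, r)" using gap_around_site[OF xt Ax] h r xc by auto
    moreover have "gap \<sigma> A (w', r) (w', u')" using h r xc by (intro later) auto
    ultimately show ?thesis using r(4) gap_trans by blast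
  qed
  consider "w = x" "w' = x" | "w = x" "w' \<noteq> x" | "w \<noteq> x" "w' = x" | "w \<noteq> x" "w' \<noteq> x" by blast
  then show ?case
  proof cases
    case 1
    then show ?thesis using gap_around_site[OF xt Ax] Cons.prems xc by auto
  next
    case 2
    then show ?thesis using first Cons.prems by auto
  next
    case 3
    then show ?thesis using first[of w u' u] Cons.prems gap_sym nbrs_sym[of w x] by auto
  next
    case 4
    then show ?thesis using later Cons.prems by auto
  qed
qed simp

definition stab :: "config \<Rightarrow> edge set" where
  "stab \<sigma> = {e. bich \<sigma> e \<and> \<not> unst \<sigma> (fst e) \<and> \<not> unst \<sigma> (snd e)}"

lemma stab_swap: "a \<in> stab \<sigma> \<Longrightarrow> prod.swap a \<in> stab \<sigma>"
  by (auto simp: stab_def)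

text \<open>One list erases both sites. It consists of unstable sites, so no stable edge touches
  it.\<close>

lemma unst_gap_same_colour:
  assumes "unst \<sigma> w" "unst \<sigma> w'" "w = w' \<or> w' \<in> nbrs w" "\<sigma> w = \<sigma> w'"
    "u \<in> nbrs w" "\<sigma> u \<noteq> \<sigma> w" "u' \<in> nbrs w'" "\<sigma> u' \<noteq> \<sigma> w'"
  shows "gap \<sigma> (stab \<sigma>) (w, u) (w', u')"
proof -
  obtain xs ys where xs: "peel (\<sigma> w) \<sigma> xs" "w \<in> set xs" "set xs \<subseteq> Collect (unst \<sigma>)"
    and ys: "peel (\<sigma> w) \<sigma> ys" "w' \<in> set ys" "set ys \<subseteq> Collect (unst \<sigma>)"
    using unst_peel[OF assms(1)] unst_peel[OF assms(2)] unfolding assms(4) by blast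
  obtain zs where zs: "peel (\<sigma> w) \<sigma> zs" "set zs = set xs \<union> set ys"
    using peel_union[OF xs(1) ys(1)] by blast
  show ?thesis
    by (rule peel_gap[OF zs(1)]) (use zs(2) xs ys assms in \<open>auto simp: stab_def\<close>)
qed

text \<open>Requiring spin +1 at the first end fixes one orientation for all interfaces, so that
  gaps found by erasing either colour can be composed.\<close>

definition edges_at :: "config \<Rightarrow> site \<Rightarrow> edge set" where
  "edges_at \<sigma> w = {e. bich \<sigma> e \<and> \<sigma> (fst e) \<and> on_edge w e}"

lemma edges_at_nonempty:
  assumes "unst \<sigma> w"
  obtains e where "e \<in> edges_at \<sigma> w"
proof -
  obtain u where u: "u \<in> nbrs w" "\<sigma> u \<noteq> \<sigma> w" by (rule unst_has_opposite[OF assms])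
  show ?thesis
  proof (cases "\<sigma> w")
    case True
    then show ?thesis using that[of "(w, u)"] u by (auto simp: edges_at_def bich_def)
  next
    case False
    then show ?thesis using that[of "(u, w)"] u nbrs_sym[of u w] by (auto simp: edges_at_def bich_def)
  qed
qed

text \<open>For neighbours of opposite colours the edge between them lies at both sites and links
  the two one-site cases.\<close>

lemma unst_gap_adjacent:
  assumes "unst \<sigma> w" "unst \<sigma> w'" "w = w' \<or> w' \<in> nbrs w" "e \<in> edges_at \<sigma> w" "e' \<in> edges_at \<sigma> w'"
  shows "gap \<sigma> (stab \<sigma>) e e'"
proof -
  have same: "gap \<sigma> (stab \<sigma>) e e'"
    if "unst \<sigma> w" "unst \<sigma> w'" "w = w' \<or> w' \<in> nbrs w" "\<sigma> w = \<sigma> w'" "e \<in> edges_at \<sigma> w" "e' \<in> edges_at \<sigma> w'" for w w' e e'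
  proof (cases "\<sigma> w")
    case True
    have fw: "fst e = w" "fst e' = w'" using that(4-6) True unfolding edges_at_def bich_def by auto
    then have "e = (w, snd e)" "e' = (w', snd e')" by auto
    moreover have "snd e \<in> nbrs w" "\<not> \<sigma> (snd e)" "snd e' \<in> nbrs w'" "\<not> \<sigma> (snd e')"
      using that(4-6) True fw unfolding edges_at_def bich_def by auto
    ultimately show ?thesis using unst_gap_same_colour[OF that(1-4), of "snd e" "snd e'"] that(4) True by simp
  next
    case False
    have fw: "snd e = w" "snd e' = w'" using that(4-6) False unfolding edges_at_def bich_def by auto
    then have "prod.swap e = (w, fst e)" "prod.swap e' = (w', fst e')" by (auto simp: prod.swap_def)
    moreover have "fst e \<in> nbrs w" "\<sigma> (fst e)" "fst e' \<in> nbrs w'" "\<sigma> (fst e')"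
      using that(4-6) False fw nbrs_sym[of "fst e" w] nbrs_sym[of "fst e'" w'] unfolding edges_at_def bich_def by auto
    ultimately have "gap \<sigma> (stab \<sigma>) (prod.swap e) (prod.swap e')"
      using unst_gap_same_colour[OF that(1-4), of "fst e" "fst e'"] that(4) False by simp
    from gap_swap[OF this stab_swap] show ?thesis by simp
  qed
  show ?thesis
  proof (cases "\<sigma> w = \<sigma> w'")
    case True
    then show ?thesis using same assms by blast
  next
    case False
    then have "w' \<in> nbrs w" using assms(3) by auto
    define f where "f = (if \<sigma> w then (w, w') else (w', w))"
    have "f \<in> edges_at \<sigma> w" "f \<in> edges_at \<sigma> w'"
      using False \<open>w' \<in> nbrs w\<close> nbrs_sym[of w w'] unfolding f_def edges_at_def bich_def by auto
    then show ?thesis using same[of w w e f] same[of w' w' f e'] assms gap_trans by blast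
  qed
qed

section \<open>Components of unstable sites\<close>

definition adj_unst :: "config \<Rightarrow> site \<Rightarrow> site \<Rightarrow> bool" where
  "adj_unst \<sigma> x y \<longleftrightarrow> y \<in> nbrs x \<and> unst \<sigma> x \<and> unst \<sigma> y"

definition ucomp :: "config \<Rightarrow> site \<Rightarrow> site set" where
  "ucomp \<sigma> x = {y. (adj_unst \<sigma>)\<^sup>*\<^sup>* x y}"

lemma ucomp_unst:
  assumes "unst \<sigma> x" "y \<in> ucomp \<sigma> x"
  shows "unst \<sigma> y"
  using assms(2) unfolding ucomp_def mem_Collect_eq
  by (induction rule: rtranclp_induct) (use assms(1) in \<open>simp_all add: adj_unst_def\<close>)

lemma ucomp_refl [simp]: "x \<in> ucomp \<sigma> x"
  by (simp add: ucomp_def)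

lemma ucomp_step: "unst \<sigma> x \<Longrightarrow> y \<in> ucomp \<sigma> x \<Longrightarrow> z \<in> nbrs y \<Longrightarrow> unst \<sigma> z \<Longrightarrow> z \<in> ucomp \<sigma> x"
  using ucomp_unst[of \<sigma> x y] unfolding ucomp_def mem_Collect_eq
  by (auto simp: adj_unst_def intro: rtranclp.rtrancl_into_rtrancl)

text \<open>This reduces the diameter of a component, which may contain both colours, to the
  displacement along a single run without stable edges.\<close>

lemma ucomp_gap:
  assumes "unst \<sigma> w" "w' \<in> ucomp \<sigma> w" "e \<in> edges_at \<sigma> w" "e' \<in> edges_at \<sigma> w'"
  shows "gap \<sigma> (stab \<sigma>) e e'"
  using assms(2,4) unfolding ucomp_def mem_Collect_eq
proof (induction arbitrary: e' rule: rtranclp_induct)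
  case base
  then show ?case using unst_gap_adjacent assms by blast
next
  case (step y z)
  then have "unst \<sigma> y" "unst \<sigma> z" "z \<in> nbrs y" by (auto simp: adj_unst_def)
  moreover obtain f where "f \<in> edges_at \<sigma> y" by (rule edges_at_nonempty[OF \<open>unst \<sigma> y\<close>])
  ultimately show ?case using step.IH[of f] unst_gap_adjacent[of \<sigma> y z f e'] step.prems gap_trans by blast
qed

section \<open>Evolution on finite unstable components\<close>

text \<open>An unstable component and the rest of the lattice evolve independently, as they are separated by
  stable sites.\<close>
definition hyb :: "site set \<Rightarrow> config \<Rightarrow> config \<Rightarrow> config" where
  "hyb W \<tau> \<sigma> x = (if x \<in> W then \<tau> x else \<sigma> x)"

lemma T_cong: "(\<And>y. y \<in> insert x (nbrs x) \<Longrightarrow> \<sigma> y = \<tau> y) \<Longrightarrow> T \<sigma> x = T \<tau> x"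
  unfolding T_def by (simp cong: bex_cong)

lemma hyb_Suc:
  assumes "unst \<sigma> x"
  defines "W \<equiv> ucomp \<sigma> x"
  defines "h \<equiv> \<lambda>n. hyb W ((T ^^ n) \<sigma>) \<sigma>"
  shows "h (Suc n) = flipset (W \<inter> tflips (h n)) (h n)"
proof
  fix z
  show "h (Suc n) z = flipset (W \<inter> tflips (h n)) (h n) z"
  proof (cases "z \<in> W")
    case True
    have "T ((T ^^ n) \<sigma>) z = T (h n) z"
    proof (rule T_cong)
      fix y assume "y \<in> insert z (nbrs z)"
      then have "y \<in> W \<or> \<not> unst \<sigma> y" using True ucomp_step[OF assms(1)] unfolding W_def by blast
      then show "(T ^^ n) \<sigma> y = h n y" using stable_T[of \<sigma> y n] by (auto simp: h_def hyb_def)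
    qed
    then show ?thesis using True by (auto simp: h_def hyb_def flipset_def tflips_def)
  qed (simp add: h_def hyb_def flipset_def)
qed

lemma hyb_fstep_star:
  assumes "unst \<sigma> x" "finite (ucomp \<sigma> x)"
  shows "(fstep (ucomp \<sigma> x))\<^sup>*\<^sup>* \<sigma> (hyb (ucomp \<sigma> x) ((T ^^ n) \<sigma>) \<sigma>)"
proof (induction n)
  case 0
  have "hyb (ucomp \<sigma> x) ((T ^^ 0) \<sigma>) \<sigma> = \<sigma>" by (auto simp: hyb_def)
  then show ?case by simp
next
  case (Suc n)
  let ?h = "hyb (ucomp \<sigma> x) ((T ^^ n) \<sigma>) \<sigma>"
  have "(fstep (ucomp \<sigma> x \<inter> tflips ?h))\<^sup>*\<^sup>* ?h (flipset (ucomp \<sigma> x \<inter> tflips ?h) ?h)"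
    using assms by (intro fstep_star_flipset) auto
  from fstep_star_mono[OF this, of "ucomp \<sigma> x"] Suc show ?case
    unfolding hyb_Suc[OF assms(1)] by auto
qed

lemma energy_nonneg: "energy V \<sigma> \<ge> 0"
  unfolding energy_def by (intro sum_nonneg) auto

text \<open>Each update that changes something in the component lowers a nonnegative integer, the
  energy of the configuration frozen outside it.\<close>

lemma eventually_fixed:
  assumes "unst \<sigma> x" "finite (ucomp \<sigma> x)"
  shows "\<exists>N. \<forall>n\<ge>N. \<forall>z\<in>ucomp \<sigma> x. (T ^^ n) \<sigma> z = (T ^^ N) \<sigma> z"
proof -
  define W where "W = ucomp \<sigma> x"
  define h where "h n = hyb W ((T ^^ n) \<sigma>) \<sigma>" for n
  define V where "V = W \<union> \<Union> (nbrs ` W)"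
  have hS: "h (Suc n) = flipset (W \<inter> tflips (h n)) (h n)" for n
    using hyb_Suc[OF assms(1)] unfolding h_def W_def .
  have dec: "energy V (h (Suc n)) < energy V (h n)" if "W \<inter> tflips (h n) \<noteq> {}" for n
    unfolding hS using assms that by (intro energy_flipset) (auto simp: V_def W_def)
  have "\<exists>N. W \<inter> tflips (h N) = {}"
  proof (rule ccontr)
    assume "\<not> ?thesis"
    then have d: "energy V (h (Suc n)) < energy V (h n)" for n using dec by blast
    have "energy V (h n) \<le> energy V (h 0) - int n" for n
    proof (induction n)
      case (Suc n)
      then show ?case using d[of n] by simp
    qed simp
    from this[of "nat (energy V (h 0)) + 1"] energy_nonneg[of V "h (nat (energy V (h 0)) + 1)"] show False
      using energy_nonneg[of V "h 0"] by simp
  qed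
  then obtain N where N: "W \<inter> tflips (h N) = {}" by blast
  have "h n = h N" if "n \<ge> N" for n
    using that
  proof (induction n rule: dec_induct)
    case (step n)
    then show ?case using N hS[of n] by (auto simp: flipset_def)
  qed simp
  then have "(T ^^ n) \<sigma> z = (T ^^ N) \<sigma> z" if "n \<ge> N" "z \<in> W" for n z
    using that by (metis h_def hyb_def)
  then show ?thesis unfolding W_def by blast
qed

lemma sigma_inf_eq:
  assumes "\<And>n. n \<ge> N \<Longrightarrow> (T ^^ n) \<sigma> z = b"
  shows "sigma_inf \<sigma> z = b"
  unfolding sigma_inf_def
proof (rule the_equality)
  show ev: "\<forall>\<^sub>F n in sequentially. (T ^^ n) \<sigma> z = b"
    using assms eventually_at_top_linorder by blast
  fix c assume "\<forall>\<^sub>F n in sequentially. (T ^^ n) \<sigma> z = c"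
  with ev have "\<forall>\<^sub>F n in sequentially. c = b" by eventually_elim auto
  then show "c = b" by simp
qed

text \<open>What the iterates and the limit have in common. It is stated one component at a time,
  because infinitely many components may change and \<tau> as a whole need not be reachable by
  finitely many flips.\<close>

definition follows :: "config \<Rightarrow> config \<Rightarrow> bool" where
  "follows \<sigma> \<tau> \<longleftrightarrow> (\<forall>x. \<not> unst \<sigma> x \<longrightarrow> \<tau> x = \<sigma> x) \<and>
     (\<forall>x. unst \<sigma> x \<longrightarrow> (fstep (ucomp \<sigma> x))\<^sup>*\<^sup>* \<sigma> (hyb (ucomp \<sigma> x) \<tau> \<sigma>))"

lemma follows_T:
  assumes "\<And>x. unst \<sigma> x \<Longrightarrow> finite (ucomp \<sigma> x)"
  shows "follows \<sigma> ((T ^^ n) \<sigma>)"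
  unfolding follows_def using hyb_fstep_star assms stable_T by blast

lemma follows_sigma_inf:
  assumes "\<And>x. unst \<sigma> x \<Longrightarrow> finite (ucomp \<sigma> x)"
  shows "follows \<sigma> (sigma_inf \<sigma>)"
  unfolding follows_def
proof (intro conjI allI impI)
  fix x assume "\<not> unst \<sigma> x"
  then show "sigma_inf \<sigma> x = \<sigma> x" using stable_T by (intro sigma_inf_eq[of 0])
next
  fix x assume x: "unst \<sigma> x"
  obtain N where N: "\<forall>n\<ge>N. \<forall>z\<in>ucomp \<sigma> x. (T ^^ n) \<sigma> z = (T ^^ N) \<sigma> z"
    using eventually_fixed[OF x assms[OF x]] by blast
  have "sigma_inf \<sigma> z = (T ^^ N) \<sigma> z" if "z \<in> ucomp \<sigma> x" for z
    by (rule sigma_inf_eq[of N]) (use N that in blast)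
  then have "hyb (ucomp \<sigma> x) (sigma_inf \<sigma>) \<sigma> = hyb (ucomp \<sigma> x) ((T ^^ N) \<sigma>) \<sigma>"
    by (intro ext) (simp add: hyb_def)
  then show "(fstep (ucomp \<sigma> x))\<^sup>*\<^sup>* \<sigma> (hyb (ucomp \<sigma> x) (sigma_inf \<sigma>) \<sigma>)"
    using hyb_fstep_star[OF x assms[OF x], of N] by simp
qed

section \<open>Runs without stable edges\<close>

definition agree :: "config \<Rightarrow> config \<Rightarrow> bool" where
  "agree \<sigma> \<tau> \<longleftrightarrow> (\<forall>x. \<not> unst \<sigma> x \<longrightarrow> \<tau> x = \<sigma> x)"

lemma agreeD: "agree \<sigma> \<tau> \<Longrightarrow> \<not> unst \<sigma> x \<Longrightarrow> \<tau> x = \<sigma> x"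
  unfolding agree_def by blast

lemma stab_iff:
  assumes "agree \<sigma> \<tau>" "bich \<tau> e"
  shows "e \<in> stab \<sigma> \<longleftrightarrow> \<not> unst \<sigma> (fst e) \<and> \<not> unst \<sigma> (snd e)"
  using agreeD[OF assms(1), of "fst e"] agreeD[OF assms(1), of "snd e"] assms(2)
  by (auto simp: stab_def bich_def)

lemma agree_bich:
  assumes "agree \<sigma> \<tau>" "e \<in> stab \<sigma>"
  shows "bich \<tau> e"
  using agreeD[OF assms(1), of "fst e"] agreeD[OF assms(1), of "snd e"] assms(2)
  by (auto simp: stab_def bich_def)

lemma triangle_adjacent:
  assumes "bich \<tau> e" "on_edge u e" "on_edge v (step \<tau> e)"
  shows "u = v \<or> v \<in> nbrs u"
proof -
  have "on_edge v e \<or> v = ahead e" using on_edge_step[OF assms(3)] .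
  then show ?thesis
    using assms(1,2) ahead_nbrs[of e] nbrs_sym[of "fst e" "snd e"] unfolding bich_def by auto
qed

text \<open>A bichromatic edge that is not stable has an unstable end. Consecutive edges bound a
  common triangle, so their unstable ends coincide or are adjacent, and the component never changes
  during the run.\<close>

lemma run_in_comp:
  assumes ag: "agree \<sigma> \<tau>" and e: "bich \<tau> e"
    and run: "\<And>i. i < j \<Longrightarrow> (step \<tau> ^^ i) e \<notin> stab \<sigma>"
    and w: "unst \<sigma> w" "\<And>u. on_edge u e \<Longrightarrow> unst \<sigma> u \<Longrightarrow> u \<in> ucomp \<sigma> w"
  shows "i \<le> j \<Longrightarrow> on_edge v ((step \<tau> ^^ i) e) \<Longrightarrow> unst \<sigma> v \<Longrightarrow> v \<in> ucomp \<sigma> w"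
proof (induction i arbitrary: v)
  case 0
  then show ?case using w by simp
next
  case (Suc i)
  let ?f = "(step \<tau> ^^ i) e"
  have b: "bich \<tau> ?f" using e by (rule bich_funpow)
  have "?f \<notin> stab \<sigma>" using run[of i] Suc by simp
  then obtain u where u: "on_edge u ?f" "unst \<sigma> u" using stab_iff[OF ag b] by blast
  have "u = v \<or> v \<in> nbrs u" using Suc.prems(2) u by (intro triangle_adjacent[OF b]) auto
  moreover have "u \<in> ucomp \<sigma> w" using Suc u by auto
  ultimately show ?case using ucomp_step[OF w(1)] Suc.prems(3) by blast
qed

text \<open>The ends of e are stable, so the only unstable site that the first step can meet is
  \<open>ahead e\<close>; it determines the component.\<close>

lemma run_from_stab:
  assumes ag: "agree \<sigma> \<tau>" and e: "e \<in> stab \<sigma>"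
    and run: "\<And>i. 0 < i \<Longrightarrow> i < j \<Longrightarrow> (step \<tau> ^^ i) e \<notin> stab \<sigma>"
    and v: "i \<le> j" "on_edge v ((step \<tau> ^^ i) e)" "unst \<sigma> v"
  shows "unst \<sigma> (ahead e)" "v \<in> ucomp \<sigma> (ahead e)"
proof -
  have be: "bich \<tau> e" using agree_bich[OF ag e] .
  have i0: "i \<noteq> 0" using v e by (auto simp: stab_def intro: gr0I)
  have b1: "bich \<tau> (step \<tau> e)" using be by (rule bich_step)
  have pow: "(step \<tau> ^^ i) (step \<tau> e) = (step \<tau> ^^ Suc i) e" for i by (simp add: funpow_swap1)
  have sub: "u = ahead e" if "on_edge u (step \<tau> e)" "unst \<sigma> u" for u
    using on_edge_step[OF that(1)] that(2) e by (auto simp: stab_def)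
  show un: "unst \<sigma> (ahead e)"
  proof (rule ccontr)
    assume n: "\<not> unst \<sigma> (ahead e)"
    have "\<not> unst \<sigma> (fst (step \<tau> e))" "\<not> unst \<sigma> (snd (step \<tau> e))"
      using n sub[of "fst (step \<tau> e)"] sub[of "snd (step \<tau> e)"] by fastforce+
    then have st: "step \<tau> e \<in> stab \<sigma>" using stab_iff[OF ag b1] by simp
    then have "\<not> (1 < j)" using run[of 1] by fastforce
    then have "i = 1" using i0 v(1) by simp
    then show False using v(2,3) st by (auto simp: stab_def)
  qed
  show "v \<in> ucomp \<sigma> (ahead e)"
  proof (rule run_in_comp[OF ag b1, of "j - 1" "ahead e" "i - 1"])
    fix i assume "i < j - 1"
    then show "(step \<tau> ^^ i) (step \<tau> e) \<notin> stab \<sigma>" unfolding pow by (intro run) auto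
  next
    show "on_edge v ((step \<tau> ^^ (i - 1)) (step \<tau> e))" unfolding pow using i0 v by (simp del: funpow.simps)
  qed (use un sub v i0 in auto)
qed

lemma conn_cong:
  assumes ag: "agree \<sigma> \<tau>" "agree \<sigma> \<tau>'"
    and ag': "\<forall>x. unst \<sigma> (ahead e) \<and> x \<in> ucomp \<sigma> (ahead e) \<longrightarrow> \<tau>' x = \<tau> x"
    and e: "e \<in> stab \<sigma>" and c: "conn \<tau> (stab \<sigma>) j e e'"
  shows "conn \<tau>' (stab \<sigma>) j e e'"
proof -
  have run: "\<And>i. 0 < i \<Longrightarrow> i < j \<Longrightarrow> (step \<tau> ^^ i) e \<notin> stab \<sigma>" using c by (simp add: conn_def)
  have site: "\<tau>' v = \<tau> v" if "i \<le> j" "on_edge v ((step \<tau> ^^ i) e)" for i v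
  proof (cases "unst \<sigma> v")
    case True
    then show ?thesis using run_from_stab[OF ag(1) e run that True] ag' by blast
  next
    case False
    then show ?thesis using agreeD[OF ag(1)] agreeD[OF ag(2)] by simp
  qed
  have eq: "(step \<tau>' ^^ i) e = (step \<tau> ^^ i) e" if "i \<le> j" for i
    using that
  proof (induction i)
    case (Suc i)
    let ?f = "(step \<tau> ^^ i) e"
    have "\<tau>' (fst ?f) = \<tau> (fst ?f)" using Suc.prems by (intro site[of i]) auto
    moreover have "\<tau>' (ahead ?f) = \<tau> (ahead ?f)"
      using Suc.prems ahead_on_step[of ?f \<tau>] by (intro site[of "Suc i"]) auto
    ultimately have "step \<tau>' ?f = step \<tau> ?f" by (intro step_cong) auto
    then show ?case using Suc by simp
  qed simp
  then show ?thesis using c by (auto simp: conn_def)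
qed

lemma next_stable:
  assumes F: "follows \<sigma> \<tau>" and e: "e \<in> stab \<sigma>" "e' \<in> stab \<sigma>"
  shows "(\<exists>j>0. conn \<sigma> (stab \<sigma>) j e e') \<longleftrightarrow> (\<exists>j>0. conn \<tau> (stab \<sigma>) j e e')"
proof -
  define W where "W = (if unst \<sigma> (ahead e) then ucomp \<sigma> (ahead e) else {})"
  \<comment> \<open>An intermediate configuration: finitely many flips lead to it from \<sigma>, and
    a run starting at e cannot tell it from \<tau> before the next stable edge.\<close>
  define h where "h = hyb W \<tau> \<sigma>"
  have ag: "agree \<sigma> \<tau>" using F unfolding follows_def agree_def by blast
  have ah: "agree \<sigma> h" using ag unfolding agree_def h_def hyb_def by simp
  have h\<tau>: "\<forall>x. unst \<sigma> (ahead e) \<and> x \<in> ucomp \<sigma> (ahead e) \<longrightarrow> h x = \<tau> x"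
    by (simp add: h_def hyb_def W_def)
  then have \<tau>h: "\<forall>x. unst \<sigma> (ahead e) \<and> x \<in> ucomp \<sigma> (ahead e) \<longrightarrow> \<tau> x = h x" by simp
  have st: "(fstep W)\<^sup>*\<^sup>* \<sigma> h"
  proof (cases "unst \<sigma> (ahead e)")
    case True
    then have "W = ucomp \<sigma> (ahead e)" by (simp add: W_def)
    then show ?thesis using F True unfolding follows_def h_def by blast
  next
    case False
    then have "h = \<sigma>" by (auto simp: h_def hyb_def W_def)
    then show ?thesis by simp
  qed
  have Wu: "unst \<sigma> x" if "x \<in> W" for x using that ucomp_unst unfolding W_def by (auto split: if_splits)
  have avoid: "\<forall>a\<in>stab \<sigma>. fst a \<notin> W \<and> snd a \<notin> W" using Wu by (auto simp: stab_def)
  have b: "bich \<sigma> e" "bich h e" using e agree_bich[OF ah] by (auto simp: stab_def)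
  show ?thesis
  proof
    assume "\<exists>j>0. conn \<sigma> (stab \<sigma>) j e e'"
    then obtain j where "j > 0" "conn h (stab \<sigma>) j e e'"
      using conn_fstep_star[OF st avoid _ _ _ _ b(1)] avoid e by blast
    then show "\<exists>j>0. conn \<tau> (stab \<sigma>) j e e'" using conn_cong[OF ah ag \<tau>h e(1)] by blast
  next
    assume "\<exists>j>0. conn \<tau> (stab \<sigma>) j e e'"
    then obtain j where "j > 0" "conn h (stab \<sigma>) j e e'" using conn_cong[OF ag ah h\<tau> e(1)] by blast
    then show "\<exists>j>0. conn \<sigma> (stab \<sigma>) j e e'"
      using conn_fstep_star[OF fstep_star_sym[OF st] avoid _ _ _ _ b(2)] avoid e by blast
  qed
qed

section \<open>Boundary paths as orbits\<close>

definition orbit :: "config \<Rightarrow> edge list \<Rightarrow> bool" where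
  "orbit \<sigma> p \<longleftrightarrow> p \<noteq> [] \<and> bich \<sigma> (hd p) \<and> (\<forall>i. Suc i < length p \<longrightarrow> p ! Suc i = step \<sigma> (p ! i))"

lemma orbit_nth:
  assumes "orbit \<sigma> p" "i < length p"
  shows "p ! i = (step \<sigma> ^^ i) (hd p)"
  using assms(2)
proof (induction i)
  case 0
  then show ?case using assms by (simp add: orbit_def hd_conv_nth)
next
  case (Suc i)
  then show ?case using assms by (simp add: orbit_def)
qed

lemma orbit_bich: "orbit \<sigma> p \<Longrightarrow> i < length p \<Longrightarrow> bich \<sigma> (p ! i)"
  using orbit_nth[of \<sigma> p i] bich_funpow[of \<sigma> "hd p" i] by (simp add: orbit_def)

lemma step_of_common_fst:
  assumes "bich \<sigma> (x, y)" "bich \<sigma> (x, z)" "z \<in> nbrs y"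
  shows "(x, z) = step \<sigma> (x, y) \<or> (z, x) = step \<sigma> (y, x)"
proof -
  have "z = ahead (x, y) \<or> z = ahead (y, x)"
    using common_nbrs[of y x z] assms by (simp add: bich_def)
  then show ?thesis using assms by (auto simp: step_def bich_def)
qed

lemma step_of_common_snd:
  assumes "bich \<sigma> (x, y)" "bich \<sigma> (z, y)" "z \<in> nbrs x"
  shows "(z, y) = step \<sigma> (x, y) \<or> (y, z) = step \<sigma> (y, x)"
proof -
  have "bich \<sigma> (y, x)" "bich \<sigma> (y, z)" using assms(1,2) bich_swap[of \<sigma> "(x, y)"] bich_swap[of \<sigma> "(z, y)"] by auto
  from step_of_common_fst[OF this assms(3)] show ?thesis by blast
qed

text \<open>Consecutive edges of a b-path are related by a step in one of the two directions of
  travel. Changing the direction would return to the previous edge, which distinctness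
  forbids.\<close>

lemma b_path_orbit:
  assumes "b_path \<sigma> p"
  shows "orbit \<sigma> p \<or> orbit \<sigma> (map prod.swap p)" "distinct p"
proof -
  note b = assms[unfolded b_path_def]
  show "distinct p" using b by (auto simp: distinct_map)
  have bi: "bich \<sigma> (p ! i)" if "i < length p" for i using b that by (auto simp: bich_def)
  have ne: "p \<noteq> []" using b by blast
  have one: "p ! Suc i = step \<sigma> (p ! i) \<or> prod.swap (p ! Suc i) = step \<sigma> (prod.swap (p ! i))"
    if "Suc i < length p" for i
  proof -
    obtain x y where p: "p ! i = (x, y)" by (cases "p ! i")
    obtain x' y' where p': "p ! Suc i = (x', y')" by (cases "p ! Suc i")
    have c: "(x' = x \<and> y' \<in> nbrs y) \<or> (y' = y \<and> x' \<in> nbrs x)"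
      using b that p p' by fastforce
    have "bich \<sigma> (x, y)" "bich \<sigma> (x', y')" using bi[of i] bi[of "Suc i"] that p p' by auto
    then show ?thesis
      using c step_of_common_fst[of \<sigma> x y y'] step_of_common_snd[of \<sigma> x y x'] unfolding p p'
      by auto
  qed
  have turn: False if "Suc (Suc i) < length p" "p ! Suc i = step \<sigma> (p ! i)"
    "prod.swap (p ! Suc (Suc i)) = step \<sigma> (prod.swap (p ! Suc i))" for i
  proof -
    have "prod.swap (p ! Suc (Suc i)) = prod.swap (p ! i)"
      using that step_swap_step[OF bi[of i]] by simp
    then have "p ! Suc (Suc i) = p ! i" by (metis swap_swap)
    then show False using \<open>distinct p\<close> that(1) nth_eq_iff_index_eq[of p "Suc (Suc i)" i] by simp
  qed
  have turn': False if "Suc (Suc i) < length p" "prod.swap (p ! Suc i) = step \<sigma> (prod.swap (p ! i))"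
    "p ! Suc (Suc i) = step \<sigma> (p ! Suc i)" for i
  proof -
    have "bich \<sigma> (prod.swap (p ! i))" using bi[of i] that by simp
    from step_swap_step[OF this] have "step \<sigma> (p ! Suc i) = p ! i"
      using that(2) by (metis swap_swap)
    then show False using \<open>distinct p\<close> that(1,3) nth_eq_iff_index_eq[of p "Suc (Suc i)" i] by simp
  qed
  show "orbit \<sigma> p \<or> orbit \<sigma> (map prod.swap p)"
  proof (cases "1 < length p \<and> p ! 1 \<noteq> step \<sigma> (p ! 0)")
    case False
    have "p ! Suc i = step \<sigma> (p ! i)" if "Suc i < length p" for i
      using that
    proof (induction i)
      case (Suc i)
      then show ?case using one[of "Suc i"] turn[of i] by auto
    qed (use False in auto)
    then show ?thesis using ne bi[of 0] by (auto simp: orbit_def hd_conv_nth)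
  next
    case True
    have "prod.swap (p ! Suc i) = step \<sigma> (prod.swap (p ! i))" if "Suc i < length p" for i
      using that
    proof (induction i)
      case 0
      then show ?case using True one[of 0] by auto
    next
      case (Suc i)
      then show ?case using one[of "Suc i"] turn'[of i] by auto
    qed
    then have "orbit \<sigma> (map prod.swap p)" using ne bi[of 0] by (auto simp: orbit_def hd_conv_nth nth_map)
    then show ?thesis ..
  qed
qed

lemma orbit_b_path:
  assumes "orbit \<sigma> p" "distinct p"
  shows "b_path \<sigma> p"
  unfolding b_path_def
proof (intro conjI allI impI)
  show "p \<noteq> []" using assms by (simp add: orbit_def)
  fix i assume i: "i < length p"
  show "snd (p ! i) \<in> nbrs (fst (p ! i))" "\<sigma> (fst (p ! i)) = (\<not> \<sigma> (snd (p ! i)))"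
    using orbit_bich[OF assms(1) i] by (auto simp: bich_def)
next
  \<comment> \<open>All first ends have one colour, so an edge and its reverse never both occur, and
    distinct directed edges have distinct dual edges.\<close>
  have col: "\<sigma> (fst e) = \<sigma> (fst (hd p))" "bich \<sigma> e" if "e \<in> set p" for e
    using that orbit_nth[OF assms(1)] orbit_bich[OF assms(1)] fst_colour_funpow
    by (metis in_set_conv_nth)+
  have "inj_on dual_edge (set p)"
  proof (rule inj_onI)
    fix e f assume ef: "e \<in> set p" "f \<in> set p" "dual_edge e = dual_edge f"
    have "{fst e, snd e} = {fst f, snd f}" using ef(3) by (simp add: dual_edge_def case_prod_beta)
    then have "(fst e = fst f \<and> snd e = snd f) \<or> (fst e = snd f \<and> snd e = fst f)"
      unfolding doubleton_eq_iff .
    moreover have "\<sigma> (fst e) \<noteq> \<sigma> (snd f)"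
      using col[OF ef(1)] col[OF ef(2)] unfolding bich_def by metis
    ultimately show "e = f" unfolding prod_eq_iff[of e f] by metis
  qed
  then show "distinct (map dual_edge p)" using assms(2) by (simp add: distinct_map)
next
  fix i assume i: "Suc i < length p"
  have s: "p ! Suc i = step \<sigma> (p ! i)" using assms(1) i by (simp add: orbit_def)
  have "snd (p ! i) \<in> nbrs (fst (p ! i))" using orbit_bich[OF assms(1), of i] i by (simp add: bich_def)
  from ahead_nbrs[OF this]
  show "(fst (p ! Suc i) = fst (p ! i) \<and> snd (p ! Suc i) \<in> nbrs (snd (p ! i))) \<or>
        (snd (p ! Suc i) = snd (p ! i) \<and> fst (p ! Suc i) \<in> nbrs (fst (p ! i)))"
    unfolding s step_def by auto
qed

lemma dual_ends_swap: "dual_ends (prod.swap e) = dual_ends e"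
  by (cases e) (auto simp: dual_ends_def add.commute)

lemma traces_swap: "traces (map prod.swap p) vs \<longleftrightarrow> traces p vs"
  by (auto simp: traces_def dual_ends_swap)

definition centre :: "site \<Rightarrow> site \<Rightarrow> site \<Rightarrow> complex" where
  "centre x y z = (pos x + pos y + pos z) / 3"

lemma dual_ends_eq:
  assumes "snd e \<in> nbrs (fst e)"
  shows "dual_ends e = {centre (fst e) (snd e) (ahead (prod.swap e)), centre (fst e) (snd e) (ahead e)}"
proof -
  have c: "z \<in> nbrs (fst e) \<and> z \<in> nbrs (snd e) \<longleftrightarrow> z = ahead e \<or> z = ahead (prod.swap e)" for z
    using common_nbrs[OF assms, of z] by (simp add: prod.swap_def)
  have "dual_ends e = {centre (fst e) (snd e) z | z. z \<in> nbrs (fst e) \<and> z \<in> nbrs (snd e)}"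
    by (cases e) (simp add: dual_ends_def centre_def)
  then show ?thesis unfolding c by blast
qed

lemma centre_step:
  "centre (fst (step \<sigma> e)) (snd (step \<sigma> e)) (ahead (prod.swap (step \<sigma> e))) = centre (fst e) (snd e) (ahead e)"
  by (cases e) (auto simp: step_def centre_def ahead_swap_left ahead_swap_right)

lemma orbit_traces:
  assumes "orbit \<sigma> p"
  shows "\<exists>vs. traces p vs"
proof
  let ?v = "\<lambda>e. centre (fst e) (snd e) (ahead (prod.swap e))"
  let ?w = "\<lambda>e. centre (fst e) (snd e) (ahead e)"
  let ?vs = "?v (hd p) # map ?w p"
  have ne: "p \<noteq> []" using assms by (simp add: orbit_def)
  show "traces p ?vs"
    unfolding traces_def
  proof (intro conjI allI impI)
    fix i assume i: "i < length p"
    have "?vs ! i = ?v (p ! i)"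
    proof (cases i)
      case 0
      then show ?thesis using ne by (simp add: hd_conv_nth)
    next
      case (Suc k)
      then have "p ! i = step \<sigma> (p ! k)" using assms i by (simp add: orbit_def)
      then show ?thesis using Suc i centre_step[of \<sigma> "p ! k"] by simp
    qed
    then show "{?vs ! i, ?vs ! Suc i} = dual_ends (p ! i)"
      using dual_ends_eq[of "p ! i"] orbit_bich[OF assms i] i by (simp add: bich_def)
  qed simp
qed

lemma curves_orbit:
  assumes "\<gamma> \<in> curves \<delta> \<sigma>"
  obtains p vs where "orbit \<sigma> p" "distinct p" "traces p vs" "\<gamma> = polygon (map (\<lambda>v. of_real \<delta> * v) vs)"
proof -
  obtain p vs where p: "b_path \<sigma> p" "traces p vs" "\<gamma> = polygon (map (\<lambda>v. of_real \<delta> * v) vs)"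
    using assms unfolding curves_def by blast
  from b_path_orbit[OF p(1)] consider "orbit \<sigma> p" "distinct p" | "orbit \<sigma> (map prod.swap p)" "distinct p" by blast
  then show ?thesis
  proof cases
    case 1
    then show ?thesis using that p by blast
  next
    case 2
    moreover have "distinct (map prod.swap p)" using 2(2) by (simp add: distinct_map)
    ultimately show ?thesis using that[of "map prod.swap p" vs] p traces_swap by blast
  qed
qed

lemma orbit_curves:
  assumes "orbit \<sigma> p" "distinct p" "traces p vs"
  shows "polygon (map (\<lambda>v. of_real \<delta> * v) vs) \<in> curves \<delta> \<sigma>"
  using orbit_b_path[OF assms(1,2)] assms(3) unfolding curves_def by blast

section \<open>Shadowing\<close>

text \<open>Discrete Frechet coupling: a monotone walk through both lists that advances one list at
  a time and visits only pairs in R.\<close>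

inductive frechet :: "('a \<Rightarrow> 'b \<Rightarrow> bool) \<Rightarrow> 'a list \<Rightarrow> 'b list \<Rightarrow> bool" for R where
  single: "R x y \<Longrightarrow> frechet R [x] [y]"
| left: "frechet R ps qs \<Longrightarrow> R x (last qs) \<Longrightarrow> frechet R (ps @ [x]) qs"
| right: "frechet R ps qs \<Longrightarrow> R (last ps) y \<Longrightarrow> frechet R ps (qs @ [y])"

lemma frechet_nonempty: "frechet R ps qs \<Longrightarrow> ps \<noteq> [] \<and> qs \<noteq> []"
  by (induction rule: frechet.induct) auto

lemma frechet_flip: "frechet R ps qs \<Longrightarrow> frechet (\<lambda>y x. R x y) qs ps"
  by (induction rule: frechet.induct) (auto intro: frechet.intros)

lemma frechet_single:
  assumes "ps \<noteq> []" "\<And>x. x \<in> set ps \<Longrightarrow> R x y"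
  shows "frechet R ps [y]"
  using assms
proof (induction ps rule: rev_induct)
  case (snoc x ps)
  show ?case
  proof (cases "ps = []")
    case True
    then show ?thesis using snoc.prems frechet.single[of R x y] by simp
  next
    case False
    then have "frechet R ps [y]" using snoc by auto
    then show ?thesis using snoc.prems frechet.left[of R ps "[y]" x] by simp
  qed
qed simp

lemma frechet_extend_right:
  assumes "frechet R ps qs" "\<And>y. y \<in> set ys \<Longrightarrow> R (last ps) y"
  shows "frechet R ps (qs @ ys)"
  using assms
proof (induction ys rule: rev_induct)
  case (snoc y ys)
  then show ?case using right[of R ps "qs @ ys" y] by simp
qed simp

lemma orbit_snoc:
  assumes "orbit \<sigma> ps"
  shows "orbit \<sigma> (ps @ [step \<sigma> (last ps)])"
  unfolding orbit_def
proof (intro conjI allI impI)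
  fix i assume "Suc i < length (ps @ [step \<sigma> (last ps)])"
  then have "Suc i < length ps \<or> Suc i = length ps" by auto
  then show "(ps @ [step \<sigma> (last ps)]) ! Suc i = step \<sigma> ((ps @ [step \<sigma> (last ps)]) ! i)"
  proof
    assume "Suc i < length ps"
    then show ?thesis using assms by (auto simp: orbit_def nth_append)
  next
    assume s: "Suc i = length ps"
    then have "last ps = ps ! i" using assms by (simp add: orbit_def last_conv_nth flip: s)
    then show ?thesis using s by (simp add: nth_append)
  qed
qed (use assms in \<open>auto simp: orbit_def\<close>)

lemma orbit_extend:
  assumes "orbit \<sigma> ps"
  shows "orbit \<sigma> (ps @ map (\<lambda>i. (step \<sigma> ^^ Suc i) (last ps)) [0..<m])"
proof (induction m)
  case 0
  then show ?case using assms by simp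
next
  case (Suc m)
  let ?l = "ps @ map (\<lambda>i. (step \<sigma> ^^ Suc i) (last ps)) [0..<m]"
  have "last ?l = (step \<sigma> ^^ m) (last ps)"
    using assms by (cases m) (auto simp: orbit_def)
  then show ?case using orbit_snoc[OF Suc] by simp
qed

lemma orbit_butlast: "orbit \<sigma> (ps @ [x]) \<Longrightarrow> ps \<noteq> [] \<Longrightarrow> orbit \<sigma> ps"
  by (auto simp: orbit_def nth_append split: if_splits)

text \<open>The slope \<kappa> can be made as small as desired at the price of a larger K; K
  disappears under scaling. The last assumption provides a partner for paths without any stable
  edge.\<close>

locale shadow =
  fixes \<sigma> :: config and \<kappa> K :: real
  assumes \<kappa>: "\<kappa> \<ge> 0" and K: "K \<ge> 0"
    and small: "\<And>w v. unst \<sigma> w \<Longrightarrow> v \<in> ucomp \<sigma> w \<Longrightarrow> cmod (pos v - pos w) \<le> \<kappa> * cmod (pos w) + K"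
    and dense: "\<And>w. \<exists>s\<in>stab \<sigma>. cmod (pos (fst s) - pos w) \<le> \<kappa> * cmod (pos w) + K"
begin

text \<open>The summand 2 pays for passing from a site of the component to the first end of an edge
  at it, and for the one step by which a run leaves the component.\<close>

definition near :: "site \<Rightarrow> edge \<Rightarrow> bool" where
  "near c e \<longleftrightarrow> cmod (pos (fst e) - pos c) \<le> \<kappa> * cmod (pos c) + K + 2"

text \<open>A common centre c instead of a bound on the distance of e and f: the error allowed is
  proportional to the modulus of c, which is the form used in \<open>dmet_near\<close>.\<close>

definition R :: "edge \<Rightarrow> edge \<Rightarrow> bool" where
  "R e f \<longleftrightarrow> (\<exists>c. near c e \<and> near c f)"

lemma nearI: "near c e \<Longrightarrow> near c f \<Longrightarrow> R e f"
  unfolding R_def by blast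

end

lemma cmod_pos_dir: "cmod (pos (x + dir k) - pos x) \<le> 1"
proof -
  have "pos (x + v) - pos x = pos v" for v
    by (cases x; cases v) (auto simp: pos_def algebra_simps)
  moreover have "cmod (pos (dir k)) \<le> 1"
  proof -
    have "cmod (pos (dir k)) = 1" if "k < 6" for k
      using less6_cases[OF that]
      by (elim disjE) (simp_all add: dir_simps pos_def omega_def cmod_def power2_eq_square field_simps)
    from this[of "k mod 6"] show ?thesis by (simp add: dir_mod6)
  qed
  ultimately show ?thesis by simp
qed

lemma cmod_pos_nbrs: "y \<in> nbrs x \<Longrightarrow> cmod (pos y - pos x) \<le> 1"
  unfolding nbrs_iff_ex using cmod_pos_dir[of x] by blast

lemma orbit_suffix:
  assumes "orbit \<sigma> (as @ e # bs)" "i < length (e # bs)"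
  shows "(e # bs) ! i = (step \<sigma> ^^ i) e"
proof -
  let ?h = "hd (as @ e # bs)"
  have "(e # bs) ! j = (step \<sigma> ^^ (j + length as)) ?h" if "j < length (e # bs)" for j
    using orbit_nth[OF assms(1), of "length as + j"] that by (simp add: nth_append add.commute)
  from this[of i] this[of 0] assms(2) show ?thesis by (simp add: funpow_add)
qed

text \<open>By injectivity of \<open>step\<close> a repetition can be pulled back to the start of
  the orbit, so the first edge, a member of A, would occur twice.\<close>

lemma orbit_distinct:
  assumes "orbit \<sigma> q" "hd q \<in> A" "distinct (filter (\<lambda>e. e \<in> A) q)"
  shows "distinct q"
proof -
  have "q ! a \<noteq> q ! b" if "a < b" "b < length q" for a b
  proof
    assume eq: "q ! a = q ! b"
    have bh: "bich \<sigma> (hd q)" using assms(1) by (simp add: orbit_def)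
    have "(step \<sigma> ^^ a) (hd q) = (step \<sigma> ^^ a) ((step \<sigma> ^^ (b - a)) (hd q))"
      using eq orbit_nth[OF assms(1), of a] orbit_nth[OF assms(1), of b] that funpow_add[of a "b - a" "step \<sigma>"] by simp
    then have "hd q = (step \<sigma> ^^ (b - a)) (hd q)"
      by (rule step_funpow_inj[OF bh bich_funpow[OF bh]])
    then have "hd q = q ! (b - a)" using orbit_nth[OF assms(1), of "b - a"] that by simp
    moreover obtain x xs where q: "q = x # xs" using assms(1) by (cases q) (auto simp: orbit_def)
    ultimately have "x \<in> set xs" using that by (cases "b - a") auto
    then show False using assms(2,3) q by auto
  qed
  then show ?thesis unfolding distinct_conv_nth by (metis nat_neq_iff)
qed

context shadow
begin

lemma near_if_unst:
  assumes "unst \<sigma> w" "v \<in> ucomp \<sigma> w" "on_edge v f" "bich \<tau> f"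
  shows "cmod (pos (fst f) - pos w) \<le> \<kappa> * cmod (pos w) + K + 1"
proof -
  have "snd f \<in> nbrs (fst f)" using assms(4) by (simp add: bich_def)
  then have "fst f \<in> nbrs (snd f)" using nbrs_sym by blast
  then have "cmod (pos (fst f) - pos v) \<le> 1" using cmod_pos_nbrs[of "fst f" "snd f"] assms(3) by auto
  moreover have "cmod (pos v - pos w) \<le> \<kappa> * cmod (pos w) + K" using small assms by blast
  ultimately show ?thesis using norm_triangle_ineq[of "pos (fst f) - pos v" "pos v - pos w"] by simp
qed

lemma near_step:
  assumes "cmod (pos (fst f) - pos w) \<le> \<kappa> * cmod (pos w) + K + 1" "bich \<tau> f"
  shows "near w (step \<tau> f)"
proof -
  have "ahead f \<in> nbrs (fst f)" using assms(2) ahead_nbrs(1) by (simp add: bich_def)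
  then have "cmod (pos (fst (step \<tau> f)) - pos (fst f)) \<le> 1" using cmod_pos_nbrs by (simp add: step_def)
  then show ?thesis
    using assms(1) norm_triangle_ineq[of "pos (fst (step \<tau> f)) - pos (fst f)" "pos (fst f) - pos w"]
    by (simp add: near_def)
qed

lemma run_near:
  assumes ag: "agree \<sigma> \<tau>" and e: "e \<in> stab \<sigma>"
    and run: "\<And>i. 0 < i \<Longrightarrow> i < j \<Longrightarrow> (step \<tau> ^^ i) e \<notin> stab \<sigma>" and "i \<le> j"
  shows "near (ahead e) ((step \<tau> ^^ i) e)"
proof -
  have be: "bich \<tau> e" using agree_bich[OF ag e] .
  have a: "ahead e \<in> nbrs (fst e)" using be ahead_nbrs(1) by (simp add: bich_def)
  then have 0: "cmod (pos (fst e) - pos (ahead e)) \<le> \<kappa> * cmod (pos (ahead e)) + K + 1"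
    using cmod_pos_nbrs[OF a] K mult_nonneg_nonneg[OF \<kappa>, of "cmod (pos (ahead e))"]
    by (simp add: norm_minus_commute)
  have n1: "cmod (pos (fst ((step \<tau> ^^ i) e)) - pos (ahead e)) \<le> \<kappa> * cmod (pos (ahead e)) + K + 1" if "i < j" for i
  proof (cases "i = 0")
    case False
    then have "(step \<tau> ^^ i) e \<notin> stab \<sigma>" using run that by simp
    then obtain v where v: "on_edge v ((step \<tau> ^^ i) e)" "unst \<sigma> v"
      using stab_iff[OF ag bich_funpow[OF be]] by blast
    have "unst \<sigma> (ahead e)" "v \<in> ucomp \<sigma> (ahead e)"
      using run_from_stab[OF ag e run _ v] that by auto
    then show ?thesis using near_if_unst[OF _ _ v(1) bich_funpow[OF be]] by blast
  qed (use 0 in simp)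
  show ?thesis
  proof (cases "i < j")
    case True
    then show ?thesis using n1[of i] by (simp add: near_def)
  next
    case False
    then have ij: "i = j" using assms(4) by simp
    show ?thesis
    proof (cases j)
      case 0
      then show ?thesis using \<open>cmod (pos (fst e) - pos (ahead e)) \<le> _\<close> ij by (simp add: near_def)
    next
      case (Suc k)
      then show ?thesis using near_step[OF n1[of k] bich_funpow[OF be]] ij by simp
    qed
  qed
qed

lemma unstable_run_near:
  assumes ag: "agree \<sigma> \<tau>" and be: "bich \<tau> e" and j: "j > 0"
    and run: "\<And>i. i < j \<Longrightarrow> (step \<tau> ^^ i) e \<notin> stab \<sigma>"
  shows "\<exists>w. \<forall>i\<le>j. near w ((step \<tau> ^^ i) e)"
proof -
  have "e \<notin> stab \<sigma>" using run[of 0] j by simp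
  then obtain w where w: "on_edge w e" "unst \<sigma> w" using stab_iff[OF ag be] by blast
  have we: "u \<in> ucomp \<sigma> w" if "on_edge u e" "unst \<sigma> u" for u
  proof -
    have "u = w \<or> u \<in> nbrs w" using that(1) w(1) be nbrs_sym[of "fst e" "snd e"] unfolding bich_def by auto
    then show ?thesis using ucomp_step[OF w(2) ucomp_refl _ that(2)] by auto
  qed
  have n1: "cmod (pos (fst ((step \<tau> ^^ i) e)) - pos w) \<le> \<kappa> * cmod (pos w) + K + 1" if "i < j" for i
  proof -
    have "(step \<tau> ^^ i) e \<notin> stab \<sigma>" using run that by simp
    then obtain v where v: "on_edge v ((step \<tau> ^^ i) e)" "unst \<sigma> v"
      using stab_iff[OF ag bich_funpow[OF be]] by blast
    have "v \<in> ucomp \<sigma> w" using run_in_comp[OF ag be run w(2) we _ v] that by simp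
    then show ?thesis using near_if_unst[OF w(2) _ v(1) bich_funpow[OF be]] by blast
  qed
  have "near w ((step \<tau> ^^ i) e)" if ij: "i \<le> j" for i
  proof (cases "i < j")
    case True
    then show ?thesis using n1[of i] by (simp add: near_def)
  next
    case False
    then obtain k where "i = Suc k" "k < j" using ij j by (cases i) auto
    then show ?thesis using near_step[OF n1[of k] bich_funpow[OF be]] by simp
  qed
  then show ?thesis by blast
qed

lemma near_self: "near (fst e) e"
  using \<kappa> K by (simp add: near_def)

text \<open>The path q extends from the first to the last stable edge of p; the pieces of p outside
  are matched with these single edges. Keeping the list of stable edges is what later makes q free
  of repetitions.\<close>

lemma shadow_stable:
  assumes ag: "agree \<sigma> \<tau>" "agree \<sigma> \<tau>'"
    and nx: "\<And>e e'. e \<in> stab \<sigma> \<Longrightarrow> e' \<in> stab \<sigma> \<Longrightarrow> \<exists>j>0. conn \<tau> (stab \<sigma>) j e e' \<Longrightarrow> \<exists>j>0. conn \<tau>' (stab \<sigma>) j e e'"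
  shows "orbit \<tau> p \<Longrightarrow> \<exists>e\<in>set p. e \<in> stab \<sigma> \<Longrightarrow>
    \<exists>q. orbit \<tau>' q \<and> frechet R p q \<and> filter (\<lambda>e. e \<in> stab \<sigma>) q = filter (\<lambda>e. e \<in> stab \<sigma>) p \<and>
      hd q \<in> stab \<sigma> \<and> last q = last (filter (\<lambda>e. e \<in> stab \<sigma>) p)"
proof (induction p rule: rev_induct)
  case (snoc x ps)
  let ?F = "filter (\<lambda>e. e \<in> stab \<sigma>)"
  show ?case
  proof (cases "\<exists>e\<in>set ps. e \<in> stab \<sigma>")
    case False
    then have x: "x \<in> stab \<sigma>" and F: "?F ps = []" using snoc.prems by (auto simp: filter_empty_conv)
    have "orbit \<tau>' [x]" using agree_bich[OF ag(2) x] by (simp add: orbit_def)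
    moreover have "frechet R (ps @ [x]) [x]"
    proof (rule frechet_single)
      fix y assume y: "y \<in> set (ps @ [x])"
      show "R y x"
      proof (cases "ps = []")
        case True
        then show ?thesis using y near_self[of x] nearI by auto
      next
        case ne: False
        let ?e = "hd (ps @ [x])"
        have be: "bich \<tau> ?e" using snoc.prems by (simp add: orbit_def)
        have nth: "(step \<tau> ^^ i) ?e = (ps @ [x]) ! i" if "i \<le> length ps" for i
          using orbit_nth[OF snoc.prems(1), of i] that by simp
        have "(step \<tau> ^^ i) ?e \<notin> stab \<sigma>" if "i < length ps" for i
          using nth[of i] that False by (auto simp: nth_append)
        then obtain w where w: "\<forall>i\<le>length ps. near w ((step \<tau> ^^ i) ?e)"
          using unstable_run_near[OF ag(1) be, of "length ps"] ne by blast
        obtain i where i: "i \<le> length ps" "y = (ps @ [x]) ! i"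
          using y by (metis in_set_conv_nth length_append_singleton less_Suc_eq_le)
        have "near w y" using w i nth by metis
        moreover have "near w x" using w nth[of "length ps"] by (metis le_refl nth_append_length)
        ultimately show ?thesis by (rule nearI)
      qed
    qed simp
    ultimately show ?thesis using x F by (intro exI[of _ "[x]"]) simp
  next
    case True
    then have op: "orbit \<tau> ps" using snoc.prems by (intro orbit_butlast[of \<tau> ps x]) auto
    obtain q where q: "orbit \<tau>' q" "frechet R ps q" "?F q = ?F ps" "hd q \<in> stab \<sigma>" "last q = last (?F ps)"
      using snoc.IH[OF op True] by blast
    obtain as e bs where s: "ps = as @ e # bs" "e \<in> stab \<sigma>" "\<forall>z\<in>set bs. z \<notin> stab \<sigma>"
      using split_list_last_prop[OF True] by blast
    have "?F bs = []" using s(3) by (simp add: filter_empty_conv)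
    then have le: "last q = e" using q(5) s by simp
    define m where "m = length bs + 1"
    have suf: "(e # bs @ [x]) ! i = (step \<tau> ^^ i) e" if "i \<le> m" for i
      using orbit_suffix[of \<tau> as e "bs @ [x]" i] snoc.prems(1) that unfolding s m_def by simp
    have xm: "x = (step \<tau> ^^ m) e" using suf[of m] unfolding m_def by (simp add: nth_append)
    have run: "(step \<tau> ^^ i) e \<notin> stab \<sigma>" if "0 < i" "i < m" for i
    proof -
      have "(step \<tau> ^^ i) e = bs ! (i - 1)" using suf[of i] that unfolding m_def by (cases i) (simp_all add: nth_append)
      then show ?thesis using s(3) that unfolding m_def by auto
    qed
    have nr: "near (ahead e) ((step \<tau> ^^ i) e)" if "i \<le> m" for i
      using run_near[OF ag(1) s(2) run that] .
    have nx': "near (ahead e) x" using nr[of m] xm by simp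
    have qne: "q \<noteq> []" using q(1) by (simp add: orbit_def)
    show ?thesis
    proof (cases "x \<in> stab \<sigma>")
      case False
      have "near (ahead e) e" using nr[of 0] by simp
      then have "frechet R (ps @ [x]) q" using q(2) le nx' nearI by (intro frechet.left) auto
      then show ?thesis using q False by (intro exI[of _ q]) simp
    next
      case True
      have "conn \<tau> (stab \<sigma>) m e x" using xm run by (simp add: conn_def)
      then have "\<exists>j>0. conn \<tau> (stab \<sigma>) j e x" unfolding m_def by (intro exI[of _ "length bs + 1"]) simp
      from nx[OF s(2) True this] obtain j where j: "j > 0" "conn \<tau>' (stab \<sigma>) j e x" by blast
      have run': "(step \<tau>' ^^ i) e \<notin> stab \<sigma>" if "0 < i" "i < j" for i using j that by (simp add: conn_def)
      have nr': "near (ahead e) ((step \<tau>' ^^ i) e)" if "i \<le> j" for i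
        using run_near[OF ag(2) s(2) run' that] .
      define ys where "ys = map (\<lambda>i. (step \<tau>' ^^ Suc i) e) [0..<j - 1]"
      have xj: "(step \<tau>' ^^ Suc (j - 1)) e = x" using j by (simp add: conn_def del: funpow.simps)
      have ys: "y \<notin> stab \<sigma>" "near (ahead e) y" if "y \<in> set ys" for y
      proof -
        obtain i where i: "i < j - 1" "y = (step \<tau>' ^^ Suc i) e"
          using \<open>y \<in> set ys\<close> unfolding ys_def by (metis (no_types, lifting) atLeastLessThan_iff imageE set_map set_upt)
        then show "y \<notin> stab \<sigma>" "near (ahead e) y"
          unfolding i(2) by (intro run' nr'; simp)+
      qed
      have orb: "orbit \<tau>' ((q @ ys) @ [x])"
      proof -
        have "[0..<j] = [0..<j - 1] @ [j - 1]" using upt_Suc_append[of 0 "j - 1"] j(1) by simp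
        then have "map (\<lambda>i. (step \<tau>' ^^ Suc i) e) [0..<j] = ys @ [x]"
          unfolding ys_def by (simp only: map_append list.map xj)
        then show ?thesis using orbit_extend[OF q(1), of j] unfolding le by (simp only: append_assoc)
      qed
      have "last ps = (step \<tau> ^^ (m - 1)) e"
        using suf[of "m - 1"] unfolding s m_def by (cases bs rule: rev_cases) (auto simp: nth_append nth_Cons')
      then have lp: "near (ahead e) (last ps)" using nr[of "m - 1"] by simp
      \<comment> \<open>While p waits on its last edge, q runs through ys; then p moves to x, and q
        follows. All edges paired here are near \<open>ahead e\<close>.\<close>
      have f1: "frechet R ps (q @ ys)" using q(2) ys(2) lp nearI by (intro frechet_extend_right) auto
      have "near (ahead e) (last (q @ ys))"
        using ys(2)[of "last ys"] nr[of 0] le qne by (cases "ys = []") auto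
      then have "frechet R (ps @ [x]) (q @ ys)" using f1 nx' nearI by (intro frechet.left) auto
      then have "frechet R (ps @ [x]) ((q @ ys) @ [x])" using nx' nearI by (intro frechet.right) auto
      moreover have "?F ys = []" using ys(1) by (simp add: filter_empty_conv)
      ultimately show ?thesis using orb q True qne
        by (intro exI[of _ "(q @ ys) @ [x]"]) simp
    qed
  qed
qed simp

lemma shadow_orbit:
  assumes ag: "agree \<sigma> \<tau>" "agree \<sigma> \<tau>'"
    and nx: "\<And>e e'. e \<in> stab \<sigma> \<Longrightarrow> e' \<in> stab \<sigma> \<Longrightarrow> \<exists>j>0. conn \<tau> (stab \<sigma>) j e e' \<Longrightarrow> \<exists>j>0. conn \<tau>' (stab \<sigma>) j e e'"
    and p: "orbit \<tau> p" "distinct p"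
  obtains q where "orbit \<tau>' q" "distinct q" "frechet R p q"
proof (cases "\<exists>e\<in>set p. e \<in> stab \<sigma>")
  case True
  obtain q where q: "orbit \<tau>' q" "frechet R p q" "filter (\<lambda>e. e \<in> stab \<sigma>) q = filter (\<lambda>e. e \<in> stab \<sigma>) p" "hd q \<in> stab \<sigma>"
    using shadow_stable[OF ag nx p(1) True] by blast
  have "distinct (filter (\<lambda>e. e \<in> stab \<sigma>) q)" unfolding q(3) using p(2) by simp
  then show ?thesis using that[OF q(1) orbit_distinct[OF q(1,4)] q(2)] by simp
next
  case False
  have ne: "p \<noteq> []" and be: "bich \<tau> (hd p)" using p(1) by (auto simp: orbit_def)
  have nth: "(step \<tau> ^^ i) (hd p) = p ! i" if "i < length p" for i using orbit_nth[OF p(1) that] by simp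
  have "(step \<tau> ^^ i) (hd p) \<notin> stab \<sigma>" if "i < length p" for i using nth[OF that] that False by auto
  then obtain w where w: "\<forall>i\<le>length p. near w ((step \<tau> ^^ i) (hd p))"
    using unstable_run_near[OF ag(1) be, of "length p"] ne by blast
  \<comment> \<open>The whole path p stays near w, so the path consisting of one stable edge
    suffices, and such an edge lies on an interface of \<tau>' too.\<close>
  obtain s where s: "s \<in> stab \<sigma>" "near w s" using dense[of w] by (force simp: near_def)
  have "frechet R p [s]"
  proof (rule frechet_single[OF ne])
    fix x assume "x \<in> set p"
    then obtain i where i: "i < length p" "x = p ! i" by (auto simp: in_set_conv_nth)
    then have "near w x" using w nth[of i] by (metis less_imp_le)
    then show "R x s" using s(2) by (rule nearI)
  qed
  moreover have "orbit \<tau>' [s]" using agree_bich[OF ag(2) s(1)] by (simp add: orbit_def)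
  ultimately show ?thesis using that by simp
qed

end

section \<open>The metric on curves\<close>

lemma dmet_bdd_below:
  "bdd_below {integral {0..L} (\<lambda>s. 1 / (1 + (cmod (\<phi> s))\<^sup>2)) | L \<phi>.
       0 \<le> L \<and> \<phi> C1_differentiable_on {0..L} \<and> \<phi> 0 = u \<and> \<phi> L = v \<and>
       (\<forall>s\<in>{0..L}. norm (vector_derivative \<phi> (at s within {0..L})) = 1)}" (is "bdd_below ?S")
  and dmet_elem_nonneg: "x \<in> {integral {0..L} (\<lambda>s. 1 / (1 + (cmod (\<phi> s))\<^sup>2)) | L \<phi>.
       0 \<le> L \<and> \<phi> C1_differentiable_on {0..L} \<and> \<phi> 0 = u \<and> \<phi> L = v \<and>
       (\<forall>s\<in>{0..L}. norm (vector_derivative \<phi> (at s within {0..L})) = 1)} \<Longrightarrow> 0 \<le> x"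
proof -
  \<comment> \<open>A non-integrable integrand has integral 0 by convention.\<close>
  have nn: "0 \<le> integral {0..L} (\<lambda>s. 1 / (1 + (cmod (\<phi> s))\<^sup>2))" for L :: real and \<phi>
  proof (cases "(\<lambda>s. 1 / (1 + (cmod (\<phi> s))\<^sup>2)) integrable_on {0..L}")
    case True
    then show ?thesis by (intro integral_nonneg) auto
  qed (simp add: not_integrable_integral)
  then show "bdd_below ?S" by (intro bdd_belowI[of _ 0]) auto
  show "x \<in> ?S \<Longrightarrow> 0 \<le> x" using nn by auto
qed

lemma dmet_le_integral:
  assumes L: "0 < L" and D: "\<And>s. (\<phi> has_vector_derivative D s) (at s)" "continuous_on UNIV D"
    "\<And>s. norm (D s) = 1" and uv: "\<phi> 0 = u" "\<phi> L = v" and m: "0 \<le> m" "\<And>s. s \<in> {0..L} \<Longrightarrow> m \<le> cmod (\<phi> s)"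
  shows "dmet u v \<le> L / (1 + m\<^sup>2)" "0 \<le> dmet u v"
proof -
  have C1: "\<phi> C1_differentiable_on {0..L}"
    unfolding C1_differentiable_on_def using D continuous_on_subset by blast
  have vd: "norm (vector_derivative \<phi> (at s within {0..L})) = 1" if "s \<in> {0..L}" for s
    using vector_derivative_at_within_ivl[OF D(1), of 0 s L] that L D(3) by simp
  have mem: "integral {0..L} (\<lambda>s. 1 / (1 + (cmod (\<phi> s))\<^sup>2)) \<in> {integral {0..L} (\<lambda>s. 1 / (1 + (cmod (\<phi> s))\<^sup>2)) | L \<phi>.
       0 \<le> L \<and> \<phi> C1_differentiable_on {0..L} \<and> \<phi> 0 = u \<and> \<phi> L = v \<and>
       (\<forall>s\<in>{0..L}. norm (vector_derivative \<phi> (at s within {0..L})) = 1)}"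
    using L C1 uv vd by (intro CollectI exI[of _ L] exI[of _ \<phi>]) auto
  have "dmet u v \<le> integral {0..L} (\<lambda>s. 1 / (1 + (cmod (\<phi> s))\<^sup>2))"
    unfolding dmet_def by (rule cInf_lower[OF mem dmet_bdd_below])
  also have "\<dots> \<le> integral {0..L} (\<lambda>s. 1 / (1 + m\<^sup>2))"
  proof (rule integral_le)
    have "continuous_on {0..L} \<phi>"
      using D(1) has_vector_derivative_continuous continuous_at_imp_continuous_on by blast
    moreover have "1 + (cmod z)\<^sup>2 \<noteq> 0" for z by (smt (verit) zero_le_power2)
    ultimately show "(\<lambda>s. 1 / (1 + (cmod (\<phi> s))\<^sup>2)) integrable_on {0..L}"
      by (intro integrable_continuous_interval continuous_intros) auto
    show "(\<lambda>s. 1 / (1 + m\<^sup>2)) integrable_on {0..L}" by (intro integrable_continuous_interval continuous_intros)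
    fix s assume "s \<in> {0..L}"
    then have "m\<^sup>2 \<le> (cmod (\<phi> s))\<^sup>2" using m by (intro power_mono) auto
    then show "1 / (1 + (cmod (\<phi> s))\<^sup>2) \<le> 1 / (1 + m\<^sup>2)"
      by (intro divide_left_mono) (auto intro!: mult_pos_pos add_pos_nonneg)
  qed
  also have "\<dots> = L / (1 + m\<^sup>2)" using L by simp
  finally show "dmet u v \<le> L / (1 + m\<^sup>2)" .
  show "0 \<le> dmet u v"
    unfolding dmet_def by (rule cInf_greatest) (use mem in blast, rule dmet_elem_nonneg)
qed

text \<open>The constant curve (L = 0) need not be admissible in \<open>dmet a a\<close>, since the vector derivative at a
  point of a degenerate interval is unspecified; small circles are used instead.\<close>
lemma dmet_loop:
  assumes "0 < r"
  shows "dmet a a \<le> 2 * pi * r" "0 \<le> dmet a a"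
proof -
  let ?\<phi> = "\<lambda>s. a + of_real r * (cis (s / r) - 1)"
  let ?D = "\<lambda>s. \<i> * cis (s / r)"
  have d: "(?\<phi> has_vector_derivative ?D s) (at s)" for s
    using assms unfolding cis_conv_exp
    by (auto intro!: derivative_eq_intros has_vector_derivative_real_field simp: field_simps)
  have "continuous_on UNIV ?D" by (intro continuous_intros) (use assms in auto)
  moreover have "norm (?D s) = 1" for s by (simp add: norm_mult)
  moreover have "?\<phi> 0 = a" "?\<phi> (2 * pi * r) = a" using assms by (simp_all add: cis_2pi)
  moreover have "0 < 2 * pi * r" using assms by simp
  ultimately show "dmet a a \<le> 2 * pi * r" "0 \<le> dmet a a"
    using dmet_le_integral[of "2 * pi * r" ?\<phi> ?D a a 0] d by auto
qed

lemma dmet_segment: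
  assumes m: "0 \<le> m" "\<And>z. z \<in> closed_segment a b \<Longrightarrow> m \<le> cmod z"
  shows "dmet a b \<le> cmod (b - a) / (1 + m\<^sup>2)" "0 \<le> dmet a b"
proof -
  have "dmet a b \<le> cmod (b - a) / (1 + m\<^sup>2) \<and> 0 \<le> dmet a b"
  proof (cases "a = b")
    case True
    have "dmet a a \<le> 0"
    proof (rule field_le_epsilon)
      fix e :: real assume "0 < e"
      then show "dmet a a \<le> 0 + e" using dmet_loop(1)[of "e / (2 * pi)" a] by simp
    qed
    then show ?thesis using True dmet_loop(2)[of 1 a] by simp
  next
    case False
    let ?L = "cmod (b - a)"
    let ?D = "(b - a) / of_real ?L"
    let ?\<phi> = "\<lambda>s. a + of_real s * ?D"
    have L: "0 < ?L" using False by simp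
    have d: "(?\<phi> has_vector_derivative ?D) (at s)" for s
      using False by (auto intro!: derivative_eq_intros has_vector_derivative_real_field)
    have end': "?\<phi> ?L = b" using L by simp
    have seg: "m \<le> cmod (?\<phi> s)" if "s \<in> {0..?L}" for s
    proof (rule m(2))
      have "?\<phi> s = (1 - s / ?L) *\<^sub>R a + (s / ?L) *\<^sub>R b"
        using L by (simp add: scaleR_conv_of_real algebra_simps diff_divide_distrib)
      then show "?\<phi> s \<in> closed_segment a b"
        unfolding closed_segment_def using that L by (intro CollectI exI[of _ "s / ?L"]) auto
    qed
    have n: "norm ?D = 1" using L by (simp add: norm_divide)
    show ?thesis
      using dmet_le_integral[of ?L ?\<phi> "\<lambda>_. ?D" a b m, OF L d continuous_on_const n _ end' m(1) seg] by simp
  qed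
  then show "dmet a b \<le> cmod (b - a) / (1 + m\<^sup>2)" "0 \<le> dmet a b" by auto
qed

lemma dmet_nonneg: "0 \<le> dmet a b"
  by (rule dmet_segment(2)[of 0]) auto

lemma dmet_le_cmod: "dmet a b \<le> cmod (b - a)"
  using dmet_segment(1)[of 0 a b] by simp

text \<open>The segment from u to v has length at most 2\<eta>(1 + r), where r is the modulus of c,
  and for \<open>r > 1\<close> it stays outside the disc of radius r/2. There the density decays
  quadratically, which outweighs the linear growth of the length.\<close>

lemma dmet_near:
  assumes \<eta>: "0 \<le> \<eta>" "\<eta> \<le> 1/4" and "cmod (u - c) \<le> \<eta> * (1 + cmod c)" "cmod (v - c) \<le> \<eta> * (1 + cmod c)"
  shows "dmet u v \<le> 4 * \<eta>"
proof -
  define r where "r = cmod c"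
  define m where "m = max 0 ((3 * r - 1) / 4)"
  have r: "0 \<le> r" by (simp add: r_def)
  have eb: "\<eta> * (1 + r) \<le> (1 + r) / 4" using mult_right_mono[OF \<eta>(2), of "1 + r"] r by simp
  have "dmet u v \<le> cmod (v - u) / (1 + m\<^sup>2)"
  proof (rule dmet_segment)
    show "0 \<le> m" by (simp add: m_def)
    fix z assume z: "z \<in> closed_segment u v"
    have "closed_segment u v \<subseteq> cball c (\<eta> * (1 + r))"
      using assms by (intro closed_segment_subset) (auto simp: dist_norm norm_minus_commute r_def)
    then have "cmod (c - z) \<le> \<eta> * (1 + r)" using z by (auto simp: dist_norm)
    then have "r - (1 + r) / 4 \<le> cmod z" using norm_triangle_ineq2[of c z] eb unfolding r_def by linarith
    then show "m \<le> cmod z" by (simp add: m_def field_simps)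
  qed
  also have "\<dots> \<le> (2 * \<eta> * (1 + r)) / (1 + m\<^sup>2)"
    using norm_triangle_ineq4[of "v - c" "u - c"] assms
    by (intro divide_right_mono) (auto simp: r_def algebra_simps)
  also have "\<dots> = 2 * \<eta> * ((1 + r) / (1 + m\<^sup>2))" by simp
  also have "\<dots> \<le> 2 * \<eta> * 2"
  proof (intro mult_left_mono)
    have "1 + r \<le> 2 * (1 + m\<^sup>2)"
    proof (cases "r \<le> 1")
      case True
      then show ?thesis by (smt (verit) zero_le_power2)
    next
      case False
      then have "r / 2 \<le> m" by (simp add: m_def)
      then have "(r / 2)\<^sup>2 \<le> m\<^sup>2" using r by (intro power_mono) auto
      moreover have "r \<le> 1 + (r / 2)\<^sup>2"
        using zero_le_power2[of "r / 2 - 1"] by (simp add: power2_eq_square algebra_simps)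
      ultimately have "r \<le> 1 + m\<^sup>2" by (rule order_trans[OF _ add_left_mono, rotated])
      then have "1 + r \<le> 2 + m\<^sup>2" by simp
      also have "\<dots> \<le> 2 * (1 + m\<^sup>2)" by simp
      finally show ?thesis .
    qed
    moreover have "0 < 1 + m\<^sup>2" by (simp add: add_pos_nonneg)
    ultimately show "(1 + r) / (1 + m\<^sup>2) \<le> 2" by (simp add: divide_le_eq)
  qed (use \<eta> in simp)
  finally show ?thesis by simp
qed

text \<open>An infimum of reals lies below a member only if the set is bounded below. Boundedness of
  the curves makes each supremum a genuine one and hence nonnegative.\<close>

lemma Dcurve_le:
  assumes "bounded (\<gamma> ` {0..1})" "bounded (\<gamma>' ` {0..1})" "reparam f" "reparam g"
    "\<And>t. t \<in> {0..1} \<Longrightarrow> dmet (\<gamma> (f t)) (\<gamma>' (g t)) \<le> \<epsilon>"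
  shows "Dcurve \<gamma> \<gamma>' \<le> \<epsilon>"
proof -
  let ?S = "{(SUP t\<in>{0..1}. dmet (\<gamma> (f1 t)) (\<gamma>' (f2 t))) | f1 f2. reparam f1 \<and> reparam f2}"
  obtain B B' where B: "\<And>t. t \<in> {0..1} \<Longrightarrow> cmod (\<gamma> t) \<le> B" "\<And>t. t \<in> {0..1} \<Longrightarrow> cmod (\<gamma>' t) \<le> B'"
    using assms(1,2) unfolding bounded_iff by blast
  have nn: "0 \<le> (SUP t\<in>{0..1}. dmet (\<gamma> (f1 t)) (\<gamma>' (f2 t)))" if "reparam f1" "reparam f2" for f1 f2
  proof (rule cSUP_upper2[of _ _ 0])
    show "bdd_above ((\<lambda>t. dmet (\<gamma> (f1 t)) (\<gamma>' (f2 t))) ` {0..1})"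
    proof (rule bdd_aboveI2)
      fix t :: real assume "t \<in> {0..1}"
      then have "f1 t \<in> {0..1}" "f2 t \<in> {0..1}" using that unfolding reparam_def by blast+
      then show "dmet (\<gamma> (f1 t)) (\<gamma>' (f2 t)) \<le> B' + B"
        using B dmet_le_cmod[of "\<gamma> (f1 t)" "\<gamma>' (f2 t)"] norm_triangle_ineq4[of "\<gamma>' (f2 t)" "\<gamma> (f1 t)"]
        by (smt (verit))
    qed
  qed (auto intro: dmet_nonneg)
  have "bdd_below ?S" using nn by (intro bdd_belowI[of _ 0]) auto
  then have "Dcurve \<gamma> \<gamma>' \<le> (SUP t\<in>{0..1}. dmet (\<gamma> (f t)) (\<gamma>' (g t)))"
    unfolding Dcurve_def using assms(3,4) by (intro cInf_lower) blast+
  also have "\<dots> \<le> \<epsilon>" using assms(5) by (intro cSUP_least) auto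
  finally show ?thesis .
qed

section \<open>From discrete couplings to reparametrised polygons\<close>

lemma frechet_last: "frechet R ps qs \<Longrightarrow> R (last ps) (last qs)"
  by (induction rule: frechet.induct) auto

text \<open>The i-th edge of a path is parametrised by the interval from i to i + 1.\<close>
definition coupled :: "('a \<Rightarrow> 'b \<Rightarrow> bool) \<Rightarrow> 'a list \<Rightarrow> 'b list \<Rightarrow> real \<Rightarrow> real \<Rightarrow> bool" where
  "coupled R ps qs s t \<longleftrightarrow> (\<exists>i<length ps. \<exists>j<length qs. R (ps ! i) (qs ! j) \<and>
     s \<in> {real i..real i + 1} \<and> t \<in> {real j..real j + 1})"

definition coupling :: "('a \<Rightarrow> 'b \<Rightarrow> bool) \<Rightarrow> 'a list \<Rightarrow> 'b list \<Rightarrow> real \<Rightarrow> real \<Rightarrow> bool" where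
  "coupling R ps qs a b \<longleftrightarrow> (\<exists>f g. path f \<and> path g \<and> mono_on {0..1} f \<and> mono_on {0..1} g \<and>
     f 0 = 0 \<and> g 0 = 0 \<and> f 1 = a \<and> g 1 = b \<and> (\<forall>t\<in>{0..1}. coupled R ps qs (f t) (g t)))"

lemma mono_on_join:
  fixes f g :: "real \<Rightarrow> real"
  assumes "mono_on {0..1} f" "mono_on {0..1} g" "f 1 = g 0"
  shows "mono_on {0..1} (f +++ g)"
proof (rule mono_onI)
  fix r s :: real assume rs: "r \<in> {0..1}" "s \<in> {0..1}" "r \<le> s"
  consider "s \<le> 1/2" | "r \<le> 1/2" "s > 1/2" | "r > 1/2" using rs by linarith
  then show "(f +++ g) r \<le> (f +++ g) s"
  proof cases
    case 1
    then show ?thesis using rs mono_onD[OF assms(1), of "2 * r" "2 * s"] by (auto simp: joinpaths_def)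
  next
    case 2
    then have "f (2 * r) \<le> f 1" "g 0 \<le> g (2 * s - 1)"
      using rs mono_onD[OF assms(1), of "2 * r" 1] mono_onD[OF assms(2), of 0 "2 * s - 1"] by auto
    then show ?thesis using 2 assms(3) by (auto simp: joinpaths_def)
  next
    case 3
    then show ?thesis using rs mono_onD[OF assms(2), of "2 * r - 1" "2 * s - 1"] by (auto simp: joinpaths_def)
  qed
qed

lemma coupling_extend:
  assumes "coupling R ps qs a b" "a \<le> a'" "b \<le> b'"
    "\<And>s t. coupled R ps qs s t \<Longrightarrow> coupled R ps' qs' s t"
    "\<And>s t. s \<in> {a..a'} \<Longrightarrow> t \<in> {b..b'} \<Longrightarrow> coupled R ps' qs' s t"
  shows "coupling R ps' qs' a' b'"
proof -
  obtain f g where fg: "path f" "path g" "mono_on {0..1} f" "mono_on {0..1} g"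
     "f 0 = 0" "g 0 = 0" "f 1 = a" "g 1 = b" "\<forall>t\<in>{0..1}. coupled R ps qs (f t) (g t)"
    using assms(1) unfolding coupling_def by blast
  let ?f = "f +++ linepath a a'" and ?g = "g +++ linepath b b'"
  have lp: "mono_on {0..1} (linepath c c')" "linepath c c' t \<in> {c..c'}" if "c \<le> c'" "t \<in> {0..1}" for c c' t :: real
  proof -
    have "mono_on {0..1} (\<lambda>x. c + x * (c' - c))"
      using that by (intro mono_onI) (auto intro!: mult_right_mono)
    then show "mono_on {0..1} (linepath c c')" by (simp add: linepath_def algebra_simps)
    have "linepath c c' t = c + t * (c' - c)" by (simp add: linepath_def algebra_simps)
    moreover have "t * (c' - c) \<le> 1 * (c' - c)" "0 \<le> t * (c' - c)" using that by (intro mult_right_mono mult_nonneg_nonneg; simp)+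
    ultimately show "linepath c c' t \<in> {c..c'}" by simp
  qed
  have "path ?f" "path ?g" using fg by (intro path_join_imp; simp add: pathfinish_def)+
  moreover have "mono_on {0..1} ?f" "mono_on {0..1} ?g"
    using fg lp(1)[OF assms(2), of 0] lp(1)[OF assms(3), of 0] by (auto intro!: mono_on_join simp: linepath_def)
  moreover have "?f 0 = 0" "?g 0 = 0" "?f 1 = a'" "?g 1 = b'" using fg by (auto simp: joinpaths_def linepath_def)
  moreover have "coupled R ps' qs' (?f t) (?g t)" if t: "t \<in> {0..1}" for t
  proof (cases "t \<le> 1/2")
    case True
    then show ?thesis using fg(9) assms(4) t by (auto simp: joinpaths_def)
  next
    case False
    then show ?thesis using lp(2)[OF assms(2), of "2 * t - 1"] lp(2)[OF assms(3), of "2 * t - 1"] t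
      by (auto simp: joinpaths_def intro!: assms(5))
  qed
  ultimately show ?thesis unfolding coupling_def by blast
qed

text \<open>The coupling stops at the midpoints of the current edges. Each discrete move keeps one
  parameter at its midpoint and carries the other to the next midpoint, so only the old and the new
  pair of edges are met. The last half edges are added in
  \<open>frechet_coupling_full\<close>.\<close>

lemma frechet_coupling:
  "frechet R ps qs \<Longrightarrow> coupling R ps qs (real (length ps) - 1/2) (real (length qs) - 1/2)"
proof (induction rule: frechet.induct)
  case (single x y)
  have "path (\<lambda>t. t / 2 :: real)" "mono_on {0..1} (\<lambda>t. t / 2 :: real)"
    by (auto simp: path_def intro!: continuous_intros mono_onI)
  then show ?case unfolding coupling_def coupled_def using single
    by (intro exI[of _ "\<lambda>t. t / 2"]) auto
next
  case (left ps qs x)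
  have ne: "ps \<noteq> []" "qs \<noteq> []" using frechet_nonempty[OF left(1)] by auto
  show ?case
  proof (rule coupling_extend[OF left(3)])
    fix s t assume st: "s \<in> {real (length ps) - 1/2..real (length (ps @ [x])) - 1/2}" "t \<in> {real (length qs) - 1/2..real (length qs) - 1/2}"
    have q: "qs ! (length qs - 1) = last qs" "ps ! (length ps - 1) = last ps" using ne by (simp_all add: last_conv_nth)
    have n: "real (length qs - 1) = real (length qs) - 1" "real (length ps - 1) = real (length ps) - 1"
      using ne by (simp_all add: of_nat_diff Suc_le_eq)
    show "coupled R (ps @ [x]) qs s t"
    proof (cases "s \<le> length ps")
      case True
      then show ?thesis unfolding coupled_def using st frechet_last[OF left(1)] ne q n
        by (intro exI[of _ "length ps - 1"] conjI exI[of _ "length qs - 1"]) (auto simp: nth_append)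
    next
      case False
      then show ?thesis unfolding coupled_def using st left(2) ne q n
        by (intro exI[of _ "length ps"] conjI exI[of _ "length qs - 1"]) (auto simp: nth_append)
    qed
  next
    fix s t assume "coupled R ps qs s t"
    then show "coupled R (ps @ [x]) qs s t"
      unfolding coupled_def by (metis length_append_singleton less_Suc_eq nth_append)
  qed auto
next
  case (right ps qs y)
  have ne: "ps \<noteq> []" "qs \<noteq> []" using frechet_nonempty[OF right(1)] by auto
  show ?case
  proof (rule coupling_extend[OF right(3)])
    fix s t assume st: "t \<in> {real (length qs) - 1/2..real (length (qs @ [y])) - 1/2}" "s \<in> {real (length ps) - 1/2..real (length ps) - 1/2}"
    have q: "qs ! (length qs - 1) = last qs" "ps ! (length ps - 1) = last ps" using ne by (simp_all add: last_conv_nth)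
    have n: "real (length qs - 1) = real (length qs) - 1" "real (length ps - 1) = real (length ps) - 1"
      using ne by (simp_all add: of_nat_diff Suc_le_eq)
    show "coupled R ps (qs @ [y]) s t"
    proof (cases "t \<le> length qs")
      case True
      then show ?thesis unfolding coupled_def using st frechet_last[OF right(1)] ne q n
        by (intro exI[of _ "length ps - 1"] conjI exI[of _ "length qs - 1"]) (auto simp: nth_append)
    next
      case False
      then show ?thesis unfolding coupled_def using st right(2) ne q n
        by (intro exI[of _ "length ps - 1"] conjI exI[of _ "length qs"]) (auto simp: nth_append)
    qed
  next
    fix s t assume "coupled R ps qs s t"
    then show "coupled R ps (qs @ [y]) s t"
      unfolding coupled_def by (metis length_append_singleton less_Suc_eq nth_append)
  qed auto
qed

lemma frechet_coupling_full:
  assumes "frechet R ps qs"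
  shows "coupling R ps qs (length ps) (length qs)"
proof (rule coupling_extend[OF frechet_coupling[OF assms]])
  have ne: "ps \<noteq> []" "qs \<noteq> []" using frechet_nonempty[OF assms] by auto
  fix s t assume "s \<in> {real (length ps) - 1/2..real (length ps)}" "t \<in> {real (length qs) - 1/2..real (length qs)}"
  moreover have "real (length qs - 1) = real (length qs) - 1" "real (length ps - 1) = real (length ps) - 1"
    using ne by (simp_all add: of_nat_diff Suc_le_eq)
  ultimately show "coupled R ps qs s t"
    unfolding coupled_def using frechet_last[OF assms] ne
    by (intro exI[of _ "length ps - 1"] conjI exI[of _ "length qs - 1"]) (auto simp: last_conv_nth)
qed auto

lemma coupling_reparam:
  assumes "coupling R ps qs (length ps) (length qs)" "ps \<noteq> []" "qs \<noteq> []"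
  obtains f g where "reparam f" "reparam g"
    "\<And>t. t \<in> {0..1} \<Longrightarrow> coupled R ps qs (f t * length ps) (g t * length qs)"
proof -
  obtain f g where fg: "path f" "path g" "mono_on {0..1} f" "mono_on {0..1} g"
     "f 0 = 0" "g 0 = 0" "f 1 = real (length ps)" "g 1 = real (length qs)" "\<forall>t\<in>{0..1}. coupled R ps qs (f t) (g t)"
    using assms(1) unfolding coupling_def by blast
  have rp: "reparam (\<lambda>t. h t / c)" if "path h" "mono_on {0..1} h" "h 0 = 0" "h 1 = c" "c > 0" for h :: "real \<Rightarrow> real" and c
    unfolding reparam_def
  proof (intro conjI)
    show m: "mono_on {0..1} (\<lambda>t. h t / c)"
      using that by (intro mono_onI divide_right_mono mono_onD[OF that(2)]) auto
    show co: "continuous_on {0..1} (\<lambda>t. h t / c)"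
      using that by (intro continuous_intros) (auto simp: path_def)
    show "(\<lambda>t. h t / c) ` {0..1} = {0..1}"
    proof
      show "(\<lambda>t. h t / c) ` {0..1} \<subseteq> {0..1}"
      proof safe
        fix t :: real assume t: "t \<in> {0..1}"
        have "h 0 / c \<le> h t / c" "h t / c \<le> h 1 / c"
          using mono_onD[OF m, of 0 t] mono_onD[OF m, of t 1] t by auto
        then show "h t / c \<in> {0..1}" using that by auto
      qed
      show "{0..1} \<subseteq> (\<lambda>t. h t / c) ` {0..1}"
      proof
        fix y :: real assume "y \<in> {0..1}"
        then show "y \<in> (\<lambda>t. h t / c) ` {0..1}"
          using IVT'[of "\<lambda>t. h t / c" 0 y 1] co that by auto
      qed
    qed
  qed
  show ?thesis
  proof (rule that[of "\<lambda>t. f t / length ps" "\<lambda>t. g t / length qs"])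
    fix t :: real assume "t \<in> {0..1}"
    then show "coupled R ps qs (f t / length ps * length ps) (g t / length qs * length qs)"
      using fg(9) assms(2,3) by simp
  qed (use fg assms rp in auto)
qed


lemma dual_ends_near:
  assumes "v \<in> dual_ends e" "snd e \<in> nbrs (fst e)"
  shows "cmod (v - pos (fst e)) \<le> 1"
proof -
  obtain z where z: "v = (pos (fst e) + pos (snd e) + pos z) / 3" "z \<in> nbrs (fst e)"
    using assms(1) unfolding dual_ends_def by (auto simp: case_prod_beta)
  have "v - pos (fst e) = ((pos (snd e) - pos (fst e)) + (pos z - pos (fst e))) / 3"
    unfolding z(1) by (simp add: field_simps)
  then have "cmod (v - pos (fst e)) = cmod ((pos (snd e) - pos (fst e)) + (pos z - pos (fst e))) / 3"
    by (simp only: norm_divide) simp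
  also have "\<dots> \<le> (cmod (pos (snd e) - pos (fst e)) + cmod (pos z - pos (fst e))) / 3"
    using norm_triangle_ineq[of "pos (snd e) - pos (fst e)" "pos z - pos (fst e)"] by (rule divide_right_mono) simp
  also have "\<dots> \<le> (1 + 1) / 3"
    using cmod_pos_nbrs[OF assms(2)] cmod_pos_nbrs[OF z(2)] by (intro divide_right_mono add_mono) auto
  finally show ?thesis by simp
qed

lemma polygon_near:
  fixes t \<delta> :: real
  assumes tr: "traces p vs" and "orbit \<sigma> p" and i: "i < length p" and t: "t * length p \<in> {real i..real i + 1}"
  obtains z where "polygon (map (\<lambda>v. of_real \<delta> * v) vs) t = of_real \<delta> * z" "cmod (z - pos (fst (p ! i))) \<le> 1"
proof -
  have len: "length vs = Suc (length p)" using tr by (simp add: traces_def)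
  define s where "s = t * real (length p)"
  define k where "k = min (nat \<lfloor>s\<rfloor>) (length p - 1)"
  define u where "u = s - real k"
  have si: "real i \<le> s" "s \<le> real i + 1" using t by (auto simp: s_def)
  have kl: "k < length p" using i by (auto simp: k_def)
  have po: "polygon (map (\<lambda>v. of_real \<delta> * v) vs) t = of_real \<delta> * (of_real (1 - u) * vs ! k + of_real u * vs ! Suc k)"
    using len kl unfolding polygon_def Let_def s_def k_def u_def
    by (simp add: algebra_simps)
  have ve: "cmod (vs ! i - pos (fst (p ! i))) \<le> 1" "cmod (vs ! Suc i - pos (fst (p ! i))) \<le> 1"
  proof -
    have "{vs ! i, vs ! Suc i} = dual_ends (p ! i)" using tr i by (simp add: traces_def)
    moreover have "snd (p ! i) \<in> nbrs (fst (p ! i))" using orbit_bich[OF assms(2) i] by (simp add: bich_def)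
    ultimately show "cmod (vs ! i - pos (fst (p ! i))) \<le> 1" "cmod (vs ! Suc i - pos (fst (p ! i))) \<le> 1"
      using dual_ends_near by blast+
  qed
  consider "k = i" | "k = Suc i" "u = 0"
  proof (cases "s < real i + 1")
    case True
    then have "\<lfloor>s\<rfloor> = int i" using si by (simp add: floor_eq_iff)
    then have "k = i" using i by (auto simp: k_def)
    then show ?thesis using that by blast
  next
    case False
    then have s: "s = real (Suc i)" using si by simp
    then have "nat \<lfloor>s\<rfloor> = Suc i" by simp
    then have "k = Suc i \<and> u = 0 \<or> k = i" using i s by (auto simp: k_def u_def min_def)
    then show ?thesis using that by blast
  qed
  then show ?thesis
  proof cases
    case 1
    let ?z = "of_real (1 - u) * vs ! k + of_real u * vs ! Suc k"
    have u: "0 \<le> u" "u \<le> 1" using si 1 by (auto simp: u_def)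
    have "?z - pos (fst (p ! i)) = of_real (1 - u) * (vs ! i - pos (fst (p ! i))) + of_real u * (vs ! Suc i - pos (fst (p ! i)))"
      unfolding 1 by (simp add: algebra_simps)
    then have "cmod (?z - pos (fst (p ! i))) \<le> (1 - u) * cmod (vs ! i - pos (fst (p ! i))) + u * cmod (vs ! Suc i - pos (fst (p ! i)))"
      using norm_triangle_ineq[of "of_real (1 - u) * (vs ! i - pos (fst (p ! i)))" "of_real u * (vs ! Suc i - pos (fst (p ! i)))"] u
      by (simp only: norm_mult norm_of_real abs_of_nonneg diff_ge_0_iff_ge)
    also have "\<dots> \<le> (1 - u) * 1 + u * 1" using ve u by (intro add_mono mult_left_mono) auto
    finally show ?thesis using that[OF po] by simp
  next
    case 2
    then show ?thesis using that[OF po] ve(2) by simp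
  qed
qed

lemma polygon_bounded:
  assumes tr: "traces p vs" and o: "orbit \<sigma> p"
  shows "bounded (polygon (map (\<lambda>v. of_real \<delta> * v) vs) ` {0..1})"
proof -
  have ne: "length p > 0" using o by (simp add: orbit_def)
  define B where "B = (\<Sum>i<length p. cmod (pos (fst (p ! i)))) + 1"
  have "cmod (polygon (map (\<lambda>v. of_real \<delta> * v) vs) t) \<le> \<bar>\<delta>\<bar> * B" if t: "t \<in> {0..1}" for t
  proof -
    define s where "s = t * real (length p)"
    define i where "i = min (nat \<lfloor>s\<rfloor>) (length p - 1)"
    have s: "0 \<le> s" "s \<le> real (length p)" using t by (auto simp: s_def mult_left_le_one_le)
    have i: "i < length p" using ne unfolding i_def by (simp add: min_less_iff_disj)
    have "real i \<le> s \<and> s \<le> real i + 1"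
    proof (cases "nat \<lfloor>s\<rfloor> \<le> length p - 1")
      case True
      then have "real i = of_int \<lfloor>s\<rfloor>" using s by (simp add: i_def)
      then show ?thesis by linarith
    next
      case False
      then have il: "real i = real (length p) - 1" using ne by (simp add: i_def of_nat_diff Suc_le_eq)
      have "length p \<le> nat \<lfloor>s\<rfloor>" using False by simp
      then have "real (length p) \<le> s" using s by (simp add: le_nat_iff le_floor_iff)
      then show ?thesis using il s by simp
    qed
    then have "t * real (length p) \<in> {real i..real i + 1}" by (simp add: s_def)
    from polygon_near[OF tr o i this, of \<delta>] obtain z where
      z: "polygon (map (\<lambda>v. of_real \<delta> * v) vs) t = of_real \<delta> * z" "cmod (z - pos (fst (p ! i))) \<le> 1" by blast
    have "cmod (pos (fst (p ! i))) \<le> (\<Sum>i<length p. cmod (pos (fst (p ! i))))"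
      using i by (intro member_le_sum) auto
    then have "cmod z \<le> B" using z(2) norm_triangle_sub[of z "pos (fst (p ! i))"] unfolding B_def by linarith
    then show ?thesis unfolding z(1) by (simp add: norm_mult mult_left_mono)
  qed
  then show ?thesis unfolding bounded_iff by (intro exI[of _ "\<bar>\<delta>\<bar> * B"]) auto
qed

lemma Dcurve_frechet:
  assumes "frechet Q p q" "traces p vs" "traces q ws" "orbit \<sigma> p" "orbit \<tau> q"
    and Q: "\<And>e f z w. Q e f \<Longrightarrow> cmod (z - pos (fst e)) \<le> 1 \<Longrightarrow> cmod (w - pos (fst f)) \<le> 1 \<Longrightarrow>
       dmet (of_real \<delta> * z) (of_real \<delta> * w) \<le> \<epsilon>"
  shows "Dcurve (polygon (map (\<lambda>v. of_real \<delta> * v) vs)) (polygon (map (\<lambda>v. of_real \<delta> * v) ws)) \<le> \<epsilon>"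
proof -
  have ne: "p \<noteq> []" "q \<noteq> []" using frechet_nonempty[OF assms(1)] by auto
  obtain f g where fg: "reparam f" "reparam g"
    "\<And>t. t \<in> {0..1} \<Longrightarrow> coupled Q p q (f t * length p) (g t * length q)"
    by (rule coupling_reparam[OF frechet_coupling_full[OF assms(1)] ne]) blast
  show ?thesis
  proof (rule Dcurve_le[OF polygon_bounded[OF assms(2,4)] polygon_bounded[OF assms(3,5)] fg(1,2)])
    fix t :: real assume "t \<in> {0..1}"
    from fg(3)[OF this] obtain i j where ij: "i < length p" "j < length q" "Q (p ! i) (q ! j)"
      "f t * length p \<in> {real i..real i + 1}" "g t * length q \<in> {real j..real j + 1}"
      unfolding coupled_def by blast
    obtain z where z: "polygon (map (\<lambda>v. of_real \<delta> * v) vs) (f t) = of_real \<delta> * z" "cmod (z - pos (fst (p ! i))) \<le> 1"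
      by (rule polygon_near[OF assms(2,4) ij(1,4)])
    obtain w where w: "polygon (map (\<lambda>v. of_real \<delta> * v) ws) (g t) = of_real \<delta> * w" "cmod (w - pos (fst (q ! j))) \<le> 1"
      by (rule polygon_near[OF assms(3,5) ij(2,5)])
    show "dmet (polygon (map (\<lambda>v. of_real \<delta> * v) vs) (f t)) (polygon (map (\<lambda>v. of_real \<delta> * v) ws) (g t)) \<le> \<epsilon>"
      unfolding z(1) w(1) using Q[OF ij(3) z(2) w(2)] .
  qed
qed

context shadow
begin

text \<open>Scaling turns \<kappa>r + K + 3 into \<kappa>(\<delta>r) + \<delta>(K + 3), at most
  \<eta>(1 + \<delta>r). The 3 is the 2 of \<open>near\<close> plus 1 for a point of the dual
  edge.\<close>

lemma R_dmet:
  assumes "R e f" "cmod (z - pos (fst e)) \<le> 1" "cmod (w - pos (fst f)) \<le> 1"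
    and \<eta>: "0 \<le> \<eta>" "\<eta> \<le> 1/4" "\<kappa> \<le> \<eta>" and \<delta>: "0 < \<delta>" "\<delta> * (K + 3) \<le> \<eta>"
  shows "dmet (of_real \<delta> * z) (of_real \<delta> * w) \<le> 4 * \<eta>"
proof -
  obtain c where c: "near c e" "near c f" using assms(1) unfolding R_def by blast
  have "cmod (of_real \<delta> * z - of_real \<delta> * pos c) \<le> \<eta> * (1 + cmod (of_real \<delta> * pos c))"
    if "near c e" "cmod (z - pos (fst e)) \<le> 1" for e z
  proof -
    have "cmod (z - pos c) \<le> \<kappa> * cmod (pos c) + (K + 3)"
      using that norm_triangle_ineq[of "z - pos (fst e)" "pos (fst e) - pos c"] by (simp add: near_def)
    then have "\<delta> * cmod (z - pos c) \<le> \<delta> * (\<kappa> * cmod (pos c) + (K + 3))" using \<delta>(1) by (intro mult_left_mono) auto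
    also have "\<dots> = \<kappa> * (\<delta> * cmod (pos c)) + \<delta> * (K + 3)" by (simp add: algebra_simps)
    also have "\<dots> \<le> \<eta> * (\<delta> * cmod (pos c)) + \<eta>" using \<eta>(3) \<delta> by (intro add_mono mult_right_mono) auto
    finally have "\<delta> * cmod (z - pos c) \<le> \<eta> * (1 + \<delta> * cmod (pos c))" by (simp add: algebra_simps)
    moreover have "cmod (of_real \<delta> * z - of_real \<delta> * pos c) = \<delta> * cmod (z - pos c)"
      unfolding right_diff_distrib[symmetric] norm_mult using \<delta>(1) by simp
    ultimately show ?thesis using \<delta>(1) by (simp add: norm_mult)
  qed
  from dmet_near[OF \<eta>(1,2) this[OF c(1) assms(2)] this[OF c(2) assms(3)]] show ?thesis .
qed

text \<open>\<open>follows\<close> is not symmetric, but \<open>next_stable\<close> is an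
  equivalence and R is symmetric; both halves use the unstable components of \<sigma>.\<close>

lemma haus_le_curves:
  assumes F: "follows \<sigma> \<tau>" and \<eta>: "0 \<le> \<eta>" "\<eta> \<le> 1/4" "\<kappa> \<le> \<eta>" and \<delta>: "0 < \<delta>" "\<delta> * (K + 3) \<le> \<eta>"
  shows "haus_le (4 * \<eta>) (curves \<delta> \<sigma>) (curves \<delta> \<tau>)"
  unfolding haus_le_def
proof (intro conjI ballI)
  have ag: "agree \<sigma> \<sigma>" "agree \<sigma> \<tau>" using F unfolding agree_def follows_def by blast+
  note nx = next_stable[OF F]
  note dm = R_dmet[OF _ _ _ \<eta> \<delta>]
  fix \<gamma> assume "\<gamma> \<in> curves \<delta> \<sigma>"
  then obtain p vs where p: "orbit \<sigma> p" "distinct p" "traces p vs" "\<gamma> = polygon (map (\<lambda>v. of_real \<delta> * v) vs)"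
    by (rule curves_orbit)
  obtain q where q: "orbit \<tau> q" "distinct q" "frechet R p q"
    by (rule shadow_orbit[OF ag _ p(1,2)]) (use nx in blast)+
  obtain ws where ws: "traces q ws" using orbit_traces[OF q(1)] by blast
  show "\<exists>\<gamma>'\<in>curves \<delta> \<tau>. Dcurve \<gamma> \<gamma>' \<le> 4 * \<eta>"
  proof
    show "Dcurve \<gamma> (polygon (map (\<lambda>v. of_real \<delta> * v) ws)) \<le> 4 * \<eta>"
      unfolding p(4) by (rule Dcurve_frechet[OF q(3) p(3) ws p(1) q(1)]) (rule dm)
  qed (rule orbit_curves[OF q(1,2) ws])
next
  have ag: "agree \<sigma> \<sigma>" "agree \<sigma> \<tau>" using F unfolding agree_def follows_def by blast+
  note nx = next_stable[OF F]
  have dm: "dmet (of_real \<delta> * z) (of_real \<delta> * w) \<le> 4 * \<eta>"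
    if "R f e" "cmod (z - pos (fst e)) \<le> 1" "cmod (w - pos (fst f)) \<le> 1" for e f z w
  proof -
    have "R e f" using that(1) unfolding R_def by blast
    from R_dmet[OF this that(2,3) \<eta> \<delta>] show ?thesis .
  qed
  fix \<gamma> assume "\<gamma> \<in> curves \<delta> \<tau>"
  then obtain p vs where p: "orbit \<tau> p" "distinct p" "traces p vs" "\<gamma> = polygon (map (\<lambda>v. of_real \<delta> * v) vs)"
    by (rule curves_orbit)
  obtain q where q: "orbit \<sigma> q" "distinct q" "frechet R p q"
    by (rule shadow_orbit[OF ag(2,1) _ p(1,2)]) (use nx in blast)+
  obtain ws where ws: "traces q ws" using orbit_traces[OF q(1)] by blast
  show "\<exists>\<gamma>'\<in>curves \<delta> \<sigma>. Dcurve \<gamma>' \<gamma> \<le> 4 * \<eta>"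
  proof
    show "Dcurve (polygon (map (\<lambda>v. of_real \<delta> * v) ws)) \<gamma> \<le> 4 * \<eta>"
      unfolding p(4) by (rule Dcurve_frechet[OF frechet_flip[OF q(3)] ws p(3) q(1) p(1)]) (rule dm)
  qed (rule orbit_curves[OF q(1,2) ws])
qed

end

lemma haus_le_limit:
  assumes F: "follows \<sigma> \<tau>" and sh: "\<And>\<kappa>. \<kappa> > 0 \<Longrightarrow> \<exists>K. shadow \<sigma> \<kappa> K" and "\<epsilon> > 0"
  shows "\<exists>\<delta>0>0. \<forall>\<delta>. 0 < \<delta> \<and> \<delta> < \<delta>0 \<longrightarrow> haus_le \<epsilon> (curves \<delta> \<sigma>) (curves \<delta> \<tau>)"
proof -
  define \<eta> where "\<eta> = min (1/4) (\<epsilon> / 4)"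
  have \<eta>: "0 < \<eta>" "\<eta> \<le> 1/4" "4 * \<eta> \<le> \<epsilon>" using assms(3) by (auto simp: \<eta>_def)
  obtain K where K: "shadow \<sigma> \<eta> K" using sh[OF \<eta>(1)] by blast
  interpret shadow \<sigma> \<eta> K by (rule K)
  have mono: "haus_le (4 * \<eta>) A B \<Longrightarrow> haus_le \<epsilon> A B" for A B
    using \<eta>(3) unfolding haus_le_def by (meson order_trans)
  have K3: "K + 3 > 0" using local.K by simp
  have "haus_le \<epsilon> (curves \<delta> \<sigma>) (curves \<delta> \<tau>)" if "0 < \<delta>" "\<delta> < \<eta> / (K + 3)" for \<delta>
    using that \<eta> K3 by (intro mono haus_le_curves[OF F]) (auto simp: pos_less_divide_eq)
  then show ?thesis using \<eta>(1) K3 by (intro exI[of _ "\<eta> / (K + 3)"]) simp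
qed

section \<open>Forcing stable edges\<close>

abbreviation col :: "site \<Rightarrow> int" where "col \<equiv> fst"

definition below :: "int \<Rightarrow> edge \<Rightarrow> bool" where
  "below n e \<longleftrightarrow> col (fst e) < n \<and> col (snd e) < n"

text \<open>The interface started at e crosses into column n for the first time, between the sites
  (n - 1, b) and (n - 1, b + 1).\<close>
definition hit :: "edge \<Rightarrow> int \<Rightarrow> int \<Rightarrow> config \<Rightarrow> bool" where
  "hit e n b \<sigma> \<longleftrightarrow> (\<exists>j. (step \<sigma> ^^ j) e = ((n - 1, b + 1), (n - 1, b)) \<and> (\<forall>i\<le>j. below n ((step \<sigma> ^^ i) e)))"

text \<open>Two monochromatic rings of opposite colours, between which the interface of \<open>hit\<close> has to pass.\<close>
definition pat :: "int \<Rightarrow> int \<Rightarrow> bool \<Rightarrow> config \<Rightarrow> bool" where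
  "pat n b c \<sigma> \<longleftrightarrow> (\<forall>k<6. \<sigma> ((n + 1, b + 1) + dir k) = (\<not> c)) \<and> (\<forall>k<6. \<sigma> ((n + 1, b - 2) + dir k) = c)"

lemma all_less6: "(\<forall>k<6. P k) \<longleftrightarrow> P 0 \<and> P 1 \<and> P 2 \<and> P 3 \<and> P 4 \<and> P (5::nat)"
  using less6_cases by auto

lemma pat_eq:
  "pat n b c \<sigma> \<longleftrightarrow> \<sigma> (n + 2, b + 1) = (\<not> c) \<and> \<sigma> (n + 1, b + 2) = (\<not> c) \<and> \<sigma> (n, b + 2) = (\<not> c) \<and>
     \<sigma> (n, b + 1) = (\<not> c) \<and> \<sigma> (n + 1, b) = (\<not> c) \<and> \<sigma> (n + 2, b) = (\<not> c) \<and>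
     \<sigma> (n + 2, b - 2) = c \<and> \<sigma> (n + 1, b - 1) = c \<and> \<sigma> (n, b - 1) = c \<and>
     \<sigma> (n, b - 2) = c \<and> \<sigma> (n + 1, b - 3) = c \<and> \<sigma> (n + 2, b - 3) = c"
  unfolding pat_def all_less6 by (simp add: dir_simps add.commute)

lemma ring_stable6:
  assumes "\<forall>k<6. \<sigma> (z + dir k) = c"
  shows "\<not> unst \<sigma> (z + dir k)"
proof (rule ring_stable[of \<sigma> z c])
  fix k :: nat
  have "k mod 6 < 6" by simp
  then show "\<sigma> (z + dir k) = c" using assms dir_mod6[of k] by metis
qed

lemma pat_stab:
  assumes "pat n b c \<sigma>"
  shows "((n + 1, b), (n + 1, b - 1)) \<in> stab \<sigma>"
proof -
  have "(n + 1, b) = (n + 1, b + 1) + dir 4" "(n + 1, b - 1) = (n + 1, b - 2) + dir 1"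
    by (simp_all add: dir_simps)
  then have "\<not> unst \<sigma> (n + 1, b)" "\<not> unst \<sigma> (n + 1, b - 1)"
    using assms ring_stable6 unfolding pat_def by metis+
  moreover have "\<sigma> (n + 1, b) \<noteq> \<sigma> (n + 1, b - 1)" using assms by (simp add: pat_eq)
  moreover have "(n + 1, b - 1) \<in> nbrs (n + 1, b)" by (simp add: nbrs_def)
  ultimately show ?thesis by (simp add: stab_def bich_def)
qed

text \<open>The colour of (n, b) is not prescribed. The interface passes this site on one side or
  the other and in either case is between the two rings after four steps, without having reached
  column n + 2.\<close>

lemma pat_forces:
  assumes "pat n b (\<sigma> (n - 1, b)) \<sigma>" "\<sigma> (n - 1, b + 1) \<noteq> \<sigma> (n - 1, b)"
  defines "f \<equiv> ((n - 1, b + 1), (n - 1, b))"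
  shows "(step \<sigma> ^^ 4) f = ((n + 1, b), (n + 1, b - 1))"
    and "i \<le> 4 \<Longrightarrow> below (n + 2) ((step \<sigma> ^^ i) f)"
proof -
  note p = assms(1)[unfolded pat_eq]
  have f0: "ahead f = (n, b)" by (simp add: f_def ahead_def rot_def)
  have steps: "\<exists>f1 f2 f3. step \<sigma> f = f1 \<and> step \<sigma> f1 = f2 \<and> step \<sigma> f2 = f3 \<and> step \<sigma> f3 = ((n + 1, b), (n + 1, b - 1)) \<and>
      below (n + 2) f1 \<and> below (n + 2) f2 \<and> below (n + 2) f3"
  proof (cases "\<sigma> (n, b) = \<sigma> (n - 1, b + 1)")
    case True
    have 1: "step \<sigma> f = ((n, b), (n - 1, b))" unfolding step_def f0 using True by (simp add: f_def)
    have 2: "step \<sigma> ((n, b), (n - 1, b)) = ((n, b), (n, b - 1))"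
      using True p assms(2) by (simp add: step_def ahead_def rot_def)
    have 3: "step \<sigma> ((n, b), (n, b - 1)) = ((n, b), (n + 1, b - 1))"
      using True p assms(2) by (simp add: step_def ahead_def rot_def)
    have 4: "step \<sigma> ((n, b), (n + 1, b - 1)) = ((n + 1, b), (n + 1, b - 1))"
      using True p assms(2) by (simp add: step_def ahead_def rot_def)
    show ?thesis using 1 2 3 4 by (simp add: below_def)
  next
    case False
    have 1: "step \<sigma> f = ((n - 1, b + 1), (n, b))" unfolding step_def f0 using False by (simp add: f_def)
    have 2: "step \<sigma> ((n - 1, b + 1), (n, b)) = ((n, b + 1), (n, b))"
      using False p assms(2) by (simp add: step_def ahead_def rot_def)
    have 3: "step \<sigma> ((n, b + 1), (n, b)) = ((n + 1, b), (n, b))"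
      using False p assms(2) by (simp add: step_def ahead_def rot_def)
    have 4: "step \<sigma> ((n + 1, b), (n, b)) = ((n + 1, b), (n + 1, b - 1))"
      using False p assms(2) by (simp add: step_def ahead_def rot_def)
    show ?thesis using 1 2 3 4 by (simp add: below_def)
  qed
  then show "(step \<sigma> ^^ 4) f = ((n + 1, b), (n + 1, b - 1))" by (auto simp: eval_nat_numeral)
  show "below (n + 2) ((step \<sigma> ^^ i) f)" if "i \<le> 4"
  proof -
    have "i = 0 \<or> i = 1 \<or> i = 2 \<or> i = 3 \<or> i = 4" using that by auto
    moreover have "below (n + 2) f" "below (n + 2) ((n + 1, b), (n + 1, b - 1))" by (simp_all add: f_def below_def)
    ultimately show ?thesis using steps by (auto simp: eval_nat_numeral)
  qed
qed

text \<open>The third corner of a triangle can be in a later column than both ends of the edge only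
  if these are in the same column; the direction of travel leaves one orientation.\<close>

lemma crossing_edge:
  assumes "snd f \<in> nbrs (fst f)" "below n f" "n \<le> col (ahead f)"
  obtains b where "f = ((n - 1, b + 1), (n - 1, b))"
proof -
  obtain k where k: "k < 6" "snd f = fst f + dir k" using assms(1) by (auto simp: nbrs_iff_ex)
  have a: "ahead f = fst f + dir (k + 1)" using k(2) ahead_dir[of "fst f" k] by (metis prod.collapse)
  have "k = 4"
    using less6_cases[OF k(1)] assms(2,3) dir_add6[of 0] unfolding a below_def k(2)
    by (elim disjE) (simp_all add: dir_simps flip: numeral_2_eq_2)
  then have "col (fst f) = n - 1" "snd f = fst f + (0, - 1)"
    using assms(2,3) unfolding a below_def k(2) by (simp_all add: dir_simps)
  then have "f = ((n - 1, (snd (fst f) - 1) + 1), (n - 1, snd (fst f) - 1))"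
    by (simp add: prod_eq_iff)
  then show ?thesis using that by blast
qed

lemma hit_ex:
  assumes "bich \<sigma> e" "below n e" "\<not> below n ((step \<sigma> ^^ j) e)"
  obtains b i where "i < j" "(step \<sigma> ^^ i) e = ((n - 1, b + 1), (n - 1, b))" "\<forall>l\<le>i. below n ((step \<sigma> ^^ l) e)"
proof -
  define m where "m = (LEAST j. \<not> below n ((step \<sigma> ^^ j) e))"
  have m: "\<not> below n ((step \<sigma> ^^ m) e)" "m \<le> j"
    unfolding m_def by (rule LeastI[of _ j], rule assms(3), rule Least_le, rule assms(3))
  have lt: "below n ((step \<sigma> ^^ l) e)" if "l < m" for l using not_less_Least that unfolding m_def by blast
  obtain i where i: "m = Suc i" using m(1) assms(2) by (cases m) auto
  let ?f = "(step \<sigma> ^^ i) e"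
  have bf: "below n ?f" using lt i by simp
  have "n \<le> col (ahead ?f)" using m(1) bf unfolding i by (auto simp: below_def step_def split: if_splits)
  moreover have "snd ?f \<in> nbrs (fst ?f)" using bich_funpow[OF assms(1), of i] by (simp add: bich_def)
  ultimately obtain b where "?f = ((n - 1, b + 1), (n - 1, b))" using crossing_edge[OF _ bf] by metis
  then show ?thesis using that[of i b] lt i m(2) by auto
qed

text \<open>The pattern takes its c from the lower end (n - 1, b), so that each ring continues the
  colour on its own side of the interface.\<close>

definition miss :: "edge \<Rightarrow> int \<Rightarrow> config \<Rightarrow> bool" where
  "miss e n \<sigma> \<longleftrightarrow> (\<exists>b. hit e n b \<sigma> \<and> \<not> pat n b (\<sigma> (n - 1, b)) \<sigma>)"

text \<open>If the pattern were present, the run would either contain the stable edge, or end within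
  the four steps leading to it and so not reach column n + 2.\<close>

lemma far_run_miss:
  assumes e: "bich \<sigma> e" "below n e" and run: "\<forall>i\<le>j. (step \<sigma> ^^ i) e \<notin> stab \<sigma>"
    and far: "n + 2 \<le> col (fst ((step \<sigma> ^^ j) e))"
  shows "miss e n \<sigma>"
proof -
  have "\<not> below n ((step \<sigma> ^^ j) e)" using far by (simp add: below_def)
  then obtain b i where bi: "i < j" "(step \<sigma> ^^ i) e = ((n - 1, b + 1), (n - 1, b))" "\<forall>l\<le>i. below n ((step \<sigma> ^^ l) e)"
    by (rule hit_ex[OF e])
  have ht: "hit e n b \<sigma>" using bi unfolding hit_def by blast
  have "\<not> pat n b (\<sigma> (n - 1, b)) \<sigma>"
  proof
    assume p: "pat n b (\<sigma> (n - 1, b)) \<sigma>"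
    let ?f = "((n - 1, b + 1), (n - 1, b))"
    have "bich \<sigma> ?f" using bich_funpow[OF e(1), of i] bi(2) by simp
    then have ne: "\<sigma> (n - 1, b + 1) \<noteq> \<sigma> (n - 1, b)" by (simp add: bich_def)
    have fp: "(step \<sigma> ^^ (r + i)) e = (step \<sigma> ^^ r) ?f" for r using bi(2) by (simp add: funpow_add)
    show False
    proof (cases "4 + i \<le> j")
      case True
      then have "(step \<sigma> ^^ (4 + i)) e \<notin> stab \<sigma>" using run by blast
      then show False unfolding fp pat_forces(1)[OF p ne] using pat_stab[OF p] by blast
    next
      case False
      then have "below (n + 2) ((step \<sigma> ^^ (j - i + i)) e)" unfolding fp by (intro pat_forces(2)[OF p ne]) simp
      then show False using far bi(1) by (simp add: below_def)
    qed
  qed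
  then show ?thesis using ht unfolding miss_def by blast
qed

text \<open>The step after a hit enters column n, so a hit happens only at the first exit from the
  columns below n.\<close>

lemma hit_unique:
  assumes "hit e n b \<sigma>" "hit e n b' \<sigma>"
  shows "b = b'"
proof -
  obtain j where j: "(step \<sigma> ^^ j) e = ((n - 1, b + 1), (n - 1, b))" "\<forall>i\<le>j. below n ((step \<sigma> ^^ i) e)"
    using assms(1) unfolding hit_def by blast
  obtain j' where j': "(step \<sigma> ^^ j') e = ((n - 1, b' + 1), (n - 1, b'))" "\<forall>i\<le>j'. below n ((step \<sigma> ^^ i) e)"
    using assms(2) unfolding hit_def by blast
  have leave: "\<not> below n (step \<sigma> ((n - 1, b + 1), (n - 1, b)))" for b
    by (simp add: step_def ahead_def rot_def below_def)
  have "\<not> j < j'"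
  proof
    assume "j < j'"
    then have "below n ((step \<sigma> ^^ Suc j) e)" using j'(2) by (intro j'(2)[rule_format]) simp
    then show False using j(1) leave[of b] by simp
  qed
  moreover have "\<not> j' < j"
  proof
    assume "j' < j"
    then have "below n ((step \<sigma> ^^ Suc j') e)" by (intro j(2)[rule_format]) simp
    then show False using j'(1) leave[of b'] by simp
  qed
  ultimately have "j = j'" by simp
  then show ?thesis using j j' by simp
qed

section \<open>Events determined by given sites\<close>

definition depends_on :: "site set \<Rightarrow> config set \<Rightarrow> bool" where
  "depends_on V D \<longleftrightarrow> (\<forall>\<sigma> \<tau>. (\<forall>x\<in>V. \<sigma> x = \<tau> x) \<longrightarrow> \<sigma> \<in> D \<longrightarrow> \<tau> \<in> D)"

lemma depends_on_mono: "depends_on V D \<Longrightarrow> V \<subseteq> V' \<Longrightarrow> depends_on V' D"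
  unfolding depends_on_def by blast

lemma depends_on_Int: "depends_on V D \<Longrightarrow> depends_on V E \<Longrightarrow> depends_on V (D \<inter> E)"
  unfolding depends_on_def by blast

text \<open>Every site inspected before the hit becomes an end of the next edge and hence lies below
  column n; the site ahead of the hit is not inspected.\<close>

lemma depends_on_hit: "depends_on {x. col x < n} {\<sigma>. hit e n b \<sigma>}"
  unfolding depends_on_def
proof (intro allI impI)
  fix \<sigma> \<tau> :: config assume ag: "\<forall>x\<in>{x. col x < n}. \<sigma> x = \<tau> x" and "\<sigma> \<in> {\<sigma>. hit e n b \<sigma>}"
  then obtain j where j: "(step \<sigma> ^^ j) e = ((n - 1, b + 1), (n - 1, b))" "\<forall>i\<le>j. below n ((step \<sigma> ^^ i) e)"
    unfolding hit_def by blast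
  have eq: "(step \<tau> ^^ i) e = (step \<sigma> ^^ i) e" if "i \<le> j" for i
    using that
  proof (induction i)
    case (Suc i)
    let ?f = "(step \<sigma> ^^ i) e"
    have "below n ?f" "below n (step \<sigma> ?f)" using j(2) Suc.prems by (auto dest: spec[of _ "Suc i"] spec[of _ i])
    then have "col (fst ?f) < n" "col (ahead ?f) < n" using ahead_on_step[of ?f \<sigma>] by (auto simp: below_def)
    then have "step \<tau> ?f = step \<sigma> ?f" using ag unfolding Ball_def mem_Collect_eq by (intro step_cong) blast+
    then show ?case using Suc by simp
  qed simp
  then show "\<tau> \<in> {\<sigma>. hit e n b \<sigma>}" using j unfolding hit_def by (intro CollectI exI[of _ j]) simp
qed

definition pat_sites :: "int \<Rightarrow> int \<Rightarrow> site set" where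
  "pat_sites n b = {(n + 2, b + 1), (n + 1, b + 2), (n, b + 2), (n, b + 1), (n + 1, b), (n + 2, b),
     (n + 2, b - 2), (n + 1, b - 1), (n, b - 1), (n, b - 2), (n + 1, b - 3), (n + 2, b - 3)}"

text \<open>The linear inequality separates the upper ring from the lower one.\<close>

definition pat_colour :: "int \<Rightarrow> int \<Rightarrow> bool \<Rightarrow> site \<Rightarrow> bool" where
  "pat_colour n b c x = (if 2 * snd x + fst x > 2 * b + n then \<not> c else c)"

lemma pat_cylinder: "pat n b c \<sigma> \<longleftrightarrow> (\<forall>x\<in>pat_sites n b. \<sigma> x = pat_colour n b c x)"
  unfolding pat_eq pat_sites_def pat_colour_def by simp

lemma pat_sites_col: "x \<in> pat_sites n b \<Longrightarrow> n \<le> col x \<and> col x < n + 3"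
  unfolding pat_sites_def by auto

lemma depends_on_pat: "depends_on {x. n \<le> col x \<and> col x < n + 3} {\<sigma>. pat n b c \<sigma>}"
  unfolding depends_on_def pat_cylinder using pat_sites_col by fastforce

lemma card_pat_sites: "finite (pat_sites n b)" "card (pat_sites n b) \<le> 12"
  unfolding pat_sites_def by (auto intro!: card_insert_le_m1 simp: card_insert_if)

section \<open>Probability estimates\<close>

abbreviation coin :: "bool measure" where
  "coin \<equiv> measure_pmf (bernoulli_pmf (1/2))"

interpretation mu: product_prob_space "\<lambda>_::site. coin" UNIV ..

lemma mu0_prob_space: "prob_space mu0"
  unfolding mu0_def by (rule mu.P.prob_space_axioms)

interpretation mu0: prob_space mu0
  by (rule mu0_prob_space)

lemma space_mu0 [simp]: "space mu0 = UNIV"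
  by (simp add: mu0_def space_PiM)

lemma measurable_site: "(\<lambda>\<sigma>. \<sigma> x) \<in> mu0 \<rightarrow>\<^sub>M count_space UNIV"
proof -
  have "(\<lambda>\<sigma>. \<sigma> x) \<in> mu0 \<rightarrow>\<^sub>M coin" unfolding mu0_def by (rule measurable_component_singleton) simp
  then show ?thesis by simp
qed

lemma sets_site: "{\<sigma>. \<sigma> x = c} \<in> sets mu0"
proof -
  have "(\<lambda>\<sigma>. \<sigma> x) -` {c} \<inter> space mu0 \<in> sets mu0" by (rule measurable_sets[OF measurable_site]) simp
  then show ?thesis by (simp add: vimage_def)
qed

lemma sets_step: "{\<sigma>. step \<sigma> e = f} \<in> sets mu0"
proof -
  have eq: "{\<sigma>. \<sigma> x = \<sigma> y} = ({\<sigma>. \<sigma> x = True} \<inter> {\<sigma>. \<sigma> y = True}) \<union> ({\<sigma>. \<sigma> x = False} \<inter> {\<sigma>. \<sigma> y = False})" for x y :: site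
    by auto
  have m: "{\<sigma>. \<sigma> x = \<sigma> y} \<in> sets mu0" for x y :: site
    unfolding eq by (intro sets.Un sets.Int sets_site)
  have st: "{\<sigma>. step \<sigma> e = f} = ({\<sigma>. \<sigma> (ahead e) = \<sigma> (fst e)} \<inter> {\<sigma>. (ahead e, snd e) = f}) \<union>
      ((space mu0 - {\<sigma>. \<sigma> (ahead e) = \<sigma> (fst e)}) \<inter> {\<sigma>. (fst e, ahead e) = f})"
    by (auto simp: step_def)
  have c: "{\<sigma>. P} \<in> sets mu0" for P using sets.top[of mu0] by (cases P) auto
  show ?thesis unfolding st by (intro sets.Un sets.Int sets.Diff m c sets.top)
qed

lemma sets_funpow: "{\<sigma>. P ((step \<sigma> ^^ j) e)} \<in> sets mu0"
proof -
  have eq: "{\<sigma>. (step \<sigma> ^^ j) e = f} \<in> sets mu0" for f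
  proof (induction j arbitrary: f)
    case 0
    then show ?case using sets.top[of mu0] by (cases "e = f") auto
  next
    case (Suc j)
    have "{\<sigma>. (step \<sigma> ^^ Suc j) e = f} = (\<Union>g. {\<sigma>. (step \<sigma> ^^ j) e = g} \<inter> {\<sigma>. step \<sigma> g = f})" by auto
    then show ?case using Suc sets_step by auto
  qed
  have "{\<sigma>. P ((step \<sigma> ^^ j) e)} = (\<Union>f\<in>{f. P f}. {\<sigma>. (step \<sigma> ^^ j) e = f})" by auto
  then show ?thesis using eq by (auto intro!: sets.countable_UN')
qed

lemma sets_hit: "{\<sigma>. hit e n b \<sigma>} \<in> sets mu0"
proof -
  have "{\<sigma>. hit e n b \<sigma>} = (\<Union>j. {\<sigma>. (step \<sigma> ^^ j) e = ((n - 1, b + 1), (n - 1, b))} \<inter>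
     (\<Inter>i\<in>{..j}. {\<sigma>. below n ((step \<sigma> ^^ i) e)}))" by (auto simp: hit_def)
  also have "\<dots> \<in> sets mu0"
    by (intro sets.countable_UN image_subsetI sets.Int sets.finite_INT sets_funpow) auto
  finally show ?thesis .
qed

lemma sets_pat: "{\<sigma>. pat n b c \<sigma>} \<in> sets mu0"
proof -
  have ne: "pat_sites n b \<noteq> {}" by (simp add: pat_sites_def)
  have "{\<sigma>. pat n b c \<sigma>} = (\<Inter>x\<in>pat_sites n b. {\<sigma>. \<sigma> x = pat_colour n b c x})" by (auto simp: pat_cylinder)
  then show ?thesis using card_pat_sites(1) ne sets_site by (auto intro!: sets.finite_INT)
qed

lemma prob_pat: "(1/2) ^ 12 \<le> measure mu0 {\<sigma>. pat n b c \<sigma>}"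
proof -
  let ?J = "pat_sites n b"
  have "emeasure mu0 {\<sigma> \<in> space mu0. \<forall>x\<in>?J. \<sigma> x \<in> {pat_colour n b c x}} = (\<Prod>x\<in>?J. emeasure coin {pat_colour n b c x})"
    unfolding mu0_def by (rule mu.emeasure_PiM_Collect) (auto simp: card_pat_sites)
  also have "\<dots> = (\<Prod>x\<in>?J. ennreal (1/2))"
  proof (intro prod.cong refl)
    fix x
    have "pmf (bernoulli_pmf (1/2)) v = 1/2" for v by (cases v) simp_all
    then show "emeasure coin {pat_colour n b c x} = ennreal (1/2)" by (simp only: emeasure_pmf_single)
  qed
  also have "\<dots> = ennreal ((1/2) ^ card ?J)" unfolding prod_constant by (rule ennreal_power) simp
  finally have "measure mu0 {\<sigma>. pat n b c \<sigma>} = (1/2) ^ card ?J"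
    by (simp add: pat_cylinder measure_def)
  moreover have "(1/2) ^ 12 \<le> (1/2 :: real) ^ card ?J"
    using card_pat_sites(2)[of n b] by (intro power_decreasing) auto
  ultimately show ?thesis by simp
qed

lemma mu0_indep_vars: "mu0.indep_vars (\<lambda>_. coin) (\<lambda>x \<sigma>. \<sigma> x) UNIV"
proof (subst mu0.indep_vars_iff_distr_eq_PiM')
  show "(\<lambda>\<sigma>. \<sigma> x) \<in> mu0 \<rightarrow>\<^sub>M coin" for x
    unfolding mu0_def by (rule measurable_component_singleton) simp
  have "(\<lambda>\<sigma>::config. \<lambda>i\<in>UNIV. \<sigma> i) = (\<lambda>\<sigma>. \<sigma>)" by (simp add: fun_eq_iff)
  then have "distr mu0 (\<Pi>\<^sub>M i\<in>UNIV. coin) (\<lambda>\<sigma>. \<lambda>i\<in>UNIV. \<sigma> i) = mu0"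
    unfolding mu0_def by (simp only: distr_id)
  moreover have "distr mu0 coin (\<lambda>\<sigma>. \<sigma> x) = coin" for x
    unfolding mu0_def by (rule mu.PiM_component) simp
  ultimately show "distr mu0 (\<Pi>\<^sub>M i\<in>UNIV. coin) (\<lambda>\<sigma>. \<lambda>i\<in>UNIV. \<sigma> i) = (\<Pi>\<^sub>M i\<in>UNIV. distr mu0 coin (\<lambda>\<sigma>. \<sigma> i))"
    by (simp add: mu0_def)
qed simp

lemma prob_indep:
  assumes D: "D \<in> sets mu0" "depends_on V D" and E: "E \<in> sets mu0" "depends_on W E" and "V \<inter> W = {}"
  shows "measure mu0 (D \<inter> E) = measure mu0 D * measure mu0 E"
proof -
  \<comment> \<open>Filling up partial configurations presents D and E as preimages of events of the
    restrictions to V and W, which are independent.\<close>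
  define ext where "ext A \<omega> x = (if x \<in> A then \<omega> x else False)" for A :: "site set" and \<omega> :: config and x
  have extm: "ext A \<in> (\<Pi>\<^sub>M x\<in>A. coin) \<rightarrow>\<^sub>M mu0" for A
  proof -
    have "(\<lambda>\<omega> x. ext A \<omega> x) \<in> (\<Pi>\<^sub>M x\<in>A. coin) \<rightarrow>\<^sub>M (\<Pi>\<^sub>M x\<in>UNIV. coin)"
    proof (rule measurable_abs_UNIV)
      fix x show "(\<lambda>\<omega>. ext A \<omega> x) \<in> (\<Pi>\<^sub>M x\<in>A. coin) \<rightarrow>\<^sub>M coin"
      proof (cases "x \<in> A")
        case True
        then show ?thesis
          using measurable_component_singleton[OF True, of "\<lambda>_. coin"] by (simp only: ext_def if_True)
      qed (simp add: ext_def)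
    qed
    then show ?thesis by (simp add: mu0_def)
  qed
  have pre: "ext A -` D \<inter> space (\<Pi>\<^sub>M x\<in>A. coin) \<in> sets (\<Pi>\<^sub>M x\<in>A. coin)" if "D \<in> sets mu0" for A D
    using extm that by (rule measurable_sets)
  have back': "(\<lambda>\<sigma>. restrict (\<lambda>x. \<sigma> x) A) -` (ext A -` D \<inter> space (\<Pi>\<^sub>M x\<in>A. coin)) = D" if "depends_on A D" for A D
  proof -
    have "ext A (restrict \<sigma> A) \<in> D \<longleftrightarrow> \<sigma> \<in> D" for \<sigma>
    proof -
      have a: "\<forall>x\<in>A. ext A (restrict \<sigma> A) x = \<sigma> x" by (simp add: ext_def)
      then have b: "\<forall>x\<in>A. \<sigma> x = ext A (restrict \<sigma> A) x" by simp
      show ?thesis using that a b unfolding depends_on_def by blast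
    qed
    then show ?thesis by (auto simp: space_PiM)
  qed
  have iv: "mu0.indep_var (\<Pi>\<^sub>M x\<in>V. coin) (\<lambda>\<sigma>. restrict (\<lambda>x. \<sigma> x) V) (\<Pi>\<^sub>M x\<in>W. coin) (\<lambda>\<sigma>. restrict (\<lambda>x. \<sigma> x) W)"
    using assms(5) by (intro mu0.indep_var_restrict[OF mu0_indep_vars]) auto
  let ?X = "ext V -` D \<inter> space (\<Pi>\<^sub>M x\<in>V. coin)" and ?Y = "ext W -` E \<inter> space (\<Pi>\<^sub>M x\<in>W. coin)"
  have "(\<lambda>\<sigma>. (restrict (\<lambda>x. \<sigma> x) V, restrict (\<lambda>x. \<sigma> x) W)) -` (?X \<times> ?Y) = D \<inter> E"
    using back'[OF D(2)] back'[OF E(2)] by (simp only: vimage_def mem_Times_iff fst_conv snd_conv Collect_conj_eq mem_Collect_eq)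
  with mu0.indep_varD[OF iv pre[OF D(1)] pre[OF E(1)]] show ?thesis
    using back'[OF D(2)] back'[OF E(2)] by simp
qed

definition q0 :: real where "q0 = 1 - (1/2) ^ 12"

lemma q0: "0 < q0" "q0 < 1"
  by (simp_all add: q0_def power_one_over)

lemma prob_no_pat:
  assumes "D \<in> sets mu0" "depends_on {x. col x < n} D"
  shows "measure mu0 (D - {\<sigma>. pat n b c \<sigma>}) \<le> q0 * measure mu0 D"
proof -
  have "measure mu0 (D - {\<sigma>. pat n b c \<sigma>}) = measure mu0 D - measure mu0 (D \<inter> {\<sigma>. pat n b c \<sigma>})"
    using assms(1) sets_pat by (metis mu0.finite_measure_Diff' )
  also have "measure mu0 (D \<inter> {\<sigma>. pat n b c \<sigma>}) = measure mu0 D * measure mu0 {\<sigma>. pat n b c \<sigma>}"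
    by (rule prob_indep[OF assms sets_pat depends_on_pat]) auto
  also have "measure mu0 D - \<dots> \<le> measure mu0 D - measure mu0 D * (1/2) ^ 12"
    using prob_pat[of n b c] by (intro diff_left_mono mult_left_mono) auto
  also have "\<dots> = q0 * measure mu0 D" by (simp add: q0_def algebra_simps)
  finally show ?thesis .
qed

lemma sets_miss: "{\<sigma>. miss e n \<sigma>} \<in> sets mu0"
proof -
  have "{\<sigma>. miss e n \<sigma>} = (\<Union>b. \<Union>c. ({\<sigma>. hit e n b \<sigma>} \<inter> {\<sigma>. \<sigma> (n - 1, b) = c}) - {\<sigma>. pat n b c \<sigma>})"
    by (auto simp: miss_def)
  also have "\<dots> \<in> sets mu0"
    by (intro sets.countable_UN image_subsetI sets.Diff sets.Int sets_hit sets_site sets_pat)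
  finally show ?thesis .
qed

lemma depends_on_site: "x \<in> V \<Longrightarrow> depends_on V {\<sigma>. \<sigma> x = c}"
  unfolding depends_on_def by auto

lemma depends_on_miss: "depends_on {x. col x < n + 3} {\<sigma>. miss e n \<sigma>}"
proof -
  have 1: "depends_on {x. col x < n + 3} {\<sigma>. hit e n b \<sigma>}" for b
    by (rule depends_on_mono[OF depends_on_hit]) auto
  have 2: "depends_on {x. col x < n + 3} {\<sigma>. pat n b c \<sigma>}" for b c
    by (rule depends_on_mono[OF depends_on_pat]) auto
  show ?thesis
    unfolding depends_on_def
  proof (intro allI impI)
    fix \<sigma> \<tau> :: config assume ag: "\<forall>x\<in>{x. col x < n + 3}. \<sigma> x = \<tau> x" and "\<sigma> \<in> {\<sigma>. miss e n \<sigma>}"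
    then obtain b where b: "hit e n b \<sigma>" "\<not> pat n b (\<sigma> (n - 1, b)) \<sigma>" unfolding miss_def by blast
    have ag': "\<forall>x\<in>{x. col x < n + 3}. \<tau> x = \<sigma> x" using ag by simp
    have "hit e n b \<tau>" using 1[of b] ag b(1) unfolding depends_on_def by blast
    moreover have "\<not> pat n b (\<sigma> (n - 1, b)) \<tau>" using 2[of b "\<sigma> (n - 1, b)"] ag' b(2) unfolding depends_on_def by blast
    moreover have "\<sigma> (n - 1, b) = \<tau> (n - 1, b)" using ag by simp
    ultimately show "\<tau> \<in> {\<sigma>. miss e n \<sigma>}" unfolding miss_def by auto
  qed
qed

text \<open>The place of the pattern is random. Splitting by the place b of the hit and the colour
  at (n - 1, b) gives disjoint events determined by the columns below n; on each the pattern is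
  fixed and independent of the past.\<close>

lemma prob_miss_Int:
  assumes B: "B \<in> sets mu0" "depends_on {x. col x < n} B"
  shows "measure mu0 (B \<inter> {\<sigma>. miss e n \<sigma>}) \<le> q0 * measure mu0 B"
proof -
  define D where "D i = B \<inter> ({\<sigma>. hit e n (fst i) \<sigma>} \<inter> {\<sigma>. \<sigma> (n - 1, fst i) = snd i})" for i :: "int \<times> bool"
  define X where "X i = D i - {\<sigma>. pat n (fst i) (snd i) \<sigma>}" for i
  have Ds: "D i \<in> sets mu0" for i unfolding D_def by (intro sets.Int B sets_hit sets_site)
  have Xs: "X i \<in> sets mu0" for i unfolding X_def by (intro sets.Diff Ds sets_pat)
  have Dd: "depends_on {x. col x < n} (D i)" for i
    unfolding D_def by (intro depends_on_Int B depends_on_hit depends_on_site) simp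
  have disj: "disjoint_family D"
    unfolding disjoint_family_on_def D_def using hit_unique by (fastforce simp: prod_eq_iff)
  then have disjX: "disjoint_family X" unfolding X_def disjoint_family_on_def by blast
  have "B \<inter> {\<sigma>. miss e n \<sigma>} = (\<Union>i. X i)"
    unfolding X_def D_def miss_def by fastforce
  then have "emeasure mu0 (B \<inter> {\<sigma>. miss e n \<sigma>}) = (\<integral>\<^sup>+i. emeasure mu0 (X i) \<partial>count_space UNIV)"
    using Xs disjX by (simp add: emeasure_UN_countable)
  also have "\<dots> \<le> (\<integral>\<^sup>+i. ennreal q0 * emeasure mu0 (D i) \<partial>count_space UNIV)"
  proof (intro nn_integral_mono)
    fix i
    have "measure mu0 (X i) \<le> q0 * measure mu0 (D i)" unfolding X_def by (rule prob_no_pat[OF Ds Dd])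
    then show "emeasure mu0 (X i) \<le> ennreal q0 * emeasure mu0 (D i)"
      using q0 by (simp add: mu0.emeasure_eq_measure ennreal_mult' [symmetric] ennreal_leI)
  qed
  also have "\<dots> = ennreal q0 * (\<integral>\<^sup>+i. emeasure mu0 (D i) \<partial>count_space UNIV)"
    by (rule nn_integral_cmult) simp
  also have "(\<integral>\<^sup>+i. emeasure mu0 (D i) \<partial>count_space UNIV) = emeasure mu0 (\<Union>i. D i)"
    using Ds disj by (simp add: emeasure_UN_countable)
  also have "ennreal q0 * \<dots> \<le> ennreal q0 * emeasure mu0 B"
    by (intro mult_left_mono emeasure_mono) (auto simp: D_def B)
  finally show ?thesis
    using q0 by (simp add: mu0.emeasure_eq_measure ennreal_mult'[symmetric])
qed

text \<open>The offset 2 puts both ends of e below the first column tested. A trial uses up three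
  columns, hence the spacing 3.\<close>

definition misses :: "edge \<Rightarrow> nat \<Rightarrow> config set" where
  "misses e m = {\<sigma>. \<forall>l<m. miss e (col (fst e) + 2 + 3 * int l) \<sigma>}"

text \<open>Its complement yields a stable edge close to x, independently of any interface.\<close>

definition barren :: "site \<Rightarrow> nat \<Rightarrow> config set" where
  "barren x m = {\<sigma>. \<forall>l<m. \<not> pat (col x + 3 * int l) (snd x) True \<sigma>}"

lemma misses_Suc: "misses e (Suc m) = misses e m \<inter> {\<sigma>. miss e (col (fst e) + 2 + 3 * int m) \<sigma>}"
  by (auto simp: misses_def less_Suc_eq)

lemma barren_Suc: "barren x (Suc m) = barren x m - {\<sigma>. pat (col x + 3 * int m) (snd x) True \<sigma>}"
  by (auto simp: barren_def less_Suc_eq)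

lemma misses_bound:
  "misses e m \<in> sets mu0 \<and> depends_on {x. col x < col (fst e) + 2 + 3 * int m} (misses e m) \<and> measure mu0 (misses e m) \<le> q0 ^ m"
proof (induction m)
  case 0
  have "misses e 0 = space mu0" by (simp add: misses_def)
  then show ?case using sets.top[of mu0] mu0.prob_space by (auto simp: depends_on_def)
next
  case (Suc m)
  let ?n = "col (fst e) + 2 + 3 * int m"
  have s: "misses e (Suc m) \<in> sets mu0" unfolding misses_Suc using Suc sets_miss by blast
  have "{x. col x < ?n} \<subseteq> {x. col x < ?n + 3}" by auto
  then have "depends_on {x. col x < ?n + 3} (misses e m)" using Suc depends_on_mono by blast
  then have "depends_on {x. col x < ?n + 3} (misses e (Suc m))"
    unfolding misses_Suc by (rule depends_on_Int[OF _ depends_on_miss])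
  moreover have "measure mu0 (misses e (Suc m)) \<le> q0 * q0 ^ m"
    unfolding misses_Suc using prob_miss_Int[of "misses e m" ?n e] Suc q0
    by (meson mult_left_mono order_trans less_imp_le)
  ultimately show ?case using s by (simp add: algebra_simps)
qed

lemma barren_bound:
  "barren x m \<in> sets mu0 \<and> depends_on {y. col y < col x + 3 * int m} (barren x m) \<and> measure mu0 (barren x m) \<le> q0 ^ m"
proof (induction m)
  case 0
  have "barren x 0 = space mu0" by (simp add: barren_def)
  then show ?case using sets.top[of mu0] mu0.prob_space by (auto simp: depends_on_def)
next
  case (Suc m)
  let ?n = "col x + 3 * int m"
  have s: "barren x (Suc m) \<in> sets mu0" unfolding barren_Suc using Suc sets_pat by blast
  have "{y. col y < ?n} \<subseteq> {y. col y < ?n + 3}" by auto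
  then have 1: "depends_on {y. col y < ?n + 3} (barren x m)" using Suc depends_on_mono by blast
  have 2: "depends_on {y. col y < ?n + 3} {\<sigma>. pat ?n (snd x) True \<sigma>}" by (rule depends_on_mono[OF depends_on_pat]) auto
  have "depends_on {y. col y < ?n + 3} (barren x (Suc m))"
    unfolding depends_on_def
  proof (intro allI impI)
    fix \<sigma> \<tau> :: config assume ag: "\<forall>y\<in>{y. col y < ?n + 3}. \<sigma> y = \<tau> y" and b: "\<sigma> \<in> barren x (Suc m)"
    have ag': "\<forall>y\<in>{y. col y < ?n + 3}. \<tau> y = \<sigma> y" using ag by simp
    show "\<tau> \<in> barren x (Suc m)" using b 1 2 ag ag' unfolding barren_Suc depends_on_def by blast
  qed
  moreover have "measure mu0 (barren x (Suc m)) \<le> q0 * q0 ^ m"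
    unfolding barren_Suc using prob_no_pat[of "barren x m" ?n "snd x" True] Suc q0
    by (meson mult_left_mono order_trans less_imp_le)
  ultimately show ?case using s by (simp add: algebra_simps)
qed

section \<open>Almost sure bounds\<close>

definition box :: "nat \<Rightarrow> site set" where
  "box n = {- int n..int n} \<times> {- int n..int n}"

lemma finite_box [simp]: "finite (box n)"
  by (simp add: box_def)

lemma card_box: "card (box n) = (2 * n + 1)\<^sup>2"
proof -
  have "card {- int n..int n} = 2 * n + 1" by simp
  then show ?thesis unfolding box_def card_cartesian_product by (simp only: power2_eq_square)
qed

lemma cmod_pos_sq: "(cmod (pos x))\<^sup>2 = (of_int (fst x))\<^sup>2 + of_int (fst x) * of_int (snd x) + (of_int (snd x))\<^sup>2"
proof -
  have "Re (pos x) = of_int (fst x) + of_int (snd x) / 2" "Im (pos x) = of_int (snd x) * (sqrt 3 / 2)"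
    by (simp_all add: pos_def omega_def)
  then have "(cmod (pos x))\<^sup>2 = (of_int (fst x) + of_int (snd x) / 2)\<^sup>2 + (of_int (snd x) * (sqrt 3 / 2))\<^sup>2"
    unfolding cmod_power2 by (simp only:)
  also have "\<dots> = (of_int (fst x))\<^sup>2 + of_int (fst x) * of_int (snd x) + (of_int (snd x))\<^sup>2"
    by (simp add: power2_eq_square field_simps)
  finally show ?thesis .
qed

lemma coord_le_cmod: "\<bar>of_int (fst x)\<bar> \<le> 2 * cmod (pos x)" "\<bar>of_int (snd x)\<bar> \<le> 2 * cmod (pos x)"
proof -
  let ?a = "of_int (fst x) :: real" and ?b = "of_int (snd x) :: real"
  have "(2 * cmod (pos x))\<^sup>2 = ?a\<^sup>2 + (2 * ?a\<^sup>2 + (?a + 2 * ?b)\<^sup>2)" "(2 * cmod (pos x))\<^sup>2 = ?b\<^sup>2 + (2 * ?b\<^sup>2 + (2 * ?a + ?b)\<^sup>2)"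
    unfolding power_mult_distrib cmod_pos_sq by (simp_all add: power2_eq_square algebra_simps)
  moreover have "0 \<le> 2 * ?a\<^sup>2 + (?a + 2 * ?b)\<^sup>2" "0 \<le> 2 * ?b\<^sup>2 + (2 * ?a + ?b)\<^sup>2" by simp_all
  ultimately have "?a\<^sup>2 \<le> (2 * cmod (pos x))\<^sup>2" "?b\<^sup>2 \<le> (2 * cmod (pos x))\<^sup>2" by linarith+
  then show "\<bar>?a\<bar> \<le> 2 * cmod (pos x)" "\<bar>?b\<bar> \<le> 2 * cmod (pos x)"
    by (metis abs_le_square_iff abs_of_nonneg mult_nonneg_nonneg norm_ge_zero zero_le_numeral)+
qed

lemma cmod_pos_le: "cmod (pos x) \<le> \<bar>of_int (fst x)\<bar> + \<bar>of_int (snd x)\<bar>"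
proof -
  have "cmod omega = 1"
    by (simp add: omega_def cmod_def power2_eq_square field_simps)
  then show ?thesis
    unfolding pos_def using norm_triangle_ineq[of "of_int (fst x) :: complex" "of_int (snd x) * omega"]
    by (simp add: norm_mult)
qed

lemma pos_diff: "pos (x - y) = pos x - pos y"
  by (simp add: pos_def algebra_simps)

lemmas sets_misses = misses_bound[THEN conjunct1]
lemmas prob_misses = misses_bound[THEN conjunct2, THEN conjunct2]
lemmas sets_barren = barren_bound[THEN conjunct1]
lemmas prob_barren = barren_bound[THEN conjunct2, THEN conjunct2]

text \<open>The number of trials grows linearly in n: the probabilities become summable, while the
  displacement still allowed has slope of order 1/(L + 1), which is small for large L.\<close>

definition bad :: "nat \<Rightarrow> nat \<Rightarrow> config set" where
  "bad L n = (\<Union>x\<in>box n. (\<Union>k\<in>{..<6}. misses (x, x + dir k) (n div Suc L)) \<union> barren x (n div Suc L))"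

lemma sets_bad: "bad L n \<in> sets mu0"
  unfolding bad_def by (intro sets.finite_UN sets.Un sets_misses sets_barren) simp_all

lemma prob_bad: "measure mu0 (bad L n) \<le> 7 * (2 * real n + 1)\<^sup>2 * q0 ^ (n div Suc L)"
proof -
  let ?m = "n div Suc L"
  have "measure mu0 ((\<Union>k\<in>{..<6}. misses (x, x + dir k) ?m) \<union> barren x ?m) \<le> 7 * q0 ^ ?m" for x
  proof -
    have "measure mu0 ((\<Union>k\<in>{..<6}. misses (x, x + dir k) ?m) \<union> barren x ?m) \<le>
      measure mu0 (\<Union>k\<in>{..<6}. misses (x, x + dir k) ?m) + measure mu0 (barren x ?m)"
      by (intro measure_Un_le sets.finite_UN sets_misses sets_barren) simp_all
    also have "measure mu0 (\<Union>k\<in>{..<6::nat}. misses (x, x + dir k) ?m) \<le> (\<Sum>k\<in>{..<6::nat}. measure mu0 (misses (x, x + dir k) ?m))"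
      by (intro mu0.finite_measure_subadditive_finite image_subsetI sets_misses) simp_all
    also have "\<dots> \<le> (\<Sum>k\<in>{..<6::nat}. q0 ^ ?m)" by (intro sum_mono prob_misses)
    also have "measure mu0 (barren x ?m) \<le> q0 ^ ?m" by (rule prob_barren)
    finally show ?thesis by simp
  qed
  note le = this
  have "measure mu0 (bad L n) \<le> (\<Sum>x\<in>box n. measure mu0 ((\<Union>k\<in>{..<6}. misses (x, x + dir k) ?m) \<union> barren x ?m))"
    unfolding bad_def
    by (intro mu0.finite_measure_subadditive_finite image_subsetI sets.Un sets.finite_UN sets_misses sets_barren) simp_all
  also have "\<dots> \<le> (\<Sum>x\<in>box n. 7 * q0 ^ ?m)" using le by (intro sum_mono)
  also have "\<dots> = real (card (box n)) * (7 * q0 ^ ?m)" by simp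
  also have "\<dots> = 7 * (2 * real n + 1)\<^sup>2 * q0 ^ ?m" unfolding card_box by (simp add: algebra_simps)
  finally show ?thesis .
qed

text \<open>Each factor 2n + 1 is bounded with the help of one factor \<open>t ^ n\<close>; the
  remaining \<open>t ^ (2 * n)\<close> gives a geometric series.\<close>

lemma summable_square_geometric:
  fixes t :: real
  assumes "0 < t" "t < 1"
  shows "summable (\<lambda>n. (2 * real n + 1)\<^sup>2 * t ^ (4 * n))"
proof -
  have "(\<lambda>n. (2 * real n + 1) * t ^ n) \<longlonglongrightarrow> 2 * 0 + 0"
  proof -
    have "(\<lambda>n. 2 * (real n * t ^ n) + t ^ n) \<longlonglongrightarrow> 2 * 0 + 0"
      using assms by (intro tendsto_intros powser_times_n_limit_0 LIMSEQ_power_zero) auto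
    then show ?thesis by (simp add: algebra_simps)
  qed
  then have "Bseq (\<lambda>n. (2 * real n + 1) * t ^ n)" by (rule convergent_imp_Bseq[OF convergentI])
  then obtain C where C: "0 < C" "\<And>n. norm ((2 * real n + 1) * t ^ n) \<le> C" by (auto elim: BseqE)
  have "summable (\<lambda>n. C\<^sup>2 * (t\<^sup>2) ^ n)"
    using assms by (intro summable_mult summable_geometric) (simp add: power_less_one_iff abs_square_less_1)
  then show ?thesis
  proof (rule summable_comparison_test')
    fix n :: nat
    have "((2 * real n + 1) * t ^ n)\<^sup>2 \<le> C\<^sup>2"
      using C(2)[of n] by (intro power2_le_iff_abs_le[THEN iffD2]) (use C(1) in auto)
    then have "((2 * real n + 1) * t ^ n)\<^sup>2 * (t\<^sup>2) ^ n \<le> C\<^sup>2 * (t\<^sup>2) ^ n"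
      by (intro mult_right_mono) auto
    moreover have "((2 * real n + 1) * t ^ n)\<^sup>2 * (t\<^sup>2) ^ n = (2 * real n + 1)\<^sup>2 * t ^ (4 * n)"
      by (simp add: power_mult_distrib mult.assoc flip: power_mult power_add)
    ultimately show "norm ((2 * real n + 1)\<^sup>2 * t ^ (4 * n)) \<le> C\<^sup>2 * (t\<^sup>2) ^ n"
      using assms by simp
  qed
qed

lemma AE_eventually_good: "AE \<sigma> in mu0. \<forall>L. \<exists>N. \<forall>n\<ge>N. \<sigma> \<notin> bad L n"
proof (subst AE_all_countable, rule allI)
  fix L :: nat
  \<comment> \<open>Then \<open>t ^ (4 * n)\<close> is q0 to the power n/(L + 1); dividing by q0
    below compensates for rounding down in \<open>n div Suc L\<close>.\<close>
  define t where "t = q0 powr (1 / (4 * real (Suc L)))"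
  have t: "0 < t" "t < 1"
    using q0 powr_less_mono'[of q0 0 "1 / (4 * real (Suc L))"] by (simp_all add: t_def)
  have le: "q0 ^ (n div Suc L) \<le> t ^ (4 * n) / q0" for n
  proof -
    have "real n / real (Suc L) \<le> real (n div Suc L) + 1"
    proof -
      have "n < Suc L * (n div Suc L + 1)" using dividend_less_times_div[of "Suc L" n] by simp
      then have "real n \<le> real (Suc L) * (real (n div Suc L) + 1)"
        by (metis less_imp_le of_nat_1 of_nat_add of_nat_le_iff of_nat_mult)
      then show ?thesis by (simp add: divide_le_eq mult.commute)
    qed
    then have "q0 powr (real (n div Suc L) + 1) \<le> q0 powr (real n / real (Suc L))"
      using q0 by (intro powr_mono') auto
    moreover have "q0 powr (real n / real (Suc L)) = t ^ (4 * n)"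
    proof -
      have "1 / (4 * real (Suc L)) * real (4 * n) = real n / real (Suc L)" by (simp del: of_nat_Suc)
      moreover have "t ^ (4 * n) = t powr real (4 * n)" by (rule powr_realpow[OF t(1), symmetric])
      moreover have "t powr real (4 * n) = q0 powr (1 / (4 * real (Suc L)) * real (4 * n))"
        by (simp only: t_def powr_powr)
      ultimately show ?thesis by (simp only:)
    qed
    moreover have "q0 powr (real (n div Suc L) + 1) = q0 ^ (n div Suc L) * q0"
      using q0 by (simp add: powr_add powr_realpow)
    ultimately show ?thesis using q0 by (simp add: pos_le_divide_eq)
  qed
  have "summable (\<lambda>n. measure mu0 (bad L n))"
  proof (rule summable_comparison_test')
    show "summable (\<lambda>n. 7 / q0 * ((2 * real n + 1)\<^sup>2 * t ^ (4 * n)))"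
      by (intro summable_mult summable_square_geometric t)
    fix n :: nat
    have "measure mu0 (bad L n) \<le> 7 * (2 * real n + 1)\<^sup>2 * q0 ^ (n div Suc L)" by (rule prob_bad)
    also have "\<dots> \<le> 7 * (2 * real n + 1)\<^sup>2 * (t ^ (4 * n) / q0)" by (intro mult_left_mono le) auto
    finally show "norm (measure mu0 (bad L n)) \<le> 7 / q0 * ((2 * real n + 1)\<^sup>2 * t ^ (4 * n))" by simp
  qed
  then have "AE \<sigma> in mu0. eventually (\<lambda>n. \<sigma> \<in> space mu0 - bad L n) sequentially"
    by (intro borel_cantelli_AE1 sets_bad) (auto simp: mu0.emeasure_eq_measure)
  then show "AE \<sigma> in mu0. \<exists>N. \<forall>n\<ge>N. \<sigma> \<notin> bad L n"
    by eventually_elim (auto simp: eventually_at_top_linorder)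
qed

text \<open>One-sided, as columns are explored in increasing order. The 6 is 3 columns per trial
  times the 2 of \<open>coord_le_cmod\<close>.\<close>

definition drift_bound :: "config \<Rightarrow> nat \<Rightarrow> real \<Rightarrow> bool" where
  "drift_bound \<sigma> L K \<longleftrightarrow> (\<forall>e j. bich \<sigma> e \<and> (\<forall>i\<le>j. (step \<sigma> ^^ i) e \<notin> stab \<sigma>) \<longrightarrow>
     of_int (col (fst ((step \<sigma> ^^ j) e) - fst e)) \<le> 6 / real (Suc L) * cmod (pos (fst e)) + K)"

definition dense_bound :: "config \<Rightarrow> nat \<Rightarrow> real \<Rightarrow> bool" where
  "dense_bound \<sigma> L K \<longleftrightarrow> (\<forall>x. \<exists>s\<in>stab \<sigma>. cmod (pos (fst s) - pos x) \<le> 6 / real (Suc L) * cmod (pos x) + K)"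

lemma drift_bound_mono: "drift_bound \<sigma> L K \<Longrightarrow> K \<le> K' \<Longrightarrow> drift_bound \<sigma> L K'"
  unfolding drift_bound_def by (meson add_left_mono order_trans)

lemma good_bounds:
  assumes N: "\<forall>n\<ge>N. \<sigma> \<notin> bad L n"
  shows "drift_bound \<sigma> L (3 * real N + 5)" "dense_bound \<sigma> L (3 * real N + 5)"
proof -
  \<comment> \<open>The radius of a box containing x, beyond the exceptional scales below N.\<close>
  define nn where "nn x = max N (nat \<lceil>2 * cmod (pos x)\<rceil>)" for x
  have xbox: "x \<in> box (nn x)" for x
  proof -
    have "2 * cmod (pos x) \<le> real (nn x)" unfolding nn_def by linarith
    then have "\<bar>real_of_int (fst x)\<bar> \<le> real (nn x)" "\<bar>real_of_int (snd x)\<bar> \<le> real (nn x)"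
      using coord_le_cmod[of x] by linarith+
    then have "\<bar>fst x\<bar> \<le> int (nn x)" "\<bar>snd x\<bar> \<le> int (nn x)" by linarith+
    then show ?thesis unfolding box_def mem_Times_iff by auto
  qed
  have bnd: "real (3 * (nn x div Suc L)) + 2 \<le> 6 / real (Suc L) * cmod (pos x) + (3 * real N + 5)" for x
  proof -
    have "real (nn x) \<le> real N + 2 * cmod (pos x) + 1"
      unfolding nn_def using norm_ge_zero[of "pos x"] by linarith
    then have "real (nn x) / real (Suc L) \<le> (real N + 2 * cmod (pos x) + 1) / real (Suc L)"
      by (intro divide_right_mono) auto
    also have "\<dots> = 2 / real (Suc L) * cmod (pos x) + (real N + 1) / real (Suc L)"
      by (simp add: add_divide_distrib)
    also have "\<dots> \<le> 2 / real (Suc L) * cmod (pos x) + (real N + 1)"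
      by (intro add_left_mono) (simp add: divide_le_eq mult_le_cancel_left1)
    finally have 1: "real (nn x) / real (Suc L) \<le> 2 / real (Suc L) * cmod (pos x) + (real N + 1)" .
    have "real (nn x div Suc L) * real (Suc L) \<le> real (nn x)"
      by (metis div_times_less_eq_dividend of_nat_le_iff of_nat_mult)
    then have "real (nn x div Suc L) \<le> real (nn x) / real (Suc L)" by (simp add: pos_le_divide_eq)
    with 1 have "real (nn x div Suc L) \<le> 2 / real (Suc L) * cmod (pos x) + (real N + 1)" by linarith
    then have "3 * real (nn x div Suc L) \<le> 3 * (2 / real (Suc L) * cmod (pos x) + (real N + 1))"
      by (rule mult_left_mono) simp
    also have "\<dots> = 6 / real (Suc L) * cmod (pos x) + (3 * real N + 3)" by (simp add: algebra_simps)
    finally show ?thesis by simp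
  qed
  have good: "\<sigma> \<notin> bad L (nn x)" for x using N by (simp add: nn_def)
  show "drift_bound \<sigma> L (3 * real N + 5)"
    unfolding drift_bound_def
  proof (intro allI impI; elim conjE)
    fix e j assume e: "bich \<sigma> e" and run: "\<forall>i\<le>j. (step \<sigma> ^^ i) e \<notin> stab \<sigma>"
    define x where "x = fst e"
    define m where "m = nn x div Suc L"
    obtain k where k: "k < 6" "e = (x, x + dir k)"
      using e unfolding bich_def nbrs_iff_ex x_def by (metis prod.collapse)
    have "\<sigma> \<notin> misses e m" using good[of x] xbox[of x] k unfolding bad_def m_def by blast
    then obtain l where l: "l < m" "\<not> miss e (col x + 2 + 3 * int l) \<sigma>" unfolding misses_def x_def by blast
    have "below (col x + 2 + 3 * int l) e"
      using less6_cases[OF k(1)] unfolding k(2) below_def by (auto simp: dir_simps)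
    then have "\<not> (col x + 2 + 3 * int l + 2 \<le> col (fst ((step \<sigma> ^^ j) e)))"
      using far_run_miss[OF e _ run] l(2) by blast
    then have "col (fst ((step \<sigma> ^^ j) e) - x) \<le> 3 * int m + 2" using l(1) by simp
    then have "real_of_int (col (fst ((step \<sigma> ^^ j) e) - x)) \<le> real (3 * m) + 2" by linarith
    then show "of_int (col (fst ((step \<sigma> ^^ j) e) - fst e)) \<le> 6 / real (Suc L) * cmod (pos (fst e)) + (3 * real N + 5)"
      using bnd[of x] unfolding m_def x_def by linarith
  qed
  show "dense_bound \<sigma> L (3 * real N + 5)"
    unfolding dense_bound_def
  proof
    fix x :: site
    define m where "m = nn x div Suc L"
    have "\<sigma> \<notin> barren x m" using good[of x] xbox[of x] unfolding bad_def m_def by blast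
    then obtain l where l: "l < m" "pat (col x + 3 * int l) (snd x) True \<sigma>" unfolding barren_def by blast
    let ?s = "((col x + 3 * int l + 1, snd x), (col x + 3 * int l + 1, snd x - 1))"
    have "cmod (pos (fst ?s) - pos x) \<le> real (3 * m) + 2"
      using cmod_pos_le[of "fst ?s - x"] l(1) unfolding pos_diff by simp
    then have "cmod (pos (fst ?s) - pos x) \<le> 6 / real (Suc L) * cmod (pos x) + (3 * real N + 5)"
      using bnd[of x] unfolding m_def by linarith
    then show "\<exists>s\<in>stab \<sigma>. cmod (pos (fst s) - pos x) \<le> 6 / real (Suc L) * cmod (pos x) + (3 * real N + 5)"
      using pat_stab[OF l(2)] by blast
  qed
qed

lemma AE_bounds: "AE \<sigma> in mu0. \<forall>L. \<exists>K. drift_bound \<sigma> L K \<and> dense_bound \<sigma> L K"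
  using AE_eventually_good by eventually_elim (metis good_bounds)

section \<open>Rotations\<close>

definition rot_edge :: "edge \<Rightarrow> edge" where
  "rot_edge e = (rot (fst e), rot (snd e))"

lemma rot_dir: "rot (dir k) = dir (k + 1)"
  by (simp add: dir_Suc)

lemma nbrs_rot: "rot y \<in> nbrs (rot x) \<longleftrightarrow> y \<in> nbrs x"
proof
  assume "y \<in> nbrs x"
  then obtain k where "y = x + dir k" by (auto simp: nbrs_iff_ex)
  then show "rot y \<in> nbrs (rot x)" by (simp add: rot_add rot_dir)
next
  assume "rot y \<in> nbrs (rot x)"
  then obtain k where k: "rot y = rot x + dir k" by (auto simp: nbrs_iff_ex)
  have "k + 5 + 1 = k + (6::nat)" by simp
  then have "dir k = rot (dir (k + 5))" unfolding rot_dir by (simp only: dir_add6)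
  then have "rot y = rot (x + dir (k + 5))" using k by (simp add: rot_add)
  then show "y \<in> nbrs x" by simp
qed

lemma rot6: "(rot ^^ 6) x = x"
  by (simp add: eval_nat_numeral rot_def prod_eq_iff)

lemma rot_surj: "\<exists>y. x = rot y"
  using rot6[of x] by (intro exI[of _ "(rot ^^ 5) x"]) (simp add: eval_nat_numeral)

lemma unst_rot_imp: "unst (\<sigma> \<circ> rot) x \<Longrightarrow> unst \<sigma> (rot x)"
proof (induction rule: unst.induct)
  case (unstI x)
  show ?case
  proof (rule unst.unstI, intro ballI impI)
    fix y1 y2 assume y: "y1 \<in> nbrs (rot x)" "y2 \<in> nbrs (rot x)"
      "y1 \<noteq> y2 \<and> y2 \<notin> nbrs y1 \<and> \<sigma> y1 = \<sigma> (rot x) \<and> \<sigma> y2 = \<sigma> (rot x)"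
    obtain z1 z2 where z: "y1 = rot z1" "y2 = rot z2" using rot_surj by metis
    have "z1 \<in> nbrs x" "z2 \<in> nbrs x" "z1 \<noteq> z2 \<and> z2 \<notin> nbrs z1 \<and> (\<sigma> \<circ> rot) z1 = (\<sigma> \<circ> rot) x \<and> (\<sigma> \<circ> rot) z2 = (\<sigma> \<circ> rot) x"
      using y unfolding z nbrs_rot by auto
    then show "unst \<sigma> y1 \<or> unst \<sigma> y2" using unstI unfolding z by blast
  qed
qed

lemma unst_rot_pow: "unst (\<sigma> \<circ> (rot ^^ k)) x \<Longrightarrow> unst \<sigma> ((rot ^^ k) x)"
proof (induction k arbitrary: x)
  case (Suc k)
  have "unst ((\<sigma> \<circ> (rot ^^ k)) \<circ> rot) x" using Suc.prems by (simp add: comp_def funpow_swap1)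
  from Suc.IH[OF unst_rot_imp[OF this]] show ?case by (simp add: funpow_swap1)
qed (simp add: comp_def)

lemma unst_rot: "unst (\<sigma> \<circ> rot) x \<longleftrightarrow> unst \<sigma> (rot x)"
proof
  assume u: "unst \<sigma> (rot x)"
  have "(\<sigma> \<circ> rot) \<circ> (rot ^^ 5) = \<sigma>" using rot6 by (simp add: fun_eq_iff eval_nat_numeral)
  then have "unst ((\<sigma> \<circ> rot) \<circ> (rot ^^ 5)) (rot x)" using u by simp
  then have "unst (\<sigma> \<circ> rot) ((rot ^^ 5) (rot x))" by (rule unst_rot_pow)
  then show "unst (\<sigma> \<circ> rot) x" using rot6[of x] by (simp add: eval_nat_numeral)
qed (rule unst_rot_imp)

lemma bich_rot: "bich (\<sigma> \<circ> rot) e \<longleftrightarrow> bich \<sigma> (rot_edge e)"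
  by (simp add: bich_def rot_edge_def nbrs_rot)

lemma stab_rot: "e \<in> stab (\<sigma> \<circ> rot) \<longleftrightarrow> rot_edge e \<in> stab \<sigma>"
  unfolding stab_def mem_Collect_eq bich_rot unst_rot by (simp add: rot_edge_def)

lemma ahead_rot: "ahead (rot_edge e) = rot (ahead e)"
  by (simp add: ahead_def rot_edge_def rot_add rot_diff)

lemma step_rot: "step \<sigma> (rot_edge e) = rot_edge (step (\<sigma> \<circ> rot) e)"
  unfolding step_def ahead_rot by (simp add: rot_edge_def)

lemma step_funpow_rot: "(step \<sigma> ^^ j) (rot_edge e) = rot_edge ((step (\<sigma> \<circ> rot) ^^ j) e)"
proof -
  define \<tau> where "\<tau> = \<sigma> \<circ> rot"
  have "(step \<sigma> ^^ j) (rot_edge e) = rot_edge ((step \<tau> ^^ j) e)"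
    by (induction j) (simp_all add: step_rot[of \<sigma>, folded \<tau>_def])
  then show ?thesis unfolding \<tau>_def .
qed

lemma rot_edge_Suc: "(rot_edge ^^ Suc k) e = (rot_edge ^^ k) (rot_edge e)"
  by (simp add: funpow_swap1)

lemma comp_rot_Suc: "\<sigma> \<circ> (rot ^^ Suc k) = (\<sigma> \<circ> (rot ^^ k)) \<circ> rot"
  by (simp add: fun_eq_iff funpow_swap1)

lemma cmod_pos_rot: "cmod (pos (rot x)) = cmod (pos x)"
proof -
  have "(cmod (pos (rot x)))\<^sup>2 = (cmod (pos x))\<^sup>2"
    unfolding cmod_pos_sq by (simp add: rot_def power2_eq_square algebra_simps)
  then show ?thesis by (simp add: power2_eq_iff_nonneg)
qed

text \<open>As \<open>k + l = 6\<close>, rotating the configuration by k matches rotating the edges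
  by l. The bound for the rotated configuration thus limits the displacement of the original run in
  another direction.\<close>

lemma rot_drift:
  assumes "bich \<sigma> e" "\<forall>i\<le>j. (step \<sigma> ^^ i) e \<notin> stab \<sigma>" "drift_bound (\<sigma> \<circ> (rot ^^ k)) L K" "k + l = 6"
  shows "of_int (col ((rot ^^ l) (fst ((step \<sigma> ^^ j) e) - fst e))) \<le> 6 / real (Suc L) * cmod (pos (fst e)) + K"
proof -
  have back': "e = (rot_edge ^^ k) ((rot_edge ^^ l) e)"
  proof -
    have "(rot_edge ^^ m) f = ((rot ^^ m) (fst f), (rot ^^ m) (snd f))" for m f
      by (induction m) (simp_all add: rot_edge_def)
    then have "(rot_edge ^^ 6) e = e" using rot6 by simp
    then show ?thesis using assms(4) by (metis comp_apply funpow_add)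
  qed
  define f where "f = (rot_edge ^^ l) e"
  define \<tau> where "\<tau> = \<sigma> \<circ> (rot ^^ k)"
  have st: "(step \<sigma> ^^ i) ((rot_edge ^^ k) f) = (rot_edge ^^ k) ((step (\<sigma> \<circ> (rot ^^ k)) ^^ i) f)" for i k f
  proof (induction k arbitrary: f)
    case (Suc k)
    show ?case unfolding rot_edge_Suc comp_rot_Suc Suc step_funpow_rot ..
  qed simp
  have sb: "f \<in> stab (\<sigma> \<circ> (rot ^^ k)) \<longleftrightarrow> (rot_edge ^^ k) f \<in> stab \<sigma>" for k f
  proof (induction k arbitrary: f)
    case (Suc k)
    show ?case unfolding rot_edge_Suc comp_rot_Suc stab_rot Suc ..
  qed simp
  have bb: "bich (\<sigma> \<circ> (rot ^^ k)) f \<longleftrightarrow> bich \<sigma> ((rot_edge ^^ k) f)" for k f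
  proof (induction k arbitrary: f)
    case (Suc k)
    show ?case unfolding rot_edge_Suc comp_rot_Suc bich_rot Suc ..
  qed simp
  have pw: "(rot_edge ^^ m) g = ((rot ^^ m) (fst g), (rot ^^ m) (snd g))" for m g
    by (induction m) (simp_all add: rot_edge_def)
  have e: "e = (rot_edge ^^ k) f" using back' by (simp add: f_def)
  have "bich \<tau> f" using assms(1) bb e by (simp add: \<tau>_def)
  moreover have "\<forall>i\<le>j. (step \<tau> ^^ i) f \<notin> stab \<tau>"
    using assms(2) unfolding \<tau>_def sb st[symmetric] e[symmetric] .
  ultimately have "of_int (col (fst ((step \<tau> ^^ j) f) - fst f)) \<le> 6 / real (Suc L) * cmod (pos (fst f)) + K"
    using assms(3) unfolding drift_bound_def \<tau>_def by blast
  moreover have "(step \<tau> ^^ j) f = (rot_edge ^^ l) ((step \<sigma> ^^ j) e)"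
  proof -
    have "(rot_edge ^^ l) ((step \<sigma> ^^ j) e) = (rot_edge ^^ l) ((rot_edge ^^ k) ((step \<tau> ^^ j) f))"
      unfolding \<tau>_def st[symmetric] e[symmetric] ..
    also have "\<dots> = (rot_edge ^^ 6) ((step \<tau> ^^ j) f)" using assms(4) by (metis add.commute comp_apply funpow_add)
    also have "\<dots> = (step \<tau> ^^ j) f" unfolding pw rot6 by simp
    finally show ?thesis ..
  qed
  moreover have "(rot ^^ m) (x - y) = (rot ^^ m) x - (rot ^^ m) y" for m x y
    by (induction m) (simp_all add: rot_diff)
  moreover have "cmod (pos ((rot ^^ m) x)) = cmod (pos x)" for m x
    by (induction m) (simp_all add: cmod_pos_rot)
  ultimately show ?thesis unfolding f_def pw by simp
qed

section \<open>Rotation invariance and displacement in all directions\<close>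

lemma distr_rot: "distr mu0 mu0 (\<lambda>\<sigma>. \<sigma> \<circ> (rot ^^ k)) = mu0"
proof -
  have inj: "inj (rot ^^ k)"
    by (induction k) (auto simp: inj_def)
  have "distr (\<Pi>\<^sub>M i\<in>UNIV. coin) (\<Pi>\<^sub>M i\<in>UNIV. coin) (\<lambda>\<omega>. \<lambda>n\<in>UNIV. \<omega> ((rot ^^ k) n)) = (\<Pi>\<^sub>M i\<in>(UNIV :: site set). coin)"
    using inj by (intro distr_PiM_reindex) (auto simp: measure_pmf.prob_space_axioms)
  moreover have "(\<lambda>\<omega>::config. \<lambda>n\<in>UNIV. \<omega> ((rot ^^ k) n)) = (\<lambda>\<sigma>. \<sigma> \<circ> (rot ^^ k))"
    by (simp add: fun_eq_iff)
  ultimately show ?thesis unfolding mu0_def by simp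
qed

lemma measurable_rot: "(\<lambda>\<sigma>. \<sigma> \<circ> (rot ^^ k)) \<in> mu0 \<rightarrow>\<^sub>M mu0"
proof -
  have "(\<lambda>\<sigma> x. \<sigma> ((rot ^^ k) x)) \<in> mu0 \<rightarrow>\<^sub>M (\<Pi>\<^sub>M x\<in>UNIV. coin)"
    by (rule measurable_abs_UNIV) (unfold mu0_def, rule measurable_component_singleton, simp)
  then show ?thesis by (simp add: mu0_def comp_def)
qed

lemma AE_rot_bounds: "AE \<sigma> in mu0. \<forall>k L. \<exists>K. drift_bound (\<sigma> \<circ> (rot ^^ k)) L K"
proof (subst AE_all_countable, rule allI)
  fix k
  have "AE \<sigma> in distr mu0 mu0 (\<lambda>\<sigma>. \<sigma> \<circ> (rot ^^ k)). \<forall>L. \<exists>K. drift_bound \<sigma> L K \<and> dense_bound \<sigma> L K"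
    unfolding distr_rot by (rule AE_bounds)
  from AE_distrD[OF measurable_rot this]
  show "AE \<sigma> in mu0. \<forall>L. \<exists>K. drift_bound (\<sigma> \<circ> (rot ^^ k)) L K" by eventually_elim blast
qed

text \<open>The rotations by l = 6, 3, 4, 1 bound the first coordinate and the second coordinate
  from above and from below.\<close>

lemma run_displacement:
  assumes "\<And>k. k < 6 \<Longrightarrow> drift_bound (\<sigma> \<circ> (rot ^^ k)) L K"
    and "bich \<sigma> e" "\<forall>i\<le>j. (step \<sigma> ^^ i) e \<notin> stab \<sigma>"
  shows "cmod (pos (fst ((step \<sigma> ^^ j) e)) - pos (fst e)) \<le> 12 / real (Suc L) * cmod (pos (fst e)) + 2 * K"
proof -
  define v where "v = fst ((step \<sigma> ^^ j) e) - fst e"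
  define M where "M = 6 / real (Suc L) * cmod (pos (fst e)) + K"
  have d: "of_int (col ((rot ^^ l) v)) \<le> M" if "k < 6" "k + l = 6" for k l
    using rot_drift[OF assms(2,3) assms(1)[OF that(1)] that(2)] unfolding v_def M_def .
  have "of_int (fst v) \<le> M" using d[of 0 6] rot6[of v] by simp
  moreover have "- of_int (fst v) \<le> M" using d[of 3 3] by (simp add: eval_nat_numeral rot_def)
  moreover have "- of_int (snd v) \<le> M" using d[of 5 1] by (simp add: rot_def)
  moreover have "of_int (snd v) \<le> M" using d[of 2 4] by (simp add: eval_nat_numeral rot_def)
  ultimately have "cmod (pos v) \<le> 2 * M" using cmod_pos_le[of v] by linarith
  then show ?thesis unfolding v_def pos_diff M_def by (simp add: algebra_simps)
qed

lemma shadow_if_bounds: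
  assumes dr: "\<forall>k L. \<exists>K. drift_bound (\<sigma> \<circ> (rot ^^ k)) L K" and de: "\<forall>L. \<exists>K. dense_bound \<sigma> L K"
    and \<kappa>: "\<kappa> > 0"
  shows "\<exists>K. shadow \<sigma> \<kappa> K"
proof -
  \<comment> \<open>Runs have slope \<open>12 / Suc L\<close>; twice this must be at most \<kappa>
    for the final bound and at most 1 for the absorption below.\<close>
  obtain L :: nat where L: "24 / min \<kappa> 1 < real L" using reals_Archimedean2 by blast
  define F where "F = 12 / real (Suc L)"
  have S: "0 < real (Suc L)" by simp
  have "24 < min \<kappa> 1 * real L" using L \<kappa> by (simp add: pos_divide_less_eq mult.commute)
  also have "\<dots> \<le> min \<kappa> 1 * real (Suc L)" using \<kappa> by (intro mult_left_mono) auto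
  finally have "24 \<le> min \<kappa> 1 * real (Suc L)" by simp
  moreover have "min \<kappa> 1 * real (Suc L) \<le> \<kappa> * real (Suc L)" "min \<kappa> 1 * real (Suc L) \<le> 1 * real (Suc L)"
    by (intro mult_right_mono; simp)+
  ultimately have "24 / real (Suc L) \<le> \<kappa>" "24 / real (Suc L) \<le> 1"
    unfolding pos_divide_le_eq[OF S] by linarith+
  moreover have "2 * F = 24 / real (Suc L)" by (simp add: F_def)
  ultimately have F: "0 < F" "2 * F \<le> \<kappa>" "2 * F \<le> 1" using S by (auto simp: F_def)
  have "\<exists>Kd. \<forall>k. drift_bound (\<sigma> \<circ> (rot ^^ k)) L (Kd k)" by (rule choice) (use dr in blast)
  then obtain Kd where Kd: "\<And>k. drift_bound (\<sigma> \<circ> (rot ^^ k)) L (Kd k)" by blast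
  obtain K' where K': "dense_bound \<sigma> L K'" using de by blast
  define K where "K = (\<Sum>k<6. \<bar>Kd k\<bar>)"
  have K0: "0 \<le> K" unfolding K_def by (simp add: sum_nonneg)
  have drK: "drift_bound (\<sigma> \<circ> (rot ^^ k)) L K" if "k < 6" for k
  proof -
    have "\<bar>Kd k\<bar> \<le> K" unfolding K_def using that by (intro member_le_sum) auto
    then have "Kd k \<le> K" by simp
    then show ?thesis by (rule drift_bound_mono[OF Kd])
  qed
  note disp = run_displacement[OF drK, folded F_def]
  \<comment> \<open>The run between e and f contributes 4K + 1, the passage from w and v to these
    edges contributes 2, and the density of stable edges K'.\<close>
  define K2 where "K2 = 4 * K + 3 + \<bar>K'\<bar>"
  have "shadow \<sigma> \<kappa> K2"
  proof
    show "0 \<le> \<kappa>" "0 \<le> K2" using \<kappa> K0 by (auto simp: K2_def)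
    fix w v assume w: "unst \<sigma> w" "v \<in> ucomp \<sigma> w"
    obtain e where e: "e \<in> edges_at \<sigma> w" by (rule edges_at_nonempty[OF w(1)])
    obtain f where f: "f \<in> edges_at \<sigma> v" by (rule edges_at_nonempty[OF ucomp_unst[OF w]])
    have g: "gap \<sigma> (stab \<sigma>) e f" by (rule ucomp_gap[OF w e f])
    have off: "cmod (pos (fst h) - pos u) \<le> 1" if "h \<in> edges_at \<sigma> u" for h u
    proof -
      have "u = fst h \<or> u \<in> nbrs (fst h)" using that unfolding edges_at_def bich_def by auto
      then show ?thesis using cmod_pos_nbrs[of u "fst h"] by (auto simp: norm_minus_commute)
    qed
    have run: "\<forall>i\<le>j. (step \<sigma> ^^ i) a \<notin> stab \<sigma>" if "conn \<sigma> (stab \<sigma>) j a b" "a \<notin> stab \<sigma>" "b \<notin> stab \<sigma>" for j a b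
      using that unfolding conn_def by (metis funpow_0 le_neq_implies_less neq0_conv)
    define E where "E = cmod (pos (fst e))"
    define d where "d = cmod (pos (fst f) - pos (fst e))"
    have E0: "0 \<le> E" "0 \<le> d" by (auto simp: E_def d_def)
    define G where "G = F * E"
    have G0: "0 \<le> G" unfolding G_def using F(1) E0 by simp
    have dG: "d \<le> 2 * G + 4 * K"
    proof -
      obtain j where "conn \<sigma> (stab \<sigma>) j e f \<or> conn \<sigma> (stab \<sigma>) j f e" using g unfolding gap_def by blast
      then show ?thesis
      proof
        assume c: "conn \<sigma> (stab \<sigma>) j e f"
        have "d \<le> G + 2 * K"
          using disp[of e j] run[OF c] g c unfolding gap_def conn_def d_def E_def G_def by auto
        then show ?thesis using G0 K0 by linarith
      next
        assume c: "conn \<sigma> (stab \<sigma>) j f e"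
        have 1: "d \<le> F * cmod (pos (fst f)) + 2 * K"
          using disp[of f j] run[OF c] g c unfolding gap_def conn_def d_def by (auto simp: norm_minus_commute)
        \<comment> \<open>This run starts at f, so its bound involves the modulus at f; the excess
          over the one at e is at most d, and half of d is absorbed on the left.\<close>
        have "cmod (pos (fst f)) \<le> E + d"
          unfolding E_def d_def using norm_triangle_sub[of "pos (fst f)" "pos (fst e)"] by simp
        then have "F * cmod (pos (fst f)) \<le> F * (E + d)" using F(1) by (intro mult_left_mono) auto
        also have "\<dots> = G + F * d" unfolding G_def by (rule distrib_left)
        also have "F * d \<le> 1/2 * d" using F(3) E0 by (intro mult_right_mono) auto
        finally have "d \<le> G + 1/2 * d + 2 * K" using 1 by linarith
        then show ?thesis by linarith
      qed
    qed
    have "E \<le> cmod (pos w) + 1"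
      using off[OF e] norm_triangle_sub[of "pos (fst e)" "pos w"] unfolding E_def by simp
    then have "2 * F * E \<le> 2 * F * (cmod (pos w) + 1)" using F(1) by (intro mult_left_mono) auto
    also have "\<dots> = 2 * F * cmod (pos w) + 2 * F" by (simp add: distrib_left)
    also have "2 * F * cmod (pos w) \<le> \<kappa> * cmod (pos w)" using F(2) by (intro mult_right_mono) auto
    finally have "2 * G \<le> \<kappa> * cmod (pos w) + 2 * F" unfolding G_def by simp
    with dG F(3) have db: "d \<le> \<kappa> * cmod (pos w) + 1 + 4 * K" by linarith
    have "cmod (pos v - pos w) \<le> cmod (pos v - pos (fst f)) + d + cmod (pos (fst e) - pos w)"
      unfolding d_def
      using norm_triangle_ineq[of "pos v - pos (fst f)" "pos (fst f) - pos (fst e)"]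
        norm_triangle_ineq[of "pos v - pos (fst e)" "pos (fst e) - pos w"] by simp
    then show "cmod (pos v - pos w) \<le> \<kappa> * cmod (pos w) + K2"
      using off[OF e] off[OF f] db unfolding K2_def by (simp add: norm_minus_commute)
  next
    fix w :: site
    obtain s where s: "s \<in> stab \<sigma>" "cmod (pos (fst s) - pos w) \<le> 6 / real (Suc L) * cmod (pos w) + K'"
      using K' unfolding dense_bound_def by blast
    have "2 * (6 / real (Suc L)) = F" by (simp add: F_def del: of_nat_Suc)
    then have "6 / real (Suc L) \<le> \<kappa>" using F(1,2) by linarith
    then have "6 / real (Suc L) * cmod (pos w) \<le> \<kappa> * cmod (pos w)" by (rule mult_right_mono) simp
    then have "cmod (pos (fst s) - pos w) \<le> \<kappa> * cmod (pos w) + K2" using s(2) K0 unfolding K2_def by linarith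
    then show "\<exists>s\<in>stab \<sigma>. cmod (pos (fst s) - pos w) \<le> \<kappa> * cmod (pos w) + K2" using s(1) by blast
  qed
  then show ?thesis ..
qed

lemma finite_ucomp:
  assumes "shadow \<sigma> \<kappa> K" "unst \<sigma> w"
  shows "finite (ucomp \<sigma> w)"
proof -
  define C where "C = (1 + \<kappa>) * cmod (pos w) + K"
  have "ucomp \<sigma> w \<subseteq> box (nat \<lceil>2 * C\<rceil>)"
  proof
    fix v assume "v \<in> ucomp \<sigma> w"
    then have "cmod (pos v - pos w) \<le> \<kappa> * cmod (pos w) + K" using assms by (intro shadow.small)
    then have "cmod (pos v) \<le> C" using norm_triangle_sub[of "pos v" "pos w"] unfolding C_def by (simp add: distrib_right)
    then have "\<bar>real_of_int (fst v)\<bar> \<le> 2 * C" "\<bar>real_of_int (snd v)\<bar> \<le> 2 * C" using coord_le_cmod[of v] by linarith+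
    then have "\<bar>fst v\<bar> \<le> int (nat \<lceil>2 * C\<rceil>)" "\<bar>snd v\<bar> \<le> int (nat \<lceil>2 * C\<rceil>)" by linarith+
    then show "v \<in> box (nat \<lceil>2 * C\<rceil>)" unfolding box_def mem_Times_iff by auto
  qed
  then show ?thesis using finite_subset finite_box by blast
qed

theorem theorem1:
  shows "AE \<sigma>0 in mu0.
     (\<forall>n::nat. n \<ge> 1 \<longrightarrow>
        (\<forall>\<epsilon>>0. \<exists>\<delta>0>0. \<forall>\<delta>. 0 < \<delta> \<and> \<delta> < \<delta>0 \<longrightarrow>
            haus_le \<epsilon> (curves \<delta> \<sigma>0) (curves \<delta> ((T ^^ n) \<sigma>0)))) \<and>
     (\<forall>\<epsilon>>0. \<exists>\<delta>0>0. \<forall>\<delta>. 0 < \<delta> \<and> \<delta> < \<delta>0 \<longrightarrow>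
            haus_le \<epsilon> (curves \<delta> \<sigma>0) (curves \<delta> (sigma_inf \<sigma>0)))"
  using AE_bounds AE_rot_bounds
proof eventually_elim
  case (elim \<sigma>)
  have sh: "\<exists>K. shadow \<sigma> \<kappa> K" if "\<kappa> > 0" for \<kappa>
    using shadow_if_bounds[of \<sigma> \<kappa>] elim that by blast
  have fin: "finite (ucomp \<sigma> x)" if "unst \<sigma> x" for x
  proof -
    obtain K where "shadow \<sigma> 1 K" using sh[of 1] by auto
    then show ?thesis using finite_ucomp that by blast
  qed
  show ?case
    using haus_le_limit[OF follows_T[OF fin] sh] haus_le_limit[OF follows_sigma_inf[OF fin] sh] by blast
qed

end
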